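(* Let $\Omega\subset\mathbb{R}^N$ be a bounded $C^1$-domain and let $\mathcal{I}(u,x)=\int_{\mathbb{R}^N}[u(x+z)-u(x)]\,\nu_x(dz)$ satisfy assumptions (M0), (M1), (M2), (M3) of the context with the same $\sigma\in(0,1)$. Let $H\in C(\bar\Omega\times\mathbb{R}\times\mathbb{R}^N)$ satisfy (H1) and (H2) of the context with $m>\sigma$, let $f\in C(\bar Q)$, $\varphi\in C(\partial\Omega\times[0,\infty))$, $u_0\in C(\bar\Omega)$, and assume $u_0=\varphi(\cdot,0)$ on $\partial\Omega$. Let $u$ and $v$ be respectively a viscosity subsolution and a viscosity supersolution (with generalized boundary and initial conditions) to $$u_t-\mathcal{I}(u(\cdot,t),x)+H(x,u,Du)=f\ \text{in }Q,\qquad u=\varphi\ \text{on }\partial Q,\qquad u=u_0\ \text{on }\bar\Omega\times\{0\},$$ both bounded on each compact subset of $\bar Q$. Then $$u\le v\quad\text{in }Q\cup(\bar\Omega\times\{0\}).$$ Moreover, if $\tilde u(x,t)=u(x,t)$ for $(x,t)\in Q\cup(\bar\Omega\times\{0\})$ and $\tilde u(x,t)=\limsup_{(y,s)\to(x,t),\,y\in\Omega}u(y,s)$ for $(x,t)\in\partial Q$, then $\tilde u\le v$ in $\bar Q$.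
   Context: Notation: $Q=\Omega\times(0,\infty)$, $\partial Q=\partial\Omega\times(0,\infty)$, $d(x)=\mathrm{dist}(x,\partial\Omega)$, $B_r(x)$ is the open ball, $B_r=B_r(0)$, $B_r^c$ its complement. "$C^1$-domain" means that the boundary is $C^1$, with the convention that there is $\delta_0>0$ such that $d$ is of class $C^1$ in $\{x\in\Omega:d(x)<\delta_0\}$. For each $x\in\bar\Omega$, $\nu_x$ is a nonnegative regular measure on $\mathbb{R}^N$. For $D\subset\mathbb{R}^N$, $\mathcal{I}[D](u,y)=\int_D[u(y+z)-u(y)]\nu_y(dz)$. (M0): (M0-1) $\bigcup_{x\in\bar\Omega}\{x+\mathrm{supp}\,\nu_x\}\subseteq\bar\Omega$. (M0-2) if $x\in\bar\Omega$, $r>0$ and $u\in L^\infty(\bar\Omega)$ is $C^1$ in $B_r(x)$ (i.e. in $B_r(x)\cap\bar\Omega$), then $\mathcal{I}(u,x)$ is well defined, and for any $D\subset\mathbb{R}^N$ the map $y\mapsto\mathcal{I}[D](u,y)$ is continuous in $B_r(x)$ (i.e. in $B_r(x)\cap\bar\Omega$). (M1): there is $C_1>0$ such that for all $\beta\in[0,2]$ and $\delta>0$, $\sup_{x\in\bar\Omega}\int_{B_\delta^c}\min\{1,|z|^\beta\}\nu_x(dz)\le C_1h_{\beta,\sigma}(\delta)$, where $h_{\beta,\sigma}(\delta)=\delta^{\beta-\sigma}$ if $\beta<\sigma$, $=|\ln\delta|+1$ if $\beta=\sigma$, $=1$ if $\beta>\sigma$ (convention $|z|^0=1$). (M2): there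 is $C_2>0$ such that for all $\beta\in(\sigma,2]$ and $\delta\in(0,1)$, $\sup_{x\in\bar\Omega}\int_{B_\delta}|z|^\beta\nu_x(dz)\le C_2\delta^{\beta-\sigma}$. (M3): for each $\beta>0$ there is a modulus of continuity $\omega_{\beta,\sigma}$ such that for all $x,y\in\bar\Omega$, $\delta>0$, $\int_{B_\delta^c}|z|^\beta|\nu_x(dz)-\nu_y(dz)|\le(1+h_{\beta,\sigma}(\delta))\,\omega_{\beta,\sigma}(|x-y|)$, where $|\nu_x-\nu_y|$ is the total variation measure. (H1): for all $R>0$ there is $\lambda_R\ge0$ such that $H(x,u,p)-H(x,v,p)\ge\lambda_R(u-v)$ for all $x\in\bar\Omega$, $p\in\mathbb{R}^N$, $u\ge v$ with $|u|,|v|\le R$. (H2) (with exponent $m$): there is $\underline c>0$ such that for each $R>0$ there is $C_R\ge0$ with $H(x,r,p)\ge\underline c|p|^m-C_R$ for all $x\in\bar\Omega$, $p\in\mathbb{R}^N$, $|r|\le R$. Viscosity solutions: put $\mathcal{E}_\delta(u,\phi,x,t)=\phi_t(x,t)-\mathcal{I}[B_\delta](\phi(\cdot,t),x)-\mathcal{I}[B_\delta^c](u(\cdot,t),x)+H(x,u(x,t),D\phi(x,t))-f(x,t)$. An upper semicontinuous $u:\bar Q\to\mathbb{R}$ is a viscosity subsolution if for each $\phi\in C^1(\bar Q)$ and each maximum point $(x_0,t_0)\in\bar Q$ of $u-\phi$ on $\bar Q$, for all $\delta>0$: $\mathcal{E}_\delta(u,\phi,x_0,t_0)\le0$ if $(x_0,t_0)\in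 Q$; $\min\{\mathcal{E}_\delta(u,\phi,x_0,t_0),u(x_0,t_0)-\varphi(x_0,t_0)\}\le0$ if $(x_0,t_0)\in\partial Q$; $\min\{\mathcal{E}_\delta(u,\phi,x_0,t_0),u(x_0,t_0)-u_0(x_0)\}\le0$ if $t_0=0$. A lower semicontinuous $v$ is a viscosity supersolution if the analogous conditions hold with minimum points of $v-\phi$, reversed inequalities and $\max$ in place of $\min$. *)

theory Defs
  imports "HOL-Analysis.Analysis"
begin

section \<open>Functions of class \<open>C\<^sup>1\<close>, semicontinuity, domains\<close>

text \<open>Derivatives are taken relative to \<open>S\<close>, so that the same notion serves open sets and sets
  such as \<open>closure \<Omega> \<inter> ball x r\<close> or \<open>closure \<Omega> \<times> {0..}\<close>, where it means
  \<open>C\<^sup>1\<close> up to the boundary.\<close>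

definition C1_gradient_on :: "'b::euclidean_space set \<Rightarrow> ('b \<Rightarrow> real) \<Rightarrow> ('b \<Rightarrow> 'b) \<Rightarrow> bool" where
  "C1_gradient_on S f g \<longleftrightarrow>
     (\<forall>x\<in>S. (f has_derivative (\<lambda>h. g x \<bullet> h)) (at x within S)) \<and> continuous_on S g"

definition C1_on :: "'b::euclidean_space set \<Rightarrow> ('b \<Rightarrow> real) \<Rightarrow> bool" where
  "C1_on S f \<longleftrightarrow> (\<exists>g. C1_gradient_on S f g)"

definition usc_on :: "'b::topological_space set \<Rightarrow> ('b \<Rightarrow> real) \<Rightarrow> bool" where
  "usc_on S u \<longleftrightarrow> (\<forall>z\<in>S. \<forall>c. u z < c \<longrightarrow> (\<forall>\<^sub>F w in at z within S. u w < c))"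

definition lsc_on :: "'b::topological_space set \<Rightarrow> ('b \<Rightarrow> real) \<Rightarrow> bool" where
  "lsc_on S v \<longleftrightarrow> (\<forall>z\<in>S. \<forall>c. c < v z \<longrightarrow> (\<forall>\<^sub>F w in at z within S. c < v w))"

text \<open>Near each boundary point \<open>\<Omega>\<close> is the strict epigraph of a \<open>C\<^sup>1\<close> function in some
  orthonormal coordinate system: \<open>e\<close> is the vertical direction and \<open>\<gamma>\<close> is only evaluated at
  the projection of \<open>x\<close> onto the hyperplane orthogonal to \<open>e\<close>.\<close>

definition C1_boundary :: "'a::euclidean_space set \<Rightarrow> bool" where
  "C1_boundary \<Omega> \<longleftrightarrow>
     (\<forall>x0\<in>frontier \<Omega>. \<exists>r>0. \<exists>e \<gamma>. norm e = 1 \<and> C1_on UNIV \<gamma> \<and>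
        \<Omega> \<inter> ball x0 r = {x \<in> ball x0 r. \<gamma> (x - (x \<bullet> e) *\<^sub>R e) < x \<bullet> e})"

definition C1_domain :: "'a::euclidean_space set \<Rightarrow> bool" where
  "C1_domain \<Omega> \<longleftrightarrow> open \<Omega> \<and> connected \<Omega> \<and> \<Omega> \<noteq> {} \<and> C1_boundary \<Omega> \<and>
     (\<exists>\<delta>0>0. C1_on {x\<in>\<Omega>. infdist x (frontier \<Omega>) < \<delta>0} (\<lambda>x. infdist x (frontier \<Omega>)))"


section \<open>Measures\<close>

text \<open>The measures \<open>\<nu> x\<close> may be infinite near the origin, where outer regularity fails already
  for the density \<open>norm z powr (- N - \<sigma>)\<close>. Regularity is therefore understood on the complement
  of the origin.\<close>

definition regular_measure :: "'a::euclidean_space measure \<Rightarrow> bool" where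
  "regular_measure M \<longleftrightarrow> sets M = sets borel \<and>
     (\<forall>A\<in>sets borel. 0 \<notin> A \<longrightarrow>
        emeasure M A = (SUP K\<in>{K. compact K \<and> K \<subseteq> A}. emeasure M K) \<and>
        emeasure M A = (INF U\<in>{U. open U \<and> A \<subseteq> U}. emeasure M U))"

definition measure_support :: "'a::topological_space measure \<Rightarrow> 'a set" where
  "measure_support M = {z. \<forall>U. open U \<longrightarrow> z \<in> U \<longrightarrow> emeasure M U > 0}"

text \<open>The total variation measure of \<open>M - N\<close>, for finite measures with the same measurable sets.\<close>

definition total_variation :: "'a measure \<Rightarrow> 'a measure \<Rightarrow> 'a measure" where
  "total_variation M N = measure_of (space M) (sets M)
     (\<lambda>A. SUP P\<in>{P. finite P \<and> P \<subseteq> sets M \<and> partition_on A P}.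
            \<Sum>B\<in>P. ennreal \<bar>measure M B - measure N B\<bar>)"

text \<open>The set function in this definition is a measure, so \<open>measure_of\<close> does not collapse to the
  zero measure.\<close>

lemma emeasure_total_variation:
  assumes "finite_measure M" "finite_measure N" and sets_eq: "sets N = sets M"
    and A: "A \<in> sets M"
  shows "emeasure (total_variation M N) A =
    (SUP P\<in>{P. finite P \<and> P \<subseteq> sets M \<and> partition_on A P}.
       \<Sum>B\<in>P. ennreal \<bar>measure M B - measure N B\<bar>)"
proof -
  interpret M: finite_measure M by fact
  interpret N: finite_measure N by fact
  define \<mu> where "\<mu> A = (SUP P\<in>{P. finite P \<and> P \<subseteq> sets M \<and> partition_on A P}.
       \<Sum>B\<in>P. ennreal \<bar>measure M B - measure N B\<bar>)" for A
  obtain Y where Y: "Y \<in> sets M"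
    and le: "(\<forall>X\<in>sets M. X \<subseteq> Y \<longrightarrow> emeasure N X \<le> emeasure M X) \<and>
      (\<forall>X\<in>sets M. X \<inter> Y = {} \<longrightarrow> emeasure M X \<le> emeasure N X)"
    using finite_unsigned_Hahn_decomposition[OF assms(1-3)] by (rule bexE)
  have le1': "measure N X \<le> measure M X" if "X \<in> sets M" "X \<subseteq> Y" for X
    using conjunct1[OF le, rule_format, OF that] by (simp add: M.emeasure_eq_measure N.emeasure_eq_measure)
  have le2': "measure M X \<le> measure N X" if "X \<in> sets M" "X \<inter> Y = {}" for X
    using conjunct2[OF le, rule_format, OF that] by (simp add: M.emeasure_eq_measure N.emeasure_eq_measure)
  have mono: "measure N (X \<inter> Y) \<le> measure M (X \<inter> Y)" "measure M (X - Y) \<le> measure N (X - Y)"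
    if "X \<in> sets M" for X
    using that Y by (auto intro: le1' le2')
  define d where "d X = (measure M (X \<inter> Y) - measure N (X \<inter> Y)) +
      (measure N (X - Y) - measure M (X - Y))" for X
  have d_nonneg: "0 \<le> d X" if "X \<in> sets M" for X
    using mono[OF that] unfolding d_def by linarith
  have d_sums: "(\<lambda>i. d (F i)) sums d (\<Union>i. F i)"
    if F: "range F \<subseteq> sets M" "disjoint_family F" for F :: "nat \<Rightarrow> 'a set"
  proof -
    have 1: "range (\<lambda>i. F i \<inter> Y) \<subseteq> sets M" "disjoint_family (\<lambda>i. F i \<inter> Y)"
      and 2: "range (\<lambda>i. F i - Y) \<subseteq> sets M" "disjoint_family (\<lambda>i. F i - Y)"
      using F Y by (auto simp: disjoint_family_on_def)
    have eq: "(\<Union>i. F i) \<inter> Y = (\<Union>i. F i \<inter> Y)" "(\<Union>i. F i) - Y = (\<Union>i. F i - Y)" by auto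
    show ?thesis unfolding d_def eq
      using 1 2 sets_eq
      by (intro sums_add sums_diff M.finite_measure_UNION N.finite_measure_UNION) auto
  qed
  have d_fin: "d (\<Union>P) = (\<Sum>B\<in>P. d B)" if "finite P" "P \<subseteq> sets M" "disjoint P" for P
    using that
  proof (induction P rule: finite_induct)
    case empty
    then show ?case by (simp add: d_def)
  next
    case (insert B P)
    have disj: "B \<inter> \<Union>P = {}"
      using insert.prems insert.hyps by (auto simp: disjoint_def)
    have UP: "\<Union>P \<in> sets M" "B \<in> sets M"
      using insert by (auto intro: sets.finite_Union)
    have eq: "(B \<union> \<Union>P) \<inter> Y = (B \<inter> Y) \<union> (\<Union>P \<inter> Y)" "(B \<union> \<Union>P) - Y = (B - Y) \<union> (\<Union>P - Y)"
      by blast+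
    have sts: "B \<inter> Y \<in> sets M" "\<Union>P \<inter> Y \<in> sets M" "B - Y \<in> sets M" "\<Union>P - Y \<in> sets M"
      using UP Y by blast+
    have dj: "(B \<inter> Y) \<inter> (\<Union>P \<inter> Y) = {}" "(B - Y) \<inter> (\<Union>P - Y) = {}"
      using disj by blast+
    have "d (B \<union> \<Union>P) = d B + d (\<Union>P)"
      unfolding d_def eq
        M.finite_measure_Union[OF sts(1,2) dj(1)] M.finite_measure_Union[OF sts(3,4) dj(2)]
        N.finite_measure_Union[OF sts(1,2)[folded sets_eq] dj(1)]
        N.finite_measure_Union[OF sts(3,4)[folded sets_eq] dj(2)]
      by linarith
    moreover have "d (\<Union>P) = (\<Sum>B\<in>P. d B)"
      using insert by (auto simp: pairwise_insert)
    ultimately show ?case using insert.hyps by simp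
  qed
  have abs_le: "\<bar>measure M B - measure N B\<bar> \<le> d B" if B: "B \<in> sets M" for B
  proof -
    have "measure M B = measure M (B \<inter> Y) + measure M (B - Y)"
      using B Y by (subst M.finite_measure_Union[symmetric]) (auto simp: Int_Diff_Un)
    moreover have "measure N B = measure N (B \<inter> Y) + measure N (B - Y)"
      using B Y sets_eq by (subst N.finite_measure_Union[symmetric]) (auto simp: Int_Diff_Un)
    moreover have "measure N (B \<inter> Y) \<le> measure M (B \<inter> Y)" "measure M (B - Y) \<le> measure N (B - Y)"
      using mono[OF B] by auto
    ultimately show ?thesis unfolding d_def by linarith
  qed
  have \<mu>_d: "\<mu> A = ennreal (d A)" if A: "A \<in> sets M" for A
  proof (rule antisym)
    show "\<mu> A \<le> ennreal (d A)"
      unfolding \<mu>_def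
    proof (rule SUP_least)
      fix P assume "P \<in> {P. finite P \<and> P \<subseteq> sets M \<and> partition_on A P}"
      then have P: "finite P" "P \<subseteq> sets M" "disjoint P" "\<Union>P = A"
        by (auto simp: partition_on_def)
      have "(\<Sum>B\<in>P. ennreal \<bar>measure M B - measure N B\<bar>) \<le> (\<Sum>B\<in>P. ennreal (d B))"
        using P abs_le by (intro sum_mono ennreal_leI) auto
      also have "\<dots> = ennreal (\<Sum>B\<in>P. d B)"
        using P d_nonneg by (intro sum_ennreal) auto
      also have "\<dots> = ennreal (d A)"
        using d_fin[OF P(1-3)] P(4) by simp
      finally show "(\<Sum>B\<in>P. ennreal \<bar>measure M B - measure N B\<bar>) \<le> ennreal (d A)" .
    qed
  next
    let ?P = "{A \<inter> Y, A - Y} - {{}}"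
    have P: "finite ?P" "?P \<subseteq> sets M" "partition_on A ?P"
      using A Y by (auto simp: partition_on_def disjoint_def)
    have "ennreal (d A) = (\<Sum>B\<in>{A \<inter> Y, A - Y}. ennreal \<bar>measure M B - measure N B\<bar>)"
    proof (cases "A \<inter> Y = A - Y")
      case True
      then have "A = {}" by auto
      then show ?thesis by (simp add: d_def)
    next
      case False
      have "\<bar>measure M (A \<inter> Y) - measure N (A \<inter> Y)\<bar> = measure M (A \<inter> Y) - measure N (A \<inter> Y)"
        "\<bar>measure M (A - Y) - measure N (A - Y)\<bar> = measure N (A - Y) - measure M (A - Y)"
        using mono[OF A] by linarith+
      moreover have "ennreal (d A) = ennreal (measure M (A \<inter> Y) - measure N (A \<inter> Y)) +
          ennreal (measure N (A - Y) - measure M (A - Y))"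
        unfolding d_def using mono[OF A] by (intro ennreal_plus) linarith+
      ultimately show ?thesis
        using False by (simp only: sum.insert sum.empty finite.intros singleton_iff empty_iff
            not_False_eq_True add_0_right)
    qed
    also have "\<dots> = (\<Sum>B\<in>?P. ennreal \<bar>measure M B - measure N B\<bar>)"
      by (rule sum.mono_neutral_right) auto
    also have "\<dots> \<le> \<mu> A"
      unfolding \<mu>_def using P by (intro SUP_upper) auto
    finally show "ennreal (d A) \<le> \<mu> A" .
  qed
  have "countably_additive (sets M) \<mu>"
  proof (rule countably_additiveI)
    fix F :: "nat \<Rightarrow> 'a set"
    assume F: "range F \<subseteq> sets M" "disjoint_family F" "(\<Union>i. F i) \<in> sets M"
    have "(\<Sum>i. ennreal (d (F i))) = ennreal (d (\<Union>i. F i))"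
      using F d_nonneg d_sums by (intro suminf_ennreal_eq) auto
    then show "(\<Sum>i. \<mu> (F i)) = \<mu> (\<Union>i. F i)"
      using F \<mu>_d by (simp add: image_subset_iff)
  qed
  moreover have "positive (sets M) \<mu>"
    using \<mu>_d[of "{}"] by (simp add: positive_def d_def)
  ultimately have "emeasure (measure_of (space M) (sets M) \<mu>) A = \<mu> A"
    using A by (intro emeasure_measure_of_sigma) (auto simp: sets.sigma_algebra_axioms)
  then show ?thesis
    unfolding total_variation_def \<mu>_def .
qed


section \<open>The nonlocal operator and its assumptions\<close>

text \<open>Functions \<open>u\<close> matter only on \<open>closure \<Omega>\<close>. By the support condition \<open>assm_M0_1\<close> below, the translates
  \<open>y + z\<close> outside \<open>closure \<Omega>\<close> carry no mass; they are removed from the domain of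
  integration so that the values of \<open>u\<close> there (and their measurability) play no role.\<close>

definition nonlocal_op ::
  "'a::euclidean_space set \<Rightarrow> ('a \<Rightarrow> 'a measure) \<Rightarrow> 'a set \<Rightarrow> ('a \<Rightarrow> real) \<Rightarrow> 'a \<Rightarrow> real" where
  "nonlocal_op \<Omega> \<nu> D u y = (LINT z : (D \<inter> {z. y + z \<in> closure \<Omega>}) | \<nu> y. u (y + z) - u y)"

definition nonlocal_well_defined ::
  "'a::euclidean_space set \<Rightarrow> ('a \<Rightarrow> 'a measure) \<Rightarrow> ('a \<Rightarrow> real) \<Rightarrow> 'a \<Rightarrow> bool" where
  "nonlocal_well_defined \<Omega> \<nu> u y \<longleftrightarrow>
     set_integrable (\<nu> y) {z. y + z \<in> closure \<Omega>} (\<lambda>z. u (y + z) - u y)"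

definition assm_M0_1 :: "'a::euclidean_space set \<Rightarrow> ('a \<Rightarrow> 'a measure) \<Rightarrow> bool" where
  "assm_M0_1 \<Omega> \<nu> \<longleftrightarrow> (\<Union>x\<in>closure \<Omega>. (\<lambda>z. x + z) ` measure_support (\<nu> x)) \<subseteq> closure \<Omega>"

text \<open>\<open>L\<^sup>\<infinity>\<close> is read as bounded and Borel measurable: the \<open>\<nu> x\<close> need not be
  absolutely continuous, so Lebesgue classes would not determine the integrals.\<close>

definition assm_M0_2 :: "'a::euclidean_space set \<Rightarrow> ('a \<Rightarrow> 'a measure) \<Rightarrow> bool" where
  "assm_M0_2 \<Omega> \<nu> \<longleftrightarrow>
     (\<forall>x\<in>closure \<Omega>. \<forall>r>0. \<forall>u.
        u \<in> borel_measurable (restrict_space borel (closure \<Omega>)) \<longrightarrow>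
        bounded (u ` closure \<Omega>) \<longrightarrow> C1_on (ball x r \<inter> closure \<Omega>) u \<longrightarrow>
          nonlocal_well_defined \<Omega> \<nu> u x \<and>
          (\<forall>D\<in>sets borel. continuous_on (ball x r \<inter> closure \<Omega>) (nonlocal_op \<Omega> \<nu> D u)))"

definition assm_M0 :: "'a::euclidean_space set \<Rightarrow> ('a \<Rightarrow> 'a measure) \<Rightarrow> bool" where
  "assm_M0 \<Omega> \<nu> \<longleftrightarrow> assm_M0_1 \<Omega> \<nu> \<and> assm_M0_2 \<Omega> \<nu>"

definition h_fun :: "real \<Rightarrow> real \<Rightarrow> real \<Rightarrow> real" where
  "h_fun \<beta> \<sigma> \<delta> =
     (if \<beta> < \<sigma> then \<delta> powr (\<beta> - \<sigma>) else if \<beta> = \<sigma> then \<bar>ln \<delta>\<bar> + 1 else 1)"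

text \<open>The convention \<open>\<bar>z\<bar>\<^sup>0 = 1\<close> agrees with \<open>powr\<close>, as \<open>z \<noteq> 0\<close> off the ball.\<close>

definition assm_M1 :: "real \<Rightarrow> 'a::euclidean_space set \<Rightarrow> ('a \<Rightarrow> 'a measure) \<Rightarrow> bool" where
  "assm_M1 \<sigma> \<Omega> \<nu> \<longleftrightarrow>
     (\<exists>C1>0. \<forall>\<beta>\<in>{0..2}. \<forall>\<delta>>0.
        (SUP x\<in>closure \<Omega>. \<integral>\<^sup>+z\<in>- ball 0 \<delta>. ennreal (min 1 (norm z powr \<beta>)) \<partial>\<nu> x)
          \<le> ennreal (C1 * h_fun \<beta> \<sigma> \<delta>))"

definition assm_M2 :: "real \<Rightarrow> 'a::euclidean_space set \<Rightarrow> ('a \<Rightarrow> 'a measure) \<Rightarrow> bool" where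
  "assm_M2 \<sigma> \<Omega> \<nu> \<longleftrightarrow>
     (\<exists>C2>0. \<forall>\<beta>\<in>{\<sigma><..2}. \<forall>\<delta>\<in>{0<..<1}.
        (SUP x\<in>closure \<Omega>. \<integral>\<^sup>+z\<in>ball 0 \<delta>. ennreal (norm z powr \<beta>) \<partial>\<nu> x)
          \<le> ennreal (C2 * \<delta> powr (\<beta> - \<sigma>)))"

definition modulus_of_continuity :: "(real \<Rightarrow> real) \<Rightarrow> bool" where
  "modulus_of_continuity \<omega> \<longleftrightarrow>
     mono_on {0..} \<omega> \<and> \<omega> 0 = 0 \<and> (\<omega> \<longlongrightarrow> 0) (at_right 0)"

text \<open>The measures are restricted to the complement of the ball before the total variation is
  taken, since \<open>\<nu> x - \<nu> y\<close> need not be a signed measure near the origin.\<close>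

definition assm_M3 :: "real \<Rightarrow> 'a::euclidean_space set \<Rightarrow> ('a \<Rightarrow> 'a measure) \<Rightarrow> bool" where
  "assm_M3 \<sigma> \<Omega> \<nu> \<longleftrightarrow>
     (\<forall>\<beta>>0. \<exists>\<omega>. modulus_of_continuity \<omega> \<and>
        (\<forall>x\<in>closure \<Omega>. \<forall>y\<in>closure \<Omega>. \<forall>\<delta>>0.
           (\<integral>\<^sup>+z. ennreal (norm z powr \<beta>)
              \<partial>total_variation (restrict_space (\<nu> x) (- ball 0 \<delta>)) (restrict_space (\<nu> y) (- ball 0 \<delta>)))
           \<le> ennreal ((1 + h_fun \<beta> \<sigma> \<delta>) * \<omega> (norm (x - y)))))"


section \<open>The Hamiltonian\<close>

definition assm_H1 :: "'a::euclidean_space set \<Rightarrow> ('a \<Rightarrow> real \<Rightarrow> 'a \<Rightarrow> real) \<Rightarrow> bool" where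
  "assm_H1 \<Omega> H \<longleftrightarrow>
     (\<forall>R>0. \<exists>L\<ge>0. \<forall>x\<in>closure \<Omega>. \<forall>p u v. v \<le> u \<longrightarrow> \<bar>u\<bar> \<le> R \<longrightarrow> \<bar>v\<bar> \<le> R \<longrightarrow>
        H x u p - H x v p \<ge> L * (u - v))"

definition assm_H2 :: "real \<Rightarrow> 'a::euclidean_space set \<Rightarrow> ('a \<Rightarrow> real \<Rightarrow> 'a \<Rightarrow> real) \<Rightarrow> bool" where
  "assm_H2 m \<Omega> H \<longleftrightarrow>
     (\<exists>c>0. \<forall>R>0. \<exists>CR\<ge>0. \<forall>x\<in>closure \<Omega>. \<forall>p r. \<bar>r\<bar> \<le> R \<longrightarrow>
        H x r p \<ge> c * norm p powr m - CR)"


section \<open>Viscosity solutions with generalized boundary and initial conditions\<close>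

definition Qbar :: "'a::euclidean_space set \<Rightarrow> ('a \<times> real) set" where
  "Qbar \<Omega> = closure \<Omega> \<times> {0..}"

definition Qcyl :: "'a::euclidean_space set \<Rightarrow> ('a \<times> real) set" where
  "Qcyl \<Omega> = \<Omega> \<times> {0<..}"

definition lateral :: "'a::euclidean_space set \<Rightarrow> ('a \<times> real) set" where
  "lateral \<Omega> = frontier \<Omega> \<times> {0<..}"

text \<open>The argument \<open>g\<close> is the space-time gradient of the test function \<open>\<psi>\<close>:
  \<open>fst (g z)\<close> is \<open>D\<psi>\<close> and \<open>snd (g z)\<close> is \<open>\<psi>\<^sub>t\<close>.\<close>

definition visc_E ::
  "'a::euclidean_space set \<Rightarrow> ('a \<Rightarrow> 'a measure) \<Rightarrow> ('a \<Rightarrow> real \<Rightarrow> 'a \<Rightarrow> real) \<Rightarrow> ('a \<times> real \<Rightarrow> real) \<Rightarrow>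
   real \<Rightarrow> ('a \<times> real \<Rightarrow> real) \<Rightarrow> ('a \<times> real \<Rightarrow> real) \<Rightarrow> ('a \<times> real \<Rightarrow> 'a \<times> real) \<Rightarrow>
   'a \<Rightarrow> real \<Rightarrow> real" where
  "visc_E \<Omega> \<nu> H f \<delta> u \<psi> g x t =
     snd (g (x, t))
     - nonlocal_op \<Omega> \<nu> (ball 0 \<delta>) (\<lambda>y. \<psi> (y, t)) x
     - nonlocal_op \<Omega> \<nu> (- ball 0 \<delta>) (\<lambda>y. u (y, t)) x
     + H x (u (x, t)) (fst (g (x, t))) - f (x, t)"

definition visc_subsolution ::
  "'a::euclidean_space set \<Rightarrow> ('a \<Rightarrow> 'a measure) \<Rightarrow> ('a \<Rightarrow> real \<Rightarrow> 'a \<Rightarrow> real) \<Rightarrow> ('a \<times> real \<Rightarrow> real) \<Rightarrow>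
   ('a \<times> real \<Rightarrow> real) \<Rightarrow> ('a \<Rightarrow> real) \<Rightarrow> ('a \<times> real \<Rightarrow> real) \<Rightarrow> bool" where
  "visc_subsolution \<Omega> \<nu> H f \<phi> u0 u \<longleftrightarrow> usc_on (Qbar \<Omega>) u \<and>
     (\<forall>\<psi> g. C1_gradient_on (Qbar \<Omega>) \<psi> g \<longrightarrow>
       (\<forall>x t. (x, t) \<in> Qbar \<Omega> \<longrightarrow> (\<forall>z\<in>Qbar \<Omega>. u z - \<psi> z \<le> u (x, t) - \<psi> (x, t)) \<longrightarrow>
         (\<forall>\<delta>>0.
            ((x, t) \<in> Qcyl \<Omega> \<longrightarrow> visc_E \<Omega> \<nu> H f \<delta> u \<psi> g x t \<le> 0) \<and>
            ((x, t) \<in> lateral \<Omega> \<longrightarrow>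
               min (visc_E \<Omega> \<nu> H f \<delta> u \<psi> g x t) (u (x, t) - \<phi> (x, t)) \<le> 0) \<and>
            (t = 0 \<longrightarrow> min (visc_E \<Omega> \<nu> H f \<delta> u \<psi> g x t) (u (x, t) - u0 x) \<le> 0))))"

definition visc_supersolution ::
  "'a::euclidean_space set \<Rightarrow> ('a \<Rightarrow> 'a measure) \<Rightarrow> ('a \<Rightarrow> real \<Rightarrow> 'a \<Rightarrow> real) \<Rightarrow> ('a \<times> real \<Rightarrow> real) \<Rightarrow>
   ('a \<times> real \<Rightarrow> real) \<Rightarrow> ('a \<Rightarrow> real) \<Rightarrow> ('a \<times> real \<Rightarrow> real) \<Rightarrow> bool" where
  "visc_supersolution \<Omega> \<nu> H f \<phi> u0 v \<longleftrightarrow> lsc_on (Qbar \<Omega>) v \<and>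
     (\<forall>\<psi> g. C1_gradient_on (Qbar \<Omega>) \<psi> g \<longrightarrow>
       (\<forall>x t. (x, t) \<in> Qbar \<Omega> \<longrightarrow> (\<forall>z\<in>Qbar \<Omega>. v (x, t) - \<psi> (x, t) \<le> v z - \<psi> z) \<longrightarrow>
         (\<forall>\<delta>>0.
            ((x, t) \<in> Qcyl \<Omega> \<longrightarrow> visc_E \<Omega> \<nu> H f \<delta> v \<psi> g x t \<ge> 0) \<and>
            ((x, t) \<in> lateral \<Omega> \<longrightarrow>
               max (visc_E \<Omega> \<nu> H f \<delta> v \<psi> g x t) (v (x, t) - \<phi> (x, t)) \<ge> 0) \<and>
            (t = 0 \<longrightarrow> max (visc_E \<Omega> \<nu> H f \<delta> v \<psi> g x t) (v (x, t) - u0 x) \<ge> 0))))"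

definition locally_bounded_on :: "'b::topological_space set \<Rightarrow> ('b \<Rightarrow> real) \<Rightarrow> bool" where
  "locally_bounded_on S u \<longleftrightarrow> (\<forall>K. compact K \<longrightarrow> K \<subseteq> S \<longrightarrow> bounded (u ` K))"

definition u_tilde :: "'a::euclidean_space set \<Rightarrow> ('a \<times> real \<Rightarrow> real) \<Rightarrow> 'a \<times> real \<Rightarrow> ereal" where
  "u_tilde \<Omega> u z =
     (if z \<in> lateral \<Omega> then Limsup (at z within (\<Omega> \<times> {0..})) (\<lambda>w. ereal (u w)) else ereal (u z))"

end

theory Submission
  imports Defs
begin

text \<open>The only regularity that is needed is a Lipschitz bound in space for the subsolution, up to the
  boundary and uniform in time after a time penalization (\<open>lipschitz_estimate\<close>): at a maximum point of
  \<open>u(x,t) - \<theta>(t) - L |x - y|\<close> the equation gives \<open>L\<^sup>m \<le> C (1 + L\<^sup>\<sigma>)\<close>, because the nonlocal term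
  grows at most like \<open>L\<^sup>\<sigma>\<close>; this is impossible for large \<open>L\<close>, as \<open>\<sigma> < m\<close>. Maximum points are kept off
  the boundary by the barrier \<open>A g\<^sup>a + \<rho> ln g\<close> with \<open>a = 1 - \<sigma>/m\<close>, where \<open>g\<close> is a local defining
  function of the domain. The exponent \<open>a\<close> makes the \<open>m\<close>-th power of the slope of the barrier dominate
  \<open>dist\<^sup>-\<^sup>\<sigma>\<close>, the size of the nonlocal term there.

  In the comparison the penalization \<open>L |x - y - \<epsilon> e|\<close> has a fixed slope and \<open>e\<close> points inwards, so the
  Lipschitz bound places \<open>x\<close> inside the domain while \<open>y\<close> may lie on the boundary. All gradients stay
  bounded, so continuity of \<open>H\<close> suffices, and the two measures are compared in total variation. Interior
  measures do not charge the boundary, so the boundary values of \<open>u\<close> do not matter.\<close>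

text \<open>(H2) excludes steep test functions above the subsolution and says nothing about those
  below the supersolution, so regularity is available for \<open>u\<close> alone. (H1) allows the
  constant 0, so the strictness needed to contradict the two equations comes from a term
  \<open>\<kappa> * s\<close> in time. The subsolution may jump at the lateral boundary. Hence
  \<open>x\<close> ranges over the open domain, the supremum of the doubled function need not be
  attained, and its role is taken by an upper limit \<open>M\<close> as \<open>x - y\<close> tends
  to 0. A common jump \<open>x + z\<close>, \<open>y + z\<close> does not change
  \<open>x - y\<close>, so the jumped pair still competes for \<open>M\<close>; this controls the
  nonlocal terms away from the origin. The order of the constants matters. The slope
  \<open>L\<close> depends on sup bounds and on the geometry, not on the barrier, whose parameters
  may shrink with the point \<open>y\<close> and leave no trace. After \<open>L\<close> come the
  radius \<open>\<delta>\<close> of small jumps, the tolerance \<open>\<mu>\<close>, small against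
  the jump mass outside that radius, and finally the shift \<open>\<epsilon>\<close>.\<close>

section \<open>Integrals against measures that are close in total variation\<close>

lemma nn_integral_mono_emeasure:
  assumes s: "sets N = sets M" and le: "\<And>X. X \<in> sets M \<Longrightarrow> emeasure N X \<le> emeasure M X"
    and f: "f \<in> borel_measurable M"
  shows "(\<integral>\<^sup>+x. f x \<partial>N) \<le> (\<integral>\<^sup>+x. f x \<partial>M)"
  using f
proof (induct f rule: borel_measurable_induct)
  case (cong f g)
  have "(\<integral>\<^sup>+x. f x \<partial>N) = (\<integral>\<^sup>+x. g x \<partial>N)"
    using cong(3) sets_eq_imp_space_eq[OF s] by (intro nn_integral_cong) auto
  moreover have "(\<integral>\<^sup>+x. f x \<partial>M) = (\<integral>\<^sup>+x. g x \<partial>M)"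
    using cong(3) by (intro nn_integral_cong) auto
  ultimately show ?case using cong by simp
next
  case (set A)
  then show ?case using le s by simp
next
  case (mult u c)
  have "u \<in> borel_measurable N" using mult(2) s by (simp cong: measurable_cong_sets)
  then show ?case using mult by (simp add: nn_integral_cmult mult_left_mono)
next
  case (add u v)
  have "u \<in> borel_measurable N" "v \<in> borel_measurable N"
    using add s by (simp_all cong: measurable_cong_sets)
  then show ?case using add by (simp add: nn_integral_add add_mono)
next
  case (seq U)
  have [measurable]: "U i \<in> borel_measurable N" "U i \<in> borel_measurable M" for i
    using seq(1) s by (simp_all cong: measurable_cong_sets)
  have N: "(\<integral>\<^sup>+x. (SUP i. U i x) \<partial>N) = (SUP i. \<integral>\<^sup>+x. U i x \<partial>N)"
    and M: "(\<integral>\<^sup>+x. (SUP i. U i x) \<partial>M) = (SUP i. \<integral>\<^sup>+x. U i x \<partial>M)"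
    using seq(4) by (intro nn_integral_monotone_convergence_SUP; simp)+
  have *: "Sup (range U) = (\<lambda>x. SUP i. U i x)"
    by (auto simp: fun_eq_iff image_comp)
  show ?case unfolding * N M by (intro SUP_mono) (use seq in auto)
qed

text \<open>Domination is known only on subsets of \<open>Y\<close>, one side of a Hahn
  decomposition; passing to densities with the indicator of \<open>Y\<close> turns it into
  domination on all measurable sets.\<close>

lemma integral_indicator_mono_measure:
  fixes k :: "'a \<Rightarrow> real"
  assumes fM: "finite_measure M" and fN: "finite_measure N" and s: "sets N = sets M"
    and Y: "Y \<in> sets M"
    and le: "\<And>X. X \<in> sets M \<Longrightarrow> X \<subseteq> Y \<Longrightarrow> emeasure N X \<le> emeasure M X"
    and k: "k \<in> borel_measurable M" "\<And>x. 0 \<le> k x" "\<And>x. k x \<le> K"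
  shows "(\<integral>x. indicator Y x * k x \<partial>N) \<le> (\<integral>x. indicator Y x * k x \<partial>M)"
proof -
  interpret M: finite_measure M by fact
  interpret N: finite_measure N by fact
  have kN: "k \<in> borel_measurable N" and YN: "Y \<in> sets N"
    using k s Y by (simp_all cong: measurable_cong_sets)
  have iM: "integrable M (\<lambda>x. indicator Y x * k x)"
    using k Y by (intro M.integrable_const_bound[of _ "K"]) (auto simp: indicator_def intro: order_trans)
  have iN: "integrable N (\<lambda>x. indicator Y x * k x)"
    using k kN YN by (intro N.integrable_const_bound[of _ "K"]) (auto simp: indicator_def intro: order_trans)
  have "(\<integral>\<^sup>+x. ennreal (k x) \<partial>density N (indicator Y)) \<le> (\<integral>\<^sup>+x. ennreal (k x) \<partial>density M (indicator Y))"
  proof (rule nn_integral_mono_emeasure)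
    fix X assume "X \<in> sets (density M (indicator Y))"
    then have X: "X \<in> sets M" "X \<in> sets N" using s by auto
    have "emeasure (density N (indicator Y)) X = emeasure N (X \<inter> Y)"
      using X YN by (simp add: emeasure_density indicator_inter_arith[symmetric] Int_commute)
    moreover have "emeasure (density M (indicator Y)) X = emeasure M (X \<inter> Y)"
      using X Y by (simp add: emeasure_density indicator_inter_arith[symmetric] Int_commute)
    ultimately show "emeasure (density N (indicator Y)) X \<le> emeasure (density M (indicator Y)) X"
      using le[of "X \<inter> Y"] X Y by auto
  qed (use s k in auto)
  also have "(\<integral>\<^sup>+x. ennreal (k x) \<partial>density N (indicator Y)) = (\<integral>\<^sup>+x. ennreal (indicator Y x * k x) \<partial>N)"
    using kN YN by (subst nn_integral_density) (auto intro!: nn_integral_cong simp: indicator_def)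
  also have "(\<integral>\<^sup>+x. ennreal (k x) \<partial>density M (indicator Y)) = (\<integral>\<^sup>+x. ennreal (indicator Y x * k x) \<partial>M)"
    using k Y by (subst nn_integral_density) (auto intro!: nn_integral_cong simp: indicator_def)
  also have "(\<integral>\<^sup>+x. ennreal (indicator Y x * k x) \<partial>N) = ennreal (\<integral>x. indicator Y x * k x \<partial>N)"
    using iN k by (intro nn_integral_eq_integral) auto
  also have "(\<integral>\<^sup>+x. ennreal (indicator Y x * k x) \<partial>M) = ennreal (\<integral>x. indicator Y x * k x \<partial>M)"
    using iM k by (intro nn_integral_eq_integral) auto
  finally show ?thesis
    using k by (subst (asm) ennreal_le_iff) (auto intro!: integral_nonneg_AE)
qed

text \<open>On the part \<open>Z\<close> of a Hahn decomposition where \<open>N\<close> dominates,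
  the integrals compare at once. On the part \<open>Y\<close> where \<open>M\<close> dominates, the
  comparison is applied to \<open>K - c\<close>, which reverses it; the price
  \<open>K * (measure M Y - measure N Y)\<close> is at most \<open>K * \<mu>\<close>.\<close>

lemma integral_le_close_measure:
  fixes c :: "'a \<Rightarrow> real"
  assumes fM: "finite_measure M" and fN: "finite_measure N" and s: "sets N = sets M"
    and close: "\<And>X. X \<in> sets M \<Longrightarrow> measure M X \<le> measure N X + \<mu>"
    and c: "c \<in> borel_measurable M" "\<And>x. 0 \<le> c x" "\<And>x. c x \<le> K"
  shows "(\<integral>x. c x \<partial>M) \<le> (\<integral>x. c x \<partial>N) + K * \<mu>"
proof -
  interpret M: finite_measure M by fact
  interpret N: finite_measure N by fact
  have sp: "space N = space M" using s by (rule sets_eq_imp_space_eq)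
  obtain Y where Y: "Y \<in> sets M"
    and le: "\<forall>X\<in>sets M. X \<subseteq> Y \<longrightarrow> emeasure N X \<le> emeasure M X"
      "\<forall>X\<in>sets M. X \<inter> Y = {} \<longrightarrow> emeasure M X \<le> emeasure N X"
    using finite_unsigned_Hahn_decomposition[OF fM fN s] by blast
  have cN: "c \<in> borel_measurable N" and YN: "Y \<in> sets N"
    using c s Y by (simp_all cong: measurable_cong_sets)
  define Z where "Z = space M - Y"
  have Z: "Z \<in> sets M" "Z \<in> sets N" using Y s by (auto simp: Z_def)
  have K: "0 \<le> K" using c(2,3) order_trans by blast
  have bM: "integrable M (\<lambda>x. indicator A x * k x)" if "A \<in> sets M" "k \<in> borel_measurable M" "\<And>x. 0 \<le> k x" "\<And>x. k x \<le> K" for A and k :: "'a \<Rightarrow> real"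
    using that K by (intro M.integrable_const_bound[of _ "K"]) (auto simp: indicator_def)
  have bN: "integrable N (\<lambda>x. indicator A x * k x)" if "A \<in> sets N" "k \<in> borel_measurable N" "\<And>x. 0 \<le> k x" "\<And>x. k x \<le> K" for A and k :: "'a \<Rightarrow> real"
    using that K by (intro N.integrable_const_bound[of _ "K"]) (auto simp: indicator_def)
  have 1: "(\<integral>x. indicator Z x * c x \<partial>M) \<le> (\<integral>x. indicator Z x * c x \<partial>N)"
    using le(2) Z s cN c by (intro integral_indicator_mono_measure[where K=K]) (auto simp: Z_def fM fN)
  have 2: "(\<integral>x. indicator Y x * (K - c x) \<partial>N) \<le> (\<integral>x. indicator Y x * (K - c x) \<partial>M)"
    using le(1) Y s c by (intro integral_indicator_mono_measure[where K=K]) (auto simp: fM fN)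
  have dM: "(\<integral>x. indicator Y x * (K - c x) \<partial>M) = K * measure M Y - (\<integral>x. indicator Y x * c x \<partial>M)"
    using bM[OF Y c] Y by (simp add: right_diff_distrib M.emeasure_eq_measure)
  have dN: "(\<integral>x. indicator Y x * (K - c x) \<partial>N) = K * measure N Y - (\<integral>x. indicator Y x * c x \<partial>N)"
    using bN[OF YN cN c(2,3)] YN by (simp add: right_diff_distrib N.emeasure_eq_measure)
  have "(\<integral>x. c x \<partial>M) = (\<integral>x. indicator Y x * c x + indicator Z x * c x \<partial>M)"
    by (rule Bochner_Integration.integral_cong) (auto simp: Z_def indicator_def)
  also have "\<dots> = (\<integral>x. indicator Y x * c x \<partial>M) + (\<integral>x. indicator Z x * c x \<partial>M)"
    using bM[OF Y c] bM[OF Z(1) c] by (rule Bochner_Integration.integral_add)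
  finally have sM: "(\<integral>x. c x \<partial>M) = (\<integral>x. indicator Y x * c x \<partial>M) + (\<integral>x. indicator Z x * c x \<partial>M)" .
  have "(\<integral>x. c x \<partial>N) = (\<integral>x. indicator Y x * c x + indicator Z x * c x \<partial>N)"
    by (rule Bochner_Integration.integral_cong) (auto simp: Z_def indicator_def sp)
  also have "\<dots> = (\<integral>x. indicator Y x * c x \<partial>N) + (\<integral>x. indicator Z x * c x \<partial>N)"
    using bN[OF YN cN c(2,3)] bN[OF Z(2) cN c(2,3)] by (rule Bochner_Integration.integral_add)
  finally have sN: "(\<integral>x. c x \<partial>N) = (\<integral>x. indicator Y x * c x \<partial>N) + (\<integral>x. indicator Z x * c x \<partial>N)" .
  have "K * measure M Y \<le> K * (measure N Y + \<mu>)"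
    using close[OF Y] K by (rule mult_left_mono)
  then show ?thesis using 1 2 unfolding dM dN sM sN by (simp add: algebra_simps)
qed

text \<open>Meant for \<open>a\<close> and \<open>b\<close> the increments of \<open>u\<close> at
  \<open>x\<close> and of \<open>v\<close> at \<open>y\<close>, and \<open>B\<close> the jumps that
  keep \<open>y\<close> in the closed domain: \<open>B\<close> carries \<open>N\<close>, but not
  necessarily \<open>M\<close>. The error is \<open>2 * K * \<mu>\<close> for an integrand shifted
  into the range from 0 to \<open>2 * K\<close>, and \<open>K * \<mu>\<close> for undoing the shift
  through the total masses.\<close>

lemma integral_diff_close_measures:
  fixes a b :: "'a \<Rightarrow> real"
  assumes fM: "finite_measure M" and fN: "finite_measure N" and s: "sets N = sets M"
    and close: "\<And>X. X \<in> sets M \<Longrightarrow> \<bar>measure M X - measure N X\<bar> \<le> \<mu>"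
    and a: "a \<in> borel_measurable M" "\<And>x. \<bar>a x\<bar> \<le> K"
    and b: "b \<in> borel_measurable M" "\<And>x. \<bar>b x\<bar> \<le> K"
    and B: "B \<in> sets M" "AE x in N. x \<in> B"
    and ab: "AE x in M. x \<in> B \<longrightarrow> a x \<le> b x + \<kappa>" and \<kappa>: "0 \<le> \<kappa>"
  shows "(\<integral>x. a x \<partial>M) - (\<integral>x. b x \<partial>N) \<le> \<kappa> * measure M (space M) + 3 * K * \<mu>"
proof -
  interpret M: finite_measure M by fact
  interpret N: finite_measure N by fact
  have sp: "space N = space M" using s by (rule sets_eq_imp_space_eq)
  \<comment> \<open>Raising \<open>b\<close> to \<open>K\<close> off \<open>B\<close> is invisible
    to \<open>N\<close> and makes \<open>a \<le> b' + \<kappa>\<close> trivial there for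
    \<open>M\<close>.\<close>
  define b' where "b' x = (if x \<in> B then b x else K)" for x
  have b': "b' \<in> borel_measurable M" "\<bar>b' x\<bar> \<le> K" for x
  proof -
    show "b' \<in> borel_measurable M" unfolding b'_def using b B by measurable
    show "\<bar>b' x\<bar> \<le> K" using b(2)[of x] by (auto simp: b'_def)
  qed
  have bN: "b \<in> borel_measurable N" "b' \<in> borel_measurable N"
    using b b' s by (simp_all cong: measurable_cong_sets)
  have iaM: "integrable M a" using a by (intro M.integrable_const_bound[of _ K]) auto
  have ibM: "integrable M b'" using b' by (intro M.integrable_const_bound[of _ K]) auto
  have ibN: "integrable N b'" using b' bN by (intro N.integrable_const_bound[of _ K]) auto
  have K: "0 \<le> K" using a(2) abs_ge_zero order_trans by blast
  have "(\<integral>x. a x \<partial>M) \<le> (\<integral>x. b' x + \<kappa> \<partial>M)"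
  proof (rule integral_mono_AE)
    show "AE x in M. a x \<le> b' x + \<kappa>"
      using ab by eventually_elim (use a(2) \<kappa> in \<open>auto simp: b'_def abs_le_iff intro: order_trans add_increasing2\<close>)
  qed (use iaM ibM in auto)
  also have "\<dots> = (\<integral>x. b' x \<partial>M) + \<kappa> * measure M (space M)"
    using ibM by simp
  finally have 1: "(\<integral>x. a x \<partial>M) \<le> (\<integral>x. b' x \<partial>M) + \<kappa> * measure M (space M)" .
  have "(\<integral>x. b' x + K \<partial>M) \<le> (\<integral>x. b' x + K \<partial>N) + (2 * K) * \<mu>"
  proof (rule integral_le_close_measure[OF fM fN s])
    show "measure M X \<le> measure N X + \<mu>" if "X \<in> sets M" for X
      using close[OF that] by linarith
    show "0 \<le> b' x + K" "b' x + K \<le> 2 * K" for x using b'(2)[of x] by (auto simp: abs_le_iff)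
  qed (use b' in auto)
  then have 2: "(\<integral>x. b' x \<partial>M) + K * measure M (space M) \<le> (\<integral>x. b' x \<partial>N) + K * measure N (space M) + 2 * K * \<mu>"
    using ibM ibN by (simp add: sp mult.commute)
  have "K * measure N (space M) \<le> K * (measure M (space M) + \<mu>)"
    using close[OF sets.top] K by (intro mult_left_mono) auto
  moreover have "(\<integral>x. b' x \<partial>N) = (\<integral>x. b x \<partial>N)"
    using bN(2,1) by (rule integral_cong_AE) (use B(2) in \<open>auto simp: b'_def elim: eventually_mono\<close>)
  ultimately show ?thesis using 1 2 by (simp add: algebra_simps)
qed

section \<open>Jump measures: support, tails and dependence on the base point\<close>

text \<open>\<open>tail\<close> is (M1) at exponent 0, and \<open>near\<close> is (M2) at exponent
  1, which is admissible because \<open>\<sigma> < 1\<close>. Increments of size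
  \<open>norm z\<close> are therefore integrable near the origin, and first-order information on
  test functions suffices.\<close>

locale levy_setting =
  fixes \<Omega> :: "'a::euclidean_space set" and \<nu> :: "'a \<Rightarrow> 'a measure" and \<sigma> C1 C2 :: real
  assumes open_dom: "open \<Omega>" and bounded_dom: "bounded \<Omega>" and C1_bdry: "C1_boundary \<Omega>"
    and sigma_pos: "0 < \<sigma>" and sigma_less: "\<sigma> < 1" and C1_pos: "0 < C1" and C2_pos: "0 < C2"
    and sets_nu: "x \<in> closure \<Omega> \<Longrightarrow> sets (\<nu> x) = sets borel"
    and support: "assm_M0_1 \<Omega> \<nu>"
    and tail: "x \<in> closure \<Omega> \<Longrightarrow> 0 < \<delta> \<Longrightarrow>
      emeasure (\<nu> x) (- ball 0 \<delta>) \<le> ennreal (C1 * \<delta> powr (- \<sigma>))"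
    and near: "x \<in> closure \<Omega> \<Longrightarrow> 0 < \<delta> \<Longrightarrow> \<delta> < 1 \<Longrightarrow>
      (\<integral>\<^sup>+z\<in>ball 0 \<delta>. ennreal (norm z) \<partial>\<nu> x) \<le> ennreal (C2 * \<delta> powr (1 - \<sigma>))"
    and M3: "assm_M3 \<sigma> \<Omega> \<nu>"
begin

lemma compact_closure_dom: "compact (closure \<Omega>)"
  using bounded_dom by simp

lemma compact_frontier_dom: "compact (frontier \<Omega>)"
  using bounded_dom by (rule compact_frontier_bounded)

lemma space_nu [simp]: "x \<in> closure \<Omega> \<Longrightarrow> space (\<nu> x) = UNIV"
  using sets_eq_imp_space_eq[OF sets_nu] by simp

text \<open>The complement of the support is a union of open null sets, and by Lindelof countably
  many of them suffice.\<close>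

lemma AE_closure:
  assumes x: "x \<in> closure \<Omega>"
  shows "AE z in \<nu> x. x + z \<in> closure \<Omega>"
proof -
  define F where "F = {U. open U \<and> emeasure (\<nu> x) U = 0}"
  obtain F' where F': "F' \<subseteq> F" "countable F'" "\<Union>F' = \<Union>F"
    using Lindelof_openin[of F UNIV] by (auto simp: F_def)
  have "\<Union>F' \<in> null_sets (\<nu> x)"
    using F' by (intro null_sets_UN'[of F' "\<lambda>U. U", simplified]) (auto simp: F_def null_sets_def sets_nu[OF x])
  moreover have "{z \<in> space (\<nu> x). \<not> x + z \<in> closure \<Omega>} \<subseteq> \<Union>F'"
  proof
    fix z assume "z \<in> {z \<in> space (\<nu> x). \<not> x + z \<in> closure \<Omega>}"
    then have "z \<notin> measure_support (\<nu> x)"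
      using support x by (auto simp: assm_M0_1_def)
    then have "z \<in> \<Union>F" by (auto simp: measure_support_def F_def)
    then show "z \<in> \<Union>F'" using F' by simp
  qed
  ultimately show ?thesis unfolding eventually_ae_filter by blast
qed

lemma measure_tail:
  assumes "x \<in> closure \<Omega>" "0 < \<delta>" "S \<in> sets borel" "S \<subseteq> - ball 0 \<delta>"
  shows "emeasure (\<nu> x) S < \<infinity>" "measure (\<nu> x) S \<le> C1 * \<delta> powr (- \<sigma>)"
proof -
  have le: "emeasure (\<nu> x) S \<le> ennreal (C1 * \<delta> powr (- \<sigma>))"
    using emeasure_mono[OF assms(4), of "\<nu> x"] tail[OF assms(1,2)] sets_nu[OF assms(1)] by auto
  then show "emeasure (\<nu> x) S < \<infinity>" using ennreal_less_top order_le_less_trans by fastforce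
  show "measure (\<nu> x) S \<le> C1 * \<delta> powr (- \<sigma>)"
    unfolding measure_def using le C1_pos by (intro enn2real_leI) auto
qed

lemma finite_restrict:
  assumes "x \<in> closure \<Omega>" "0 < \<delta>"
  shows "finite_measure (restrict_space (\<nu> x) (- ball 0 \<delta>))"
proof (rule finite_measureI)
  show "emeasure (restrict_space (\<nu> x) (- ball 0 \<delta>)) (space (restrict_space (\<nu> x) (- ball 0 \<delta>))) \<noteq> \<infinity>"
    using measure_tail(1)[OF assms, of "- ball 0 \<delta>"] assms
    by (simp add: emeasure_restrict_space space_restrict_space sets_nu)
qed

text \<open>(M3) at exponent 1: off the ball of radius \<open>\<delta>\<close> the weight
  \<open>norm z\<close> is at least \<open>\<delta>\<close>, so a difference of masses is at most
  the weighted variation divided by \<open>\<delta>\<close>.\<close>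

lemma tv_small:
  assumes \<delta>: "0 < \<delta>" and \<mu>: "0 < \<mu>"
  shows "\<exists>r>0. \<forall>x\<in>closure \<Omega>. \<forall>y\<in>closure \<Omega>. norm (x - y) < r \<longrightarrow>
    (\<forall>S\<in>sets borel. S \<subseteq> - ball 0 \<delta> \<longrightarrow> \<bar>measure (\<nu> x) S - measure (\<nu> y) S\<bar> \<le> \<mu>)"
proof -
  obtain \<omega> where \<omega>: "modulus_of_continuity \<omega>" and
    tv: "\<And>x y. x\<in>closure \<Omega> \<Longrightarrow> y\<in>closure \<Omega> \<Longrightarrow>
           (\<integral>\<^sup>+z. ennreal (norm z powr 1)
              \<partial>total_variation (restrict_space (\<nu> x) (- ball 0 \<delta>)) (restrict_space (\<nu> y) (- ball 0 \<delta>)))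
           \<le> ennreal ((1 + h_fun 1 \<sigma> \<delta>) * \<omega> (norm (x - y)))"
    using M3 \<delta> unfolding assm_M3_def by (meson zero_less_one)
  \<comment> \<open>As \<open>\<sigma> < 1\<close>, the factor
    \<open>1 + h_fun 1 \<sigma> \<delta>\<close> is 2, whence the threshold
    \<open>\<delta> * \<mu> / 2\<close> below.\<close>
  have h: "h_fun 1 \<sigma> \<delta> = 1" using sigma_less by (simp add: h_fun_def)
  have "(\<omega> \<longlongrightarrow> 0) (at_right 0)" "\<omega> 0 = 0" using \<omega> by (auto simp: modulus_of_continuity_def)
  then have "\<forall>\<^sub>F d in at_right 0. \<omega> d < \<delta> * \<mu> / 2"
    using \<delta> \<mu> by (intro order_tendstoD) auto
  then obtain r where r: "r > 0" "\<And>d. 0 < d \<Longrightarrow> d < r \<Longrightarrow> \<omega> d < \<delta> * \<mu> / 2"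
    by (auto simp: eventually_at_right_field)
  have om: "\<omega> d \<le> \<delta> * \<mu> / 2" if "0 \<le> d" "d < r" for d
    using r(2)[of d] that \<open>\<omega> 0 = 0\<close> \<delta> \<mu> by (cases "d = 0") (auto simp: less_imp_le)
  show ?thesis
  proof (intro exI[of _ r] conjI ballI impI r)
    fix x y S assume x: "x \<in> closure \<Omega>" and y: "y \<in> closure \<Omega>" and xy: "norm (x - y) < r"
      and S: "S \<in> sets (borel :: 'a measure)" "S \<subseteq> - ball 0 \<delta>"
    define M where "M = restrict_space (\<nu> x) (- ball 0 \<delta>)"
    define N where "N = restrict_space (\<nu> y) (- ball 0 \<delta>)"
    have sM: "sets N = sets M" unfolding M_def N_def
      by (simp add: sets_restrict_space sets_nu x y)
    have SM: "S \<in> sets M" unfolding M_def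
      using S by (auto simp: sets_restrict_space_iff sets_nu x)
    have mM: "measure M S = measure (\<nu> x) S" "measure N S = measure (\<nu> y) S"
      unfolding M_def N_def using S by (auto simp: measure_restrict_space sets_nu x y)
    have fin: "finite_measure M" "finite_measure N" unfolding M_def N_def
      using finite_restrict x y \<delta> by auto
    let ?T = "total_variation M N"
    have sT: "sets ?T = sets M" unfolding total_variation_def
      by (simp add: sets.space_closed sets.sigma_sets_eq)
    have "ennreal \<bar>measure M S - measure N S\<bar> \<le> emeasure ?T S"
    proof (cases "S = {}")
      case False
      then have "{S} \<in> {P. finite P \<and> P \<subseteq> sets M \<and> partition_on S P}"
        using SM by (auto simp: partition_on_def)
      then show ?thesis
        unfolding emeasure_total_variation[OF fin sM SM] by (intro SUP_upper2[of "{S}"]) auto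
    qed simp
    then have "ennreal \<delta> * ennreal \<bar>measure M S - measure N S\<bar> \<le> ennreal \<delta> * emeasure ?T S"
      by (rule mult_left_mono) simp
    also have "\<dots> = (\<integral>\<^sup>+z. ennreal \<delta> * indicator S z \<partial>?T)"
      using SM sT by (subst nn_integral_cmult_indicator) auto
    also have "\<dots> \<le> (\<integral>\<^sup>+z. ennreal (norm z powr 1) \<partial>?T)"
      using S \<delta> by (intro nn_integral_mono) (auto simp: indicator_def intro!: ennreal_leI)
    also have "\<dots> \<le> ennreal (2 * \<omega> (norm (x - y)))"
      using tv[OF x y] unfolding h M_def N_def by simp
    also have "\<dots> \<le> ennreal (\<delta> * \<mu>)"
      using om[of "norm (x - y)"] xy by (intro ennreal_leI) auto
    finally have "ennreal (\<delta> * \<bar>measure M S - measure N S\<bar>) \<le> ennreal (\<delta> * \<mu>)"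
      using \<delta> by (simp add: ennreal_mult)
    then show "\<bar>measure (\<nu> x) S - measure (\<nu> y) S\<bar> \<le> \<mu>"
      using \<delta> \<mu> by (simp add: mM)
  qed
qed

end

section \<open>The boundary as a graph, and its measure seen from inside\<close>

lemma C1_gradient_imp_continuous:
  assumes "C1_gradient_on UNIV \<gamma> D" shows "continuous_on UNIV \<gamma>"
  using assms unfolding C1_gradient_on_def
  by (auto intro!: continuous_at_imp_continuous_on has_derivative_continuous)

text \<open>Inside the ball the points of negative height over the graph form an open set that
  misses \<open>\<Omega>\<close>, hence also its closure. A frontier point lies in the closure but
  not in \<open>\<Omega>\<close>, which leaves only height 0.\<close>

lemma frontier_graph:
  assumes op: "open \<Omega>" and \<gamma>: "continuous_on UNIV \<gamma>"
    and eq: "\<Omega> \<inter> ball x0 r = {x \<in> ball x0 r. \<gamma> (x - (x \<bullet> e) *\<^sub>R e) < x \<bullet> e}"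
    and x: "x \<in> ball x0 r"
  shows "x \<in> \<Omega> \<longleftrightarrow> 0 < x \<bullet> e - \<gamma> (x - (x \<bullet> e) *\<^sub>R e)"
    and "x \<in> closure \<Omega> \<Longrightarrow> 0 \<le> x \<bullet> e - \<gamma> (x - (x \<bullet> e) *\<^sub>R e)"
    and "x \<in> frontier \<Omega> \<Longrightarrow> x \<bullet> e - \<gamma> (x - (x \<bullet> e) *\<^sub>R e) = 0"
proof -
  let ?g = "\<lambda>x. x \<bullet> e - \<gamma> (x - (x \<bullet> e) *\<^sub>R e)"
  have 1: "x \<in> \<Omega> \<longleftrightarrow> 0 < ?g x" if "x \<in> ball x0 r" for x
    using eq that by (auto simp: set_eq_iff)
  show "x \<in> \<Omega> \<longleftrightarrow> 0 < ?g x" using 1 x by blast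
  have cg: "continuous_on UNIV ?g"
    by (intro continuous_intros continuous_on_compose2[OF \<gamma>]) auto
  show 2: "0 \<le> ?g x" if "x \<in> closure \<Omega>"
  proof (rule ccontr)
    assume "\<not> 0 \<le> ?g x"
    have "open ({x. ?g x < 0} \<inter> ball x0 r)"
      using cg by (intro open_Int open_Collect_less) auto
    moreover have "({x. ?g x < 0} \<inter> ball x0 r) \<inter> \<Omega> = {}" using 1 by fastforce
    ultimately have "({x. ?g x < 0} \<inter> ball x0 r) \<inter> closure \<Omega> = {}"
      using open_Int_closure_eq_empty by blast
    moreover have "x \<in> ({x. ?g x < 0} \<inter> ball x0 r)" using \<open>\<not> 0 \<le> ?g x\<close> x by simp
    ultimately show False using that by blast
  qed
  assume "x \<in> frontier \<Omega>"
  then have "x \<in> closure \<Omega>" "x \<notin> \<Omega>" using op by (auto simp: frontier_def interior_open)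
  then show "?g x = 0" using 1[OF x] 2 by linarith
qed

context levy_setting begin

text \<open>Moving along \<open>- e\<close> leaves the projection, hence the graph value, unchanged
  and lowers the height by exactly \<open>\<tau>\<close>, from 0 to a negative number. Halving the
  radius keeps the shifted point in the graph ball.\<close>

lemma outward_shift:
  assumes "b \<in> frontier \<Omega>"
  obtains r e where "0 < r" "norm e = 1"
    "\<And>y \<tau>. y \<in> frontier \<Omega> \<Longrightarrow> norm (y - b) < r \<Longrightarrow> 0 < \<tau> \<Longrightarrow> \<tau> < r \<Longrightarrow> y - \<tau> *\<^sub>R e \<notin> closure \<Omega>"
proof -
  obtain r e \<gamma> where r: "r > 0" "norm e = 1" "C1_on UNIV \<gamma>"
    and eq: "\<Omega> \<inter> ball b r = {x \<in> ball b r. \<gamma> (x - (x \<bullet> e) *\<^sub>R e) < x \<bullet> e}"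
    using C1_bdry assms unfolding C1_boundary_def by meson
  have \<gamma>: "continuous_on UNIV \<gamma>"
    using r(3) C1_gradient_imp_continuous by (auto simp: C1_on_def)
  have ee: "e \<bullet> e = 1" using r(2) by (simp add: dot_square_norm)
  show thesis
  proof (rule that[of "r/2" e])
    fix y \<tau> assume y: "y \<in> frontier \<Omega>" "norm (y - b) < r/2" and \<tau>: "0 < \<tau>" "\<tau> < r/2"
    have yb: "y \<in> ball b r" using y r by (auto simp: dist_norm norm_minus_commute)
    have "norm (y - \<tau> *\<^sub>R e - b) < r"
      using norm_triangle_ineq4[of "y - b" "\<tau> *\<^sub>R e"] y \<tau> r(2) by (simp add: algebra_simps)
    then have yb': "y - \<tau> *\<^sub>R e \<in> ball b r" by (simp add: dist_norm norm_minus_commute)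
    have e: "(y - \<tau> *\<^sub>R e) - ((y - \<tau> *\<^sub>R e) \<bullet> e) *\<^sub>R e = y - (y \<bullet> e) *\<^sub>R e"
      by (simp add: inner_diff_left ee algebra_simps)
    show "y - \<tau> *\<^sub>R e \<notin> closure \<Omega>"
    proof
      assume "y - \<tau> *\<^sub>R e \<in> closure \<Omega>"
      from frontier_graph(2)[OF open_dom \<gamma> eq yb' this]
      have "0 \<le> y \<bullet> e - \<tau> - \<gamma> (y - (y \<bullet> e) *\<^sub>R e)" unfolding e by (simp add: inner_diff_left ee)
      then show False using frontier_graph(3)[OF open_dom \<gamma> eq yb y(1)] \<tau> by linarith
    qed
  qed (use r in auto)
qed

text \<open>Shifting \<open>x\<close> by a small outward vector moves the boundary piece out of \<open>closure \<Omega>\<close>, where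
  the shifted measure has no mass; continuity in total variation transfers this to \<open>\<nu> x\<close>.\<close>

lemma AE_interior:
  assumes x: "x \<in> \<Omega>"
  shows "AE z in \<nu> x. z \<noteq> 0 \<longrightarrow> x + z \<in> \<Omega>"
proof -
  have xc: "x \<in> closure \<Omega>" using x closure_subset by auto
  \<comment> \<open>The argument is run on one graph ball, since the direction of the shift depends
    on it, and on jumps of size at least \<open>\<delta>\<close>, so that the masses are
    finite.\<close>
  have piece: "\<exists>r>0. \<forall>\<delta>>0. AE z in \<nu> x. \<not> (x + z \<in> frontier \<Omega> \<and> norm (x + z - b) < r \<and> \<delta> \<le> norm z)"
    if b: "b \<in> frontier \<Omega>" for b
  proof -
    obtain r e where r: "0 < r" "norm e = 1"
      and out: "\<And>y \<tau>. y \<in> frontier \<Omega> \<Longrightarrow> norm (y - b) < r \<Longrightarrow> 0 < \<tau> \<Longrightarrow> \<tau> < r \<Longrightarrow> y - \<tau> *\<^sub>R e \<notin> closure \<Omega>"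
      using outward_shift[OF b] by metis
    show ?thesis
    proof (intro exI[of _ r] conjI allI impI r)
      fix \<delta> :: real assume \<delta>: "0 < \<delta>"
      define S where "S = {z. x + z \<in> frontier \<Omega> \<and> norm (x + z - b) < r \<and> \<delta> \<le> norm z}"
      have "S = ((\<lambda>z. x + z) -` frontier \<Omega>) \<inter> {z. norm (x + z - b) < r} \<inter> {z. \<delta> \<le> norm z}"
        by (auto simp: S_def)
      moreover have "closed ((\<lambda>z. x + z) -` frontier \<Omega>)"
        by (intro continuous_closed_vimage) auto
      moreover have "open {z. norm (x + z - b) < r}"
        by (intro open_Collect_less continuous_intros)
      moreover have "closed {z::'a. \<delta> \<le> norm z}"
        by (intro closed_Collect_le continuous_intros)
      ultimately have Sb: "S \<in> sets borel" by auto
      have Sd: "S \<subseteq> - ball 0 \<delta>" by (auto simp: S_def)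
      have "measure (\<nu> x) S \<le> \<mu>" if \<mu>: "0 < \<mu>" for \<mu>
      proof -
        obtain r' where r': "r' > 0" "\<forall>x\<in>closure \<Omega>. \<forall>y\<in>closure \<Omega>. norm (x - y) < r' \<longrightarrow>
          (\<forall>S\<in>sets borel. S \<subseteq> - ball 0 \<delta> \<longrightarrow> \<bar>measure (\<nu> x) S - measure (\<nu> y) S\<bar> \<le> \<mu>)"
          using tv_small[OF \<delta> \<mu>] by auto
        obtain r1 where r1: "r1 > 0" "ball x r1 \<subseteq> \<Omega>"
          using open_dom x open_contains_ball by blast
        define \<tau> where "\<tau> = min (min r r') r1 / 2"
        have \<tau>: "0 < \<tau>" "\<tau> < r" "\<tau> < r'" "\<tau> < r1" using r r' r1 by (auto simp: \<tau>_def)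
        define x' where "x' = x - \<tau> *\<^sub>R e"
        have nx': "norm (x - x') = \<tau>" using \<tau> r by (simp add: x'_def)
        have x': "x' \<in> \<Omega>" using r1 \<tau> nx' by (auto simp: subset_eq dist_norm)
        then have x'c: "x' \<in> closure \<Omega>" using closure_subset by auto
        \<comment> \<open>A jump \<open>z\<close> in \<open>S\<close> taken from \<open>x'\<close>
          lands at \<open>x + z - \<tau> *\<^sub>R e\<close>, outside the closure.\<close>
        have "AE z in \<nu> x'. z \<notin> S"
          using AE_closure[OF x'c]
        proof eventually_elim
          case (elim z)
          have "x + z - \<tau> *\<^sub>R e \<in> closure \<Omega>" using elim by (simp add: x'_def algebra_simps)
          then show ?case using out[of "x + z" \<tau>] \<tau> by (auto simp: S_def)
        qed
        then have "S \<in> null_sets (\<nu> x')" using Sb sets_nu[OF x'c] by (subst AE_iff_null_sets) auto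
        then have "measure (\<nu> x') S = 0" by (simp add: measure_def null_sets_def)
        then show ?thesis using r'(2)[rule_format, OF xc x'c _ Sb Sd] nx' \<tau> by auto
      qed
      then have "measure (\<nu> x) S \<le> 0" by (rule field_le_epsilon) simp
      then have "emeasure (\<nu> x) S = 0"
        using measure_tail(1)[OF xc \<delta> Sb Sd]
        by (subst emeasure_eq_ennreal_measure) (auto simp: measure_le_0_iff)
      then have "S \<in> null_sets (\<nu> x)" using Sb sets_nu[OF xc] by auto
      then have "AE z in \<nu> x. z \<notin> S" using Sb sets_nu[OF xc] by (subst (asm) AE_iff_null_sets) auto
      then show "AE z in \<nu> x. \<not> (x + z \<in> frontier \<Omega> \<and> norm (x + z - b) < r \<and> \<delta> \<le> norm z)"
        by (simp add: S_def)
    qed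
  qed
  then have "\<exists>r. \<forall>b\<in>frontier \<Omega>. 0 < r b \<and> (\<forall>\<delta>>0. AE z in \<nu> x.
      \<not> (x + z \<in> frontier \<Omega> \<and> norm (x + z - b) < r b \<and> \<delta> \<le> norm z))"
    by (intro bchoice ballI)
  then obtain r where r: "\<And>b. b \<in> frontier \<Omega> \<Longrightarrow> 0 < r b"
    and ae: "\<And>b \<delta>. b \<in> frontier \<Omega> \<Longrightarrow> \<delta> > 0 \<Longrightarrow>
      AE z in \<nu> x. \<not> (x + z \<in> frontier \<Omega> \<and> norm (x + z - b) < r b \<and> \<delta> \<le> norm z)"
    by auto
  obtain D where D: "D \<subseteq> frontier \<Omega>" "finite D" "frontier \<Omega> \<subseteq> (\<Union>b\<in>D. ball b (r b))"
    by (rule compactE_image[OF compact_frontier_dom, of "frontier \<Omega>" "\<lambda>b. ball b (r b)"]) (use r in auto)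
  \<comment> \<open>Finitely many balls cover the frontier and the cutoffs
    \<open>1 / (n + 1)\<close> exhaust the jumps \<open>z \<noteq> 0\<close>, so only countably many
    null sets are removed.\<close>
  have "AE z in \<nu> x. \<forall>n::nat. \<forall>b\<in>D. \<not> (x + z \<in> frontier \<Omega> \<and> norm (x + z - b) < r b \<and> 1 / (n + 1) \<le> norm z)"
    using D ae by (subst AE_all_countable, intro allI, subst AE_ball_countable) (auto intro: countable_finite)
  with AE_closure[OF xc] show ?thesis
  proof eventually_elim
    case (elim z)
    show ?case
    proof (intro impI, rule ccontr)
      assume z: "z \<noteq> 0" "x + z \<notin> \<Omega>"
      then have "x + z \<in> frontier \<Omega>" using elim open_dom by (auto simp: frontier_def interior_open)
      moreover obtain b where "b \<in> D" "norm (x + z - b) < r b"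
        using D(3) \<open>x + z \<in> frontier \<Omega>\<close> by (auto simp: dist_norm norm_minus_commute)
      moreover obtain n :: nat where "1 / (real n + 1) < norm z"
        using z nat_approx_posE[of "norm z"] by (auto simp: add.commute)
      ultimately show False using elim by (auto dest: less_imp_le)
    qed
  qed
qed

end

section \<open>Semicontinuous functions and test functions of class C^1\<close>

lemma usc_onD:
  assumes "usc_on S u" "z \<in> S" "u z < c"
  shows "\<forall>\<^sub>F w in nhds z. w \<in> S \<longrightarrow> u w < c"
proof -
  have "\<forall>\<^sub>F w in at z within S. u w < c" using assms by (auto simp: usc_on_def)
  then show ?thesis using assms(3) unfolding eventually_at_filter
    by (auto elim!: eventually_mono)
qed

lemma usc_on_subset: "usc_on S u \<Longrightarrow> T \<subseteq> S \<Longrightarrow> usc_on T u"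
  unfolding usc_on_def by (meson filter_leD at_le subsetD)

lemma usc_on_compose:
  assumes "usc_on T u" "continuous_on S h" "h ` S \<subseteq> T"
  shows "usc_on S (\<lambda>z. u (h z))"
  unfolding usc_on_def
proof (intro ballI allI impI)
  fix z c assume "z \<in> S" "u (h z) < c"
  then have "\<forall>\<^sub>F w in nhds (h z). w \<in> T \<longrightarrow> u w < c"
    using assms by (intro usc_onD) auto
  moreover have "(h \<longlongrightarrow> h z) (at z within S)" using assms(2) \<open>z \<in> S\<close> by (auto simp: continuous_on_def)
  ultimately have "\<forall>\<^sub>F w in at z within S. h w \<in> T \<longrightarrow> u (h w) < c"
    by (auto simp: filterlim_iff)
  moreover have "\<forall>\<^sub>F w in at z within S. w \<in> S" by (simp add: eventually_at_filter)
  ultimately show "\<forall>\<^sub>F w in at z within S. u (h w) < c"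
    by eventually_elim (use assms(3) in auto)
qed

lemma continuous_imp_usc_on:
  fixes f :: "_ \<Rightarrow> real"
  shows "continuous_on S f \<Longrightarrow> usc_on S f"
  unfolding usc_on_def continuous_on_def by (auto intro: order_tendstoD)

lemma lsc_imp_usc_on_minus: "lsc_on S v \<Longrightarrow> usc_on S (\<lambda>z. - v z)"
  unfolding usc_on_def lsc_on_def by (auto simp: minus_less_iff)

lemma usc_on_add:
  assumes "usc_on S f" "usc_on S g"
  shows "usc_on S (\<lambda>z. f z + g z)"
  unfolding usc_on_def
proof (intro ballI allI impI)
  fix z c assume z: "z \<in> S" "f z + g z < c"
  define e where "e = (c - f z - g z) / 2"
  have "\<forall>\<^sub>F w in at z within S. f w < f z + e" "\<forall>\<^sub>F w in at z within S. g w < g z + e"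
    using assms z by (auto simp: usc_on_def e_def)
  then show "\<forall>\<^sub>F w in at z within S. f w + g w < c"
    by eventually_elim (auto simp: e_def field_simps)
qed

lemma usc_on_openin:
  assumes "usc_on S u"
  shows "openin (top_of_set S) {z \<in> S. u z < c}"
proof (subst openin_subopen, intro ballI)
  fix z assume z: "z \<in> {z \<in> S. u z < c}"
  then obtain T where "open T" "z \<in> T" "\<forall>w\<in>T. w \<in> S \<longrightarrow> u w < c"
    using usc_onD[OF assms, of z c] by (auto simp: eventually_nhds)
  then show "\<exists>T. openin (top_of_set S) T \<and> z \<in> T \<and> T \<subseteq> {z \<in> S. u z < c}"
    using z \<open>z \<in> T\<close> by (intro exI[of _ "S \<inter> T"]) (auto simp: openin_open_Int)
qed

text \<open>Without a maximum the relatively open sets \<open>{z \<in> K. u z < u w}\<close> would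
  cover \<open>K\<close>; the \<open>w\<close> with the largest value in a finite subcover would lie
  in one of its sets, which is absurd.\<close>

lemma usc_attains_sup:
  fixes u :: "'b::topological_space \<Rightarrow> real"
  assumes K: "compact K" "K \<noteq> {}" and u: "usc_on K u"
  shows "\<exists>z\<in>K. \<forall>w\<in>K. u w \<le> u z"
proof (rule ccontr)
  assume "\<not> ?thesis"
  then have ex: "\<exists>w\<in>K. u z < u w" if "z \<in> K" for z using that by (auto simp: not_le)
  have "\<forall>w. \<exists>T. open T \<and> {z \<in> K. u z < u w} = K \<inter> T"
    using usc_on_openin[OF u] by (auto simp: openin_open)
  then obtain T where T: "\<And>w. open (T w)" "\<And>w. {z \<in> K. u z < u w} = K \<inter> T w" by metis
  have "K \<subseteq> (\<Union>w\<in>K. T w)" using ex T(2) by blast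
  then obtain D where D: "D \<subseteq> K" "finite D" "K \<subseteq> (\<Union>w\<in>D. T w)"
    using compactE_image[OF K(1), of K T] T(1) by metis
  then have "D \<noteq> {}" using K(2) by auto
  then obtain w where w: "w \<in> D" "\<forall>w'\<in>D. u w' \<le> u w"
  proof -
    have "Max (u ` D) \<in> u ` D" using D(2) \<open>D \<noteq> {}\<close> by (intro Max_in) auto
    then obtain w where "w \<in> D" "u w = Max (u ` D)" by force
    then show ?thesis using D(2) by (intro that[of w]) auto
  qed
  then obtain w' where "w' \<in> D" "w \<in> T w'" using D by auto
  then have "w \<in> {z \<in> K. u z < u w'}" using T(2) w D by auto
  then show False using w \<open>w' \<in> D\<close> by force
qed

text \<open>The squared positive part is the elementary C^1 gluing function: the growth function,
  the extension of the barrier and the penalty in time are built from it.\<close>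

lemma max_sq_deriv:
  fixes x :: real
  shows "((\<lambda>x. (max 0 x)\<^sup>2) has_real_derivative 2 * max 0 x) (at x)"
proof -
  consider "x > 0" | "x < 0" | "x = 0" by linarith
  then show ?thesis
  proof cases
    case 1
    have "((\<lambda>x. x\<^sup>2) has_real_derivative 2 * x) (at x)" by (auto intro!: derivative_eq_intros)
    then show ?thesis using 1
      by (subst DERIV_cong_ev[OF refl _ refl, of _ "\<lambda>x. x\<^sup>2"])
        (auto intro!: eventually_mono[OF eventually_nhds_in_open[of "{0<..}"]])
  next
    case 2
    have "((\<lambda>x. 0) has_real_derivative 0) (at x)" by simp
    then show ?thesis using 2
      by (subst DERIV_cong_ev[OF refl _ refl, of _ "\<lambda>x. 0"])
        (auto intro!: eventually_mono[OF eventually_nhds_in_open[of "{..<0}"]])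
  next
    case 3
    have "((\<lambda>h. (max 0 h)\<^sup>2 / h) \<longlongrightarrow> 0) (at (0::real))"
    proof (rule tendsto_0_le[where K=1])
      show "((\<lambda>h::real. h) \<longlongrightarrow> 0) (at 0)" by simp
      show "\<forall>\<^sub>F h in at (0::real). norm ((max 0 h)\<^sup>2 / h) \<le> norm h * 1"
        by (auto simp: max_def power2_eq_square)
    qed
    then show ?thesis using 3 by (simp add: DERIV_def)
  qed
qed

text \<open>A locally finite sum of one-sided parabolas: the \<open>n\<close>-th starts at
  \<open>a + real n\<close> and has passed \<open>B n\<close> after the further distance
  \<open>b - a\<close>, which fixes \<open>c n\<close>. Only the first \<open>K r\<close> terms can
  be nonzero at \<open>r\<close>.\<close>

lemma C1_growth:
  fixes a b :: real and B :: "nat \<Rightarrow> real"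
  assumes "a < b"
  obtains \<Theta> \<Theta>' where "\<And>r. (\<Theta> has_real_derivative \<Theta>' r) (at r)" "continuous_on UNIV \<Theta>'"
    "\<And>r. r \<le> a \<Longrightarrow> \<Theta> r = 0" "\<And>r. 0 \<le> \<Theta> r"
    "\<And>n r. b + real n \<le> r \<Longrightarrow> B n \<le> \<Theta> r"
proof -
  define c where "c n = max 0 (B n) / (b - a)\<^sup>2" for n
  have c0: "c n \<ge> 0" for n by (simp add: c_def)
  define p where "p n r = c n * (max 0 (r - a - real n))\<^sup>2" for n r
  define p' where "p' n r = c n * (2 * max 0 (r - a - real n))" for n r
  define K where "K r = nat \<lceil>r - a\<rceil>" for r
  define \<Theta> where "\<Theta> r = (\<Sum>n<K r. p n r)" for r
  define \<Theta>' where "\<Theta>' r = (\<Sum>n<K r. p' n r)" for r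
  have van: "p n r = 0" "p' n r = 0" if "K r \<le> n" for n r
  proof -
    have "r - a \<le> real n" using that by (simp add: K_def ceiling_le_iff nat_le_iff)
    then show "p n r = 0" "p' n r = 0" by (auto simp: p_def p'_def)
  qed
  have eq: "\<Theta> r = (\<Sum>n<k. p n r)" "\<Theta>' r = (\<Sum>n<k. p' n r)" if "K r \<le> k" for r k
    unfolding \<Theta>_def \<Theta>'_def using that
    by (intro sum.mono_neutral_left; auto simp: van)+
  have loc: "\<forall>\<^sub>F s in nhds r. K s \<le> K (r + 1)" for r
  proof -
    have "\<forall>\<^sub>F s in nhds r. s \<in> {..<r+1}" by (intro eventually_nhds_in_open) auto
    then show ?thesis by eventually_elim (unfold K_def, intro nat_mono ceiling_mono, auto)
  qed
  have dp: "(p n has_real_derivative p' n r) (at r)" for n r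
  proof -
    have "((\<lambda>r. (max 0 (r - a - real n))\<^sup>2) has_real_derivative 2 * max 0 (r - a - real n) * 1) (at r)"
      by (rule DERIV_chain2[OF max_sq_deriv]) (auto intro!: derivative_eq_intros)
    from DERIV_cmult[OF this, of "c n"] show ?thesis unfolding p_def[abs_def] p'_def by simp
  qed
  show thesis
  proof (rule that)
    fix r
    have "K r \<le> K (r + 1)" unfolding K_def by (intro nat_mono ceiling_mono) auto
    then have "((\<lambda>s. \<Sum>n<K(r+1). p n s) has_real_derivative \<Theta>' r) (at r)"
      unfolding eq(2)[OF \<open>K r \<le> K (r + 1)\<close>] by (intro DERIV_sum dp)
    then show "(\<Theta> has_real_derivative \<Theta>' r) (at r)"
      by (subst DERIV_cong_ev[OF refl _ refl, of _ "\<lambda>s. \<Sum>n<K(r+1). p n s"])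
        (use loc[of r] eq in \<open>auto elim!: eventually_mono\<close>)
  next
    show "continuous_on UNIV \<Theta>'"
    proof (intro continuous_at_imp_continuous_on ballI)
      fix r :: real
      have "isCont (\<lambda>s. \<Sum>n<K(r+1). p' n s) r" unfolding p'_def by (intro continuous_intros)
      then show "isCont \<Theta>' r"
        by (subst isCont_cong[of _ "\<lambda>s. \<Sum>n<K(r+1). p' n s"])
          (use loc[of r] eq in \<open>auto elim!: eventually_mono\<close>)
    qed
  next
    show "\<Theta> r = 0" if "r \<le> a" for r using that by (simp add: \<Theta>_def K_def)
    show pos: "0 \<le> \<Theta> r" for r by (auto simp: \<Theta>_def p_def c0 intro!: sum_nonneg)
    fix n r assume r: "b + real n \<le> r"
    have "B n \<le> c n * (b - a)\<^sup>2" using assms by (simp add: c_def)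
    also have "\<dots> \<le> p n r" unfolding p_def
      using r assms by (intro mult_left_mono power_mono c0) auto
    also have "\<dots> \<le> \<Theta> r"
    proof (cases "n < K r")
      case True
      then show ?thesis unfolding \<Theta>_def
        by (intro member_le_sum) (auto simp: p_def c0)
    next
      case False
      then show ?thesis using van[of r n] pos[of r] by simp
    qed
    finally show "B n \<le> \<Theta> r" .
  qed
qed

lemma C1_gradient_on_add:
  "C1_gradient_on S f g \<Longrightarrow> C1_gradient_on S f' g' \<Longrightarrow> C1_gradient_on S (\<lambda>z. f z + f' z) (\<lambda>z. g z + g' z)"
  unfolding C1_gradient_on_def
  by (auto intro!: continuous_intros derivative_eq_intros simp: inner_add_left)

lemma C1_gradient_on_minus:
  "C1_gradient_on S f g \<Longrightarrow> C1_gradient_on S (\<lambda>z. - f z) (\<lambda>z. - g z)"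
  unfolding C1_gradient_on_def by (auto intro!: continuous_intros derivative_eq_intros)

lemma C1_gradient_on_compose:
  assumes g: "C1_gradient_on S f g" and F: "\<And>r. (F has_real_derivative F' r) (at r)" "continuous_on UNIV F'"
  shows "C1_gradient_on S (\<lambda>z. F (f z)) (\<lambda>z. F' (f z) *\<^sub>R g z)"
  unfolding C1_gradient_on_def
proof (intro conjI ballI)
  have gd: "(f has_derivative (\<lambda>h. g x \<bullet> h)) (at x within S)" if "x \<in> S" for x
    using g that by (auto simp: C1_gradient_on_def)
  then have cf: "continuous_on S f" by (rule has_derivative_continuous_on)
  show "continuous_on S (\<lambda>z. F' (f z) *\<^sub>R g z)"
    using g by (intro continuous_intros continuous_on_compose2[OF F(2) cf]) (auto simp: C1_gradient_on_def)
  fix x assume "x \<in> S"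
  from DERIV_compose_FDERIV[OF F(1) gd[OF this]]
  show "((\<lambda>z. F (f z)) has_derivative (\<lambda>h. F' (f x) *\<^sub>R g x \<bullet> h)) (at x within S)"
    by (simp add: mult.commute)
qed

lemma C1_gradient_on_sq_dist:
  fixes z0 :: "'b::euclidean_space"
  shows "C1_gradient_on S (\<lambda>z. (z - z0) \<bullet> (z - z0)) (\<lambda>z. 2 *\<^sub>R (z - z0))"
  unfolding C1_gradient_on_def
  by (auto intro!: continuous_intros derivative_eq_intros simp: inner_commute)

text \<open>The definition of solutions asks for a maximum over all of \<open>Qbar \<Omega>\<close>,
  whereas the arguments produce local ones. A function of the squared distance, zero near
  \<open>z0\<close>, is added to the test function so as to dominate the excess on each shell around
  \<open>z0\<close>; this excess is bounded because the shells are compact.\<close>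

lemma global_test:
  fixes \<Omega> :: "'a::euclidean_space set"
  assumes bd: "bounded \<Omega>" and lb: "locally_bounded_on (Qbar \<Omega>) u"
    and \<psi>: "C1_gradient_on (Qbar \<Omega>) \<psi> g" and z0: "z0 \<in> Qbar \<Omega>" and d: "0 < d"
    and max: "\<And>z. z \<in> Qbar \<Omega> \<Longrightarrow> norm (z - z0) < d \<Longrightarrow> u z - \<psi> z \<le> u z0 - \<psi> z0"
  obtains \<psi>' g' where "C1_gradient_on (Qbar \<Omega>) \<psi>' g'" "g' z0 = g z0"
    "\<And>z. z \<in> Qbar \<Omega> \<Longrightarrow> u z - \<psi>' z \<le> u z0 - \<psi>' z0"
proof -
  let ?r = "\<lambda>z. (z - z0) \<bullet> (z - z0)"
  define K where "K n = {z \<in> Qbar \<Omega>. ?r z \<le> d\<^sup>2 + real n + 1}" for n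
  have cQ: "closed (Qbar \<Omega>)" unfolding Qbar_def by (intro closed_Times) auto
  have "\<exists>B. \<forall>z\<in>K n. (u z - \<psi> z) - (u z0 - \<psi> z0) \<le> B" for n
  proof -
    have K: "K n = Qbar \<Omega> \<inter> cball z0 (sqrt (d\<^sup>2 + real n + 1))"
    proof (rule set_eqI)
      fix z show "z \<in> K n \<longleftrightarrow> z \<in> Qbar \<Omega> \<inter> cball z0 (sqrt (d\<^sup>2 + real n + 1))"
        unfolding K_def by (simp add: dist_commute[of z0 z]) (simp add: dist_norm norm_eq_sqrt_inner)
    qed
    have cK: "compact (K n)" unfolding K using cQ by (simp add: closed_Int_compact)
    have "K n \<subseteq> Qbar \<Omega>" by (auto simp: K_def)
    then have "bounded (u ` K n)" using lb cK by (auto simp: locally_bounded_on_def)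
    then obtain B1 where B1: "\<And>z. z \<in> K n \<Longrightarrow> \<bar>u z\<bar> \<le> B1" by (auto simp: bounded_iff)
    have "continuous_on (Qbar \<Omega>) \<psi>" using \<psi> unfolding C1_gradient_on_def
      by (auto intro: has_derivative_continuous_on)
    then have "continuous_on (K n) \<psi>" using \<open>K n \<subseteq> _\<close> continuous_on_subset by blast
    then have "bounded (\<psi> ` K n)" using cK compact_continuous_image compact_imp_bounded by blast
    then obtain B2 where B2: "\<And>z. z \<in> K n \<Longrightarrow> \<bar>\<psi> z\<bar> \<le> B2" by (auto simp: bounded_iff)
    show ?thesis
    proof (intro exI ballI)
      fix z assume "z \<in> K n"
      then show "(u z - \<psi> z) - (u z0 - \<psi> z0) \<le> B1 + B2 - (u z0 - \<psi> z0)"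
        using B1[of z] B2[of z] by (auto simp: abs_le_iff)
    qed
  qed
  then obtain B where B: "\<And>n z. z \<in> K n \<Longrightarrow> (u z - \<psi> z) - (u z0 - \<psi> z0) \<le> B n" by metis
  obtain \<Theta> \<Theta>' where \<Theta>: "\<And>r. (\<Theta> has_real_derivative \<Theta>' r) (at r)" "continuous_on UNIV \<Theta>'"
    "\<And>r. r \<le> d\<^sup>2/2 \<Longrightarrow> \<Theta> r = 0" "\<And>r. 0 \<le> \<Theta> r"
    "\<And>n r. d\<^sup>2 + real n \<le> r \<Longrightarrow> B n \<le> \<Theta> r"
    by (rule C1_growth[of "d\<^sup>2/2" "d\<^sup>2" B]) (use d in auto)
  have \<Theta>0: "\<Theta> 0 = 0" using \<Theta>(3)[of 0] by simp
  show thesis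
  proof (rule that)
    show "C1_gradient_on (Qbar \<Omega>) (\<lambda>z. \<psi> z + \<Theta> (?r z)) (\<lambda>z. g z + \<Theta>' (?r z) *\<^sub>R (2 *\<^sub>R (z - z0)))"
      by (intro C1_gradient_on_add \<psi> C1_gradient_on_compose C1_gradient_on_sq_dist \<Theta>)
    show "g z0 + \<Theta>' (?r z0) *\<^sub>R (2 *\<^sub>R (z0 - z0)) = g z0" by simp
    fix z assume z: "z \<in> Qbar \<Omega>"
    show "u z - (\<psi> z + \<Theta> (?r z)) \<le> u z0 - (\<psi> z0 + \<Theta> (?r z0))"
    proof (cases "norm (z - z0) < d")
      case True
      then show ?thesis using max[OF z] \<Theta>(4)[of "?r z"] \<Theta>0 by simp
    next
      case False
      then have ge: "d\<^sup>2 \<le> ?r z" using d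
        using power_mono[of d "norm (z - z0)" 2] by (simp add: power2_norm_eq_inner)
      define n where "n = nat \<lfloor>?r z - d\<^sup>2\<rfloor>"
      have n: "d\<^sup>2 + real n \<le> ?r z" "?r z \<le> d\<^sup>2 + real n + 1"
        using ge unfolding n_def by linarith+
      have "(u z - \<psi> z) - (u z0 - \<psi> z0) \<le> B n" using n z by (intro B) (auto simp: K_def)
      also have "\<dots> \<le> \<Theta> (?r z)" using n by (intro \<Theta>(5))
      finally show ?thesis using \<Theta>0 by simp
    qed
  qed
qed


section \<open>Estimates of the nonlocal operator, and the equation freed from its test
  function\<close>

text \<open>A non-integrable \<open>F\<close> has integral 0 by convention, and
  \<open>0 \<le> J\<close>. Hence a pointwise upper bound suffices, and upper estimates of nonlocal
  terms require no separate proof of integrability.\<close>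

lemma integral_le_nn:
  fixes F K :: "'b \<Rightarrow> real"
  assumes FK: "AE z in M. F z \<le> K z" and K: "(\<integral>\<^sup>+z. ennreal (K z) \<partial>M) \<le> ennreal J" and J: "0 \<le> J"
  shows "(\<integral>z. F z \<partial>M) \<le> J"
proof (cases "integrable M F")
  case True
  have i: "integrable M (\<lambda>z. max 0 (F z))" using True by auto
  have "(\<integral>z. F z \<partial>M) \<le> (\<integral>z. max 0 (F z) \<partial>M)" using True i by (intro integral_mono) auto
  moreover have "ennreal (\<integral>z. max 0 (F z) \<partial>M) = (\<integral>\<^sup>+z. ennreal (max 0 (F z)) \<partial>M)"
    using i by (intro nn_integral_eq_integral[symmetric]) auto
  moreover have "(\<integral>\<^sup>+z. ennreal (max 0 (F z)) \<partial>M) \<le> (\<integral>\<^sup>+z. ennreal (K z) \<partial>M)"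
    using FK by (intro nn_integral_mono_AE) (auto elim!: eventually_mono simp: max_def ennreal_leI)
  ultimately have "ennreal (\<integral>z. max 0 (F z) \<partial>M) \<le> ennreal J" using K by simp
  then have "(\<integral>z. max 0 (F z) \<partial>M) \<le> J" using J by simp
  then show ?thesis using \<open>(\<integral>z. F z \<partial>M) \<le> _\<close> by linarith
next
  case False
  then show ?thesis using J by (simp add: not_integrable_integral_eq)
qed

text \<open>The integrand of \<open>nonlocal_op\<close> made total by the value 0 where the jump
  leaves the closure, so that \<open>D\<close> enters only through its indicator.\<close>

definition increment :: "'a::euclidean_space set \<Rightarrow> ('a \<Rightarrow> real) \<Rightarrow> 'a \<Rightarrow> 'a \<Rightarrow> real" where
  "increment \<Omega> w y z = (if y + z \<in> closure \<Omega> then w (y + z) - w y else 0)"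

lemma nonlocal_op_increment:
  "nonlocal_op \<Omega> \<nu> D w y = (\<integral>z. indicator D z * increment \<Omega> w y z \<partial>\<nu> y)"
  unfolding nonlocal_op_def set_lebesgue_integral_def increment_def
  by (intro Bochner_Integration.integral_cong) (auto simp: indicator_def)

lemma nonlocal_op_minus: "nonlocal_op \<Omega> \<nu> D (\<lambda>y. - w y) y = - nonlocal_op \<Omega> \<nu> D w y"
proof -
  have "increment \<Omega> (\<lambda>y. - w y) y z = - increment \<Omega> w y z" for z by (simp add: increment_def)
  then show ?thesis by (simp add: nonlocal_op_increment)
qed

lemma increment_measurable:
  assumes "usc_on (closure \<Omega>) w"
  shows "increment \<Omega> w y \<in> borel_measurable borel"
proof (rule borel_measurableI_less)
  fix a
  let ?C = "{z. y + z \<in> closure \<Omega>}"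
  have C: "closed ?C"
    using continuous_closed_vimage[of "closure \<Omega>" "\<lambda>z. y + z"] by (auto simp: vimage_def)
  have "usc_on ?C (\<lambda>z. w (y + z))"
    by (rule usc_on_compose[OF assms]) (auto intro!: continuous_intros)
  from usc_on_openin[OF this, of "a + w y"] obtain T where "open T"
    "{z \<in> ?C. w (y + z) < a + w y} = ?C \<inter> T" by (auto simp: openin_open)
  then have "{z \<in> ?C. w (y + z) < a + w y} \<in> sets borel" using C by auto
  moreover have "{z \<in> space borel. increment \<Omega> w y z < a} =
      {z \<in> ?C. w (y + z) < a + w y} \<union> (if 0 < a then - ?C else {})"
    by (auto simp: increment_def)
  ultimately show "{z \<in> space borel. increment \<Omega> w y z < a} \<in> sets borel"
    using C by auto
qed

lemma usc_on_slice:
  assumes "usc_on (Qbar \<Omega>) u" "0 \<le> t"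
  shows "usc_on (closure \<Omega>) (\<lambda>y. u (y, t))"
  by (rule usc_on_compose[OF assms(1)]) (use assms(2) in \<open>auto simp: Qbar_def intro!: continuous_intros\<close>)

lemma slice_bounded:
  assumes "bounded \<Omega>" "locally_bounded_on (Qbar \<Omega>) u"
  obtains R where "0 < R" "\<And>y t. y \<in> closure \<Omega> \<Longrightarrow> 0 \<le> t \<Longrightarrow> t \<le> T \<Longrightarrow> \<bar>u (y, t)\<bar> \<le> R"
proof -
  have "compact (closure \<Omega> \<times> {0..T})" using assms by (intro compact_Times) auto
  then have "bounded (u ` (closure \<Omega> \<times> {0..T}))"
    using assms(2) by (auto simp: locally_bounded_on_def Qbar_def)
  then obtain R where "\<forall>z\<in>closure \<Omega> \<times> {0..T}. \<bar>u z\<bar> \<le> R" by (auto simp: bounded_iff)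
  then show thesis by (intro that[of "max 1 R"]) (force simp: le_max_iff_disj)+
qed

context levy_setting begin

text \<open>The jump \<open>z = 0\<close> contributes nothing; it is exempted in the hypothesis
  because \<open>AE_interior\<close> says nothing about it.\<close>

lemma nonlocal_op_le:
  assumes x: "x \<in> closure \<Omega>"
    and le: "AE z in \<nu> x. z \<noteq> 0 \<longrightarrow> z \<in> D \<longrightarrow> x + z \<in> closure \<Omega> \<longrightarrow> w (x + z) - w x \<le> k z"
    and k: "\<And>z. 0 \<le> k z" "(\<integral>\<^sup>+z\<in>D. ennreal (k z) \<partial>\<nu> x) \<le> ennreal J" and J: "0 \<le> J"
  shows "nonlocal_op \<Omega> \<nu> D w x \<le> J"
  unfolding nonlocal_op_increment
proof (rule integral_le_nn[where K="\<lambda>z. indicator D z * k z"])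
  show "AE z in \<nu> x. indicator D z * increment \<Omega> w x z \<le> indicator D z * k z"
    using le by eventually_elim (use k(1) in \<open>auto simp: increment_def indicator_def\<close>)
  have "(\<integral>\<^sup>+z. ennreal (indicator D z * k z) \<partial>\<nu> x) = (\<integral>\<^sup>+z\<in>D. ennreal (k z) \<partial>\<nu> x)"
    by (intro nn_integral_cong) (auto simp: indicator_def)
  then show "(\<integral>\<^sup>+z. ennreal (indicator D z * k z) \<partial>\<nu> x) \<le> ennreal J" using k by simp
qed fact

lemma integrable_increment:
  assumes x: "x \<in> closure \<Omega>" and w: "usc_on (closure \<Omega>) w" "\<And>y. y \<in> closure \<Omega> \<Longrightarrow> \<bar>w y\<bar> \<le> R"
    and D: "D \<in> sets borel" "D \<subseteq> - ball 0 \<delta>" "0 < \<delta>"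
  shows "integrable (\<nu> x) (\<lambda>z. indicator D z * increment \<Omega> w x z)"
proof (rule Bochner_Integration.integrable_bound[where f="\<lambda>z. (2 * R) * indicator D z"])
  show "integrable (\<nu> x) (\<lambda>z. (2 * R) * indicator D z :: real)"
    using measure_tail(1)[OF x D(3,1,2)] D sets_nu[OF x]
    by (intro integrable_mult_right) (auto simp: integrable_indicator_iff)
  show "(\<lambda>z. indicator D z * increment \<Omega> w x z) \<in> borel_measurable (\<nu> x)"
    using increment_measurable[OF w(1), of x] D
    by (simp add: measurable_cong_sets[OF sets_nu[OF x] refl])
  have "\<bar>increment \<Omega> w x z\<bar> \<le> 2 * R" for z
    using w(2)[of x] w(2)[of "x + z"] x by (auto simp: increment_def abs_le_iff)
  then show "AE z in \<nu> x. norm (indicator D z * increment \<Omega> w x z) \<le> norm ((2 * R) * indicator D z)"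
    by (auto simp: indicator_def intro!: AE_I2) (meson abs_ge_self order_trans)
qed

lemma nonlocal_op_Un:
  assumes x: "x \<in> closure \<Omega>" and w: "usc_on (closure \<Omega>) w" "\<And>y. y \<in> closure \<Omega> \<Longrightarrow> \<bar>w y\<bar> \<le> R"
    and D: "D \<in> sets borel" "D' \<in> sets borel" "D \<union> D' \<subseteq> - ball 0 \<delta>" "0 < \<delta>" "D \<inter> D' = {}"
  shows "nonlocal_op \<Omega> \<nu> (D \<union> D') w x = nonlocal_op \<Omega> \<nu> D w x + nonlocal_op \<Omega> \<nu> D' w x"
proof -
  have "integrable (\<nu> x) (\<lambda>z. indicator D z * increment \<Omega> w x z)"
    "integrable (\<nu> x) (\<lambda>z. indicator D' z * increment \<Omega> w x z)"
    using D by (auto intro!: integrable_increment[OF x w])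
  from Bochner_Integration.integral_add[OF this] show ?thesis
    unfolding nonlocal_op_increment indicator_add[OF D(5), symmetric] by (simp add: distrib_right)
qed

lemma nn_integral_linear:
  assumes x: "x \<in> closure \<Omega>" and \<delta>: "0 < \<delta>" "\<delta> < 1" and \<Lambda>: "0 \<le> \<Lambda>"
  shows "(\<integral>\<^sup>+z\<in>ball 0 \<delta>. ennreal (\<Lambda> * norm z) \<partial>\<nu> x) \<le> ennreal (\<Lambda> * (C2 * \<delta> powr (1 - \<sigma>)))"
proof -
  have "(\<integral>\<^sup>+z\<in>ball 0 \<delta>. ennreal (\<Lambda> * norm z) \<partial>\<nu> x) = (\<integral>\<^sup>+z. ennreal \<Lambda> * (ennreal (norm z) * indicator (ball 0 \<delta>) z) \<partial>\<nu> x)"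
    using \<Lambda> by (intro nn_integral_cong) (auto simp: indicator_def ennreal_mult)
  also have "\<dots> = ennreal \<Lambda> * (\<integral>\<^sup>+z\<in>ball 0 \<delta>. ennreal (norm z) \<partial>\<nu> x)"
    by (intro nn_integral_cmult) (auto simp: measurable_cong_sets[OF sets_nu[OF x] refl] intro!: borel_measurable_times_ennreal borel_measurable_indicator)
  also have "\<dots> \<le> ennreal \<Lambda> * ennreal (C2 * \<delta> powr (1 - \<sigma>))"
    using near[OF x] \<delta> by (intro mult_left_mono) auto
  finally show ?thesis using \<Lambda> C2_pos by (simp add: ennreal_mult)
qed

lemma nn_integral_const_tail:
  assumes x: "x \<in> closure \<Omega>" and \<delta>: "0 < \<delta>" and K: "0 \<le> K" and D: "D \<subseteq> - ball 0 \<delta>"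
  shows "(\<integral>\<^sup>+z\<in>D. ennreal K \<partial>\<nu> x) \<le> ennreal (K * (C1 * \<delta> powr (- \<sigma>)))"
proof -
  have "(\<integral>\<^sup>+z\<in>D. ennreal K \<partial>\<nu> x) \<le> (\<integral>\<^sup>+z\<in>- ball 0 \<delta>. ennreal K \<partial>\<nu> x)"
    using D by (intro nn_integral_mono) (auto simp: indicator_def)
  also have "\<dots> = ennreal K * emeasure (\<nu> x) (- ball 0 \<delta>)"
    using sets_nu[OF x] by (intro nn_integral_cmult_indicator) auto
  also have "\<dots> \<le> ennreal K * ennreal (C1 * \<delta> powr (- \<sigma>))"
    using tail[OF x \<delta>] by (intro mult_left_mono) auto
  finally show ?thesis using K C1_pos by (simp add: ennreal_mult)
qed

text \<open>The definition is applied with radii \<open>\<delta>\<close> tending to 0. On the small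
  ball the test function contributes at most
  \<open>\<Lambda> * (C2 * \<delta> powr (1 - \<sigma>))\<close>, which vanishes in the limit; on
  the annulus up to \<open>\<delta>0\<close> the one-sided bound \<open>k\<close> on the increments
  of \<open>u\<close> itself takes over. So only the first derivatives of the test function survive.
  The hypothesis \<open>pos\<close> rules out the boundary alternatives.\<close>

lemma sub_ineq:
  assumes sub: "visc_subsolution \<Omega> \<nu> H f \<phi> u0 u" and lb: "locally_bounded_on (Qbar \<Omega>) u"
    and \<psi>: "C1_gradient_on (Qbar \<Omega>) \<psi> g" and z0: "(x, t) \<in> Qbar \<Omega>" and d: "0 < d"
    and max: "\<And>z. z \<in> Qbar \<Omega> \<Longrightarrow> norm (z - (x, t)) < d \<Longrightarrow> u z - \<psi> z \<le> u (x, t) - \<psi> (x, t)"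
    and pos: "(x, t) \<in> Qcyl \<Omega> \<or> ((x, t) \<in> lateral \<Omega> \<and> \<phi> (x, t) < u (x, t)) \<or> (t = 0 \<and> u0 x < u (x, t))"
    and \<delta>0: "0 < \<delta>0"
    and incr: "AE z in \<nu> x. z \<noteq> 0 \<longrightarrow> norm z < \<delta>0 \<longrightarrow> x + z \<in> closure \<Omega> \<longrightarrow> u (x + z, t) - u (x, t) \<le> k z"
    and k: "\<And>z. 0 \<le> k z" "(\<integral>\<^sup>+z\<in>ball 0 \<delta>0. ennreal (k z) \<partial>\<nu> x) \<le> ennreal J" and J: "0 \<le> J"
  shows "snd (g (x, t)) + H x (u (x, t)) (fst (g (x, t))) - f (x, t)
    \<le> J + nonlocal_op \<Omega> \<nu> (- ball 0 \<delta>0) (\<lambda>y. u (y, t)) x"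
proof -
  have x: "x \<in> closure \<Omega>" and t: "0 \<le> t" using z0 by (auto simp: Qbar_def)
  have usc: "usc_on (Qbar \<Omega>) u" using sub by (simp add: visc_subsolution_def)
  obtain R where R: "\<And>y. y \<in> closure \<Omega> \<Longrightarrow> \<bar>u (y, t)\<bar> \<le> R"
    using slice_bounded[OF bounded_dom lb, of t] t by (metis order_refl)
  obtain \<psi>' g' where \<psi>': "C1_gradient_on (Qbar \<Omega>) \<psi>' g'" and g': "g' (x, t) = g (x, t)"
    and max': "\<And>z. z \<in> Qbar \<Omega> \<Longrightarrow> u z - \<psi>' z \<le> u (x, t) - \<psi>' (x, t)"
    using global_test[OF bounded_dom lb \<psi> z0 d max] by metis
  have E: "visc_E \<Omega> \<nu> H f \<delta> u \<psi>' g' x t \<le> 0" if "0 < \<delta>" for \<delta>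
    using sub \<psi>' z0 max' that pos unfolding visc_subsolution_def
    by (fastforce simp: min_le_iff_disj)
  \<comment> \<open>The slope of the test function at the contact point, with 1 to spare for the
    remainder in the definition of the derivative.\<close>
  define \<Lambda> where "\<Lambda> = norm (g' (x, t)) + 1"
  have \<Lambda>: "0 \<le> \<Lambda>" by (simp add: \<Lambda>_def)
  obtain e where e: "e > 0" and
    \<psi>e: "\<And>z. z \<in> Qbar \<Omega> \<Longrightarrow> norm (z - (x, t)) < e \<Longrightarrow>
      \<bar>\<psi>' z - \<psi>' (x, t) - g' (x, t) \<bullet> (z - (x, t))\<bar> \<le> 1 * norm (z - (x, t))"
    using \<psi>' z0 unfolding C1_gradient_on_def has_derivative_within_alt
    by (metis real_norm_def zero_less_one)
  have \<psi>\<Lambda>: "\<psi>' (x + z, t) - \<psi>' (x, t) \<le> \<Lambda> * norm z" if "x + z \<in> closure \<Omega>" "norm z < e" for z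
  proof -
    have "norm ((x + z, t) - (x, t)) = norm z" by (simp add: norm_Pair)
    moreover have "\<bar>g' (x, t) \<bullet> ((x + z, t) - (x, t))\<bar> \<le> norm (g' (x, t)) * norm z"
      using Cauchy_Schwarz_ineq2[of "g' (x, t)" "(x + z, t) - (x, t)"] by (simp add: norm_Pair)
    ultimately show ?thesis using \<psi>e[of "(x + z, t)"] that t by (auto simp: Qbar_def \<Lambda>_def algebra_simps)
  qed
  let ?I = "nonlocal_op \<Omega> \<nu> (- ball 0 \<delta>0) (\<lambda>y. u (y, t)) x"
  let ?L = "snd (g (x, t)) + H x (u (x, t)) (fst (g (x, t))) - f (x, t)"
  have main: "?L \<le> \<Lambda> * (C2 * \<delta> powr (1 - \<sigma>)) + (J + ?I)" if \<delta>: "0 < \<delta>" "\<delta> < min e (min 1 \<delta>0)" for \<delta>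
  proof -
    have "nonlocal_op \<Omega> \<nu> (ball 0 \<delta>) (\<lambda>y. \<psi>' (y, t)) x \<le> \<Lambda> * (C2 * \<delta> powr (1 - \<sigma>))"
    proof (rule nonlocal_op_le[OF x])
      show "AE z in \<nu> x. z \<noteq> 0 \<longrightarrow> z \<in> ball 0 \<delta> \<longrightarrow> x + z \<in> closure \<Omega> \<longrightarrow> \<psi>' (x + z, t) - \<psi>' (x, t) \<le> \<Lambda> * norm z"
        using \<psi>\<Lambda> \<delta> by (intro AE_I2) auto
      show "(\<integral>\<^sup>+z\<in>ball 0 \<delta>. ennreal (\<Lambda> * norm z) \<partial>\<nu> x) \<le> ennreal (\<Lambda> * (C2 * \<delta> powr (1 - \<sigma>)))"
        using nn_integral_linear[OF x _ _ \<Lambda>] \<delta> by simp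
    qed (use \<Lambda> C2_pos in auto)
    moreover have "nonlocal_op \<Omega> \<nu> (- ball 0 \<delta>) (\<lambda>y. u (y, t)) x =
        ?I + nonlocal_op \<Omega> \<nu> (ball 0 \<delta>0 - ball 0 \<delta>) (\<lambda>y. u (y, t)) x"
    proof -
      have "- ball 0 \<delta> = - ball 0 \<delta>0 \<union> (ball 0 \<delta>0 - ball (0::'a) \<delta>)" using \<delta> by auto
      then show ?thesis
        using nonlocal_op_Un[OF x usc_on_slice[OF usc t] R, of "- ball 0 \<delta>0" "ball 0 \<delta>0 - ball 0 \<delta>" \<delta>] \<delta> by auto
    qed
    moreover have "nonlocal_op \<Omega> \<nu> (ball 0 \<delta>0 - ball 0 \<delta>) (\<lambda>y. u (y, t)) x \<le> J"
    proof (rule nonlocal_op_le[OF x _ k(1) _ J])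
      show "AE z in \<nu> x. z \<noteq> 0 \<longrightarrow> z \<in> ball 0 \<delta>0 - ball 0 \<delta> \<longrightarrow> x + z \<in> closure \<Omega> \<longrightarrow> u (x + z, t) - u (x, t) \<le> k z"
        using incr by eventually_elim auto
      have "(\<integral>\<^sup>+z\<in>ball 0 \<delta>0 - ball 0 \<delta>. ennreal (k z) \<partial>\<nu> x) \<le> (\<integral>\<^sup>+z\<in>ball 0 \<delta>0. ennreal (k z) \<partial>\<nu> x)"
        by (intro nn_integral_mono) (auto simp: indicator_def)
      then show "(\<integral>\<^sup>+z\<in>ball 0 \<delta>0 - ball 0 \<delta>. ennreal (k z) \<partial>\<nu> x) \<le> ennreal J"
        using k(2) by (rule order_trans)
    qed
    ultimately show ?thesis using E[OF \<delta>(1)] unfolding visc_E_def g' by linarith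
  qed
  have "((\<lambda>\<delta>. \<Lambda> * (C2 * \<delta> powr (1 - \<sigma>)) + (J + ?I)) \<longlongrightarrow> \<Lambda> * (C2 * 0) + (J + ?I)) (at_right 0)"
    using sigma_less
    by (intro tendsto_intros tendsto_zero_powrI[where b="1 - \<sigma>"]) (auto simp: eventually_at_right_less eventually_mono[OF eventually_at_right_less])
  moreover have "\<forall>\<^sub>F \<delta> in at_right 0. ?L \<le> \<Lambda> * (C2 * \<delta> powr (1 - \<sigma>)) + (J + ?I)"
    using main e \<delta>0 by (auto simp: eventually_at_right_field intro!: exI[of _ "min e (min 1 \<delta>0)"])
  ultimately show ?thesis using tendsto_lowerbound[of _ _ "at_right (0::real)" ?L] by fastforce
qed

lemma nonlocal_op_tail_le:
  assumes x: "x \<in> closure \<Omega>" and \<delta>: "0 < \<delta>" and w: "\<And>y. y \<in> closure \<Omega> \<Longrightarrow> \<bar>w y\<bar> \<le> R" and R: "0 \<le> R"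
  shows "nonlocal_op \<Omega> \<nu> (- ball 0 \<delta>) w x \<le> 2 * R * (C1 * \<delta> powr (- \<sigma>))"
proof (rule nonlocal_op_le[OF x, where k="\<lambda>_. 2 * R"])
  have "w (x + z) - w x \<le> 2 * R" if "x + z \<in> closure \<Omega>" for z
    using w[OF x] w[OF that] by linarith
  then show "AE z in \<nu> x. z \<noteq> 0 \<longrightarrow> z \<in> - ball 0 \<delta> \<longrightarrow> x + z \<in> closure \<Omega> \<longrightarrow> w (x + z) - w x \<le> 2 * R"
    by (intro AE_I2) auto
  show "(\<integral>\<^sup>+z\<in>- ball 0 \<delta>. ennreal (2 * R) \<partial>\<nu> x) \<le> ennreal (2 * R * (C1 * \<delta> powr (- \<sigma>)))"
    by (rule nn_integral_const_tail[OF x \<delta>]) (use R in auto)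
qed (use R C1_pos in auto)

text \<open>Results for subsolutions transfer to \<open>- v\<close> as long as they avoid (H2),
  which reflection destroys: the reflected Hamiltonian is bounded above, not below, at large
  gradients. This concerns \<open>super_ineq\<close> and the initial inequality.\<close>

lemma visc_super_minus:
  assumes "visc_supersolution \<Omega> \<nu> H f \<phi> u0 v"
  shows "visc_subsolution \<Omega> \<nu> (\<lambda>x r p. - H x (- r) (- p)) (\<lambda>z. - f z) (\<lambda>z. - \<phi> z) (\<lambda>x. - u0 x) (\<lambda>z. - v z)"
  unfolding visc_subsolution_def
proof (intro conjI allI impI)
  show "usc_on (Qbar \<Omega>) (\<lambda>z. - v z)"
    using assms by (auto simp: visc_supersolution_def intro: lsc_imp_usc_on_minus)
  fix \<psi> g x t and \<delta> :: real
  assume a: "C1_gradient_on (Qbar \<Omega>) \<psi> g" "(x, t) \<in> Qbar \<Omega>"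
    "\<forall>z\<in>Qbar \<Omega>. - v z - \<psi> z \<le> - v (x, t) - \<psi> (x, t)" "0 < \<delta>"
  have b: "C1_gradient_on (Qbar \<Omega>) (\<lambda>z. - \<psi> z) (\<lambda>z. - g z)" using a(1) by (rule C1_gradient_on_minus)
  have c: "\<forall>z\<in>Qbar \<Omega>. v (x, t) - (- \<psi> (x, t)) \<le> v z - (- \<psi> z)" using a(3) by fastforce
  have E: "visc_E \<Omega> \<nu> (\<lambda>x r p. - H x (- r) (- p)) (\<lambda>z. - f z) \<delta> (\<lambda>z. - v z) \<psi> g x t =
     - visc_E \<Omega> \<nu> H f \<delta> v (\<lambda>z. - \<psi> z) (\<lambda>z. - g z) x t"
    unfolding visc_E_def nonlocal_op_minus by simp
  note s = assms[unfolded visc_supersolution_def, THEN conjunct2, rule_format, OF b a(2) c[rule_format] a(4)]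
  show "visc_E \<Omega> \<nu> (\<lambda>x r p. - H x (- r) (- p)) (\<lambda>z. - f z) \<delta> (\<lambda>z. - v z) \<psi> g x t \<le> 0"
    if "(x, t) \<in> Qcyl \<Omega>"
    using s that unfolding E by auto
  show "min (visc_E \<Omega> \<nu> (\<lambda>x r p. - H x (- r) (- p)) (\<lambda>z. - f z) \<delta> (\<lambda>z. - v z) \<psi> g x t)
     (- v (x, t) - - \<phi> (x, t)) \<le> 0" if "(x, t) \<in> lateral \<Omega>"
    using s that unfolding E by (auto simp: min_le_iff_disj le_max_iff_disj)
  show "min (visc_E \<Omega> \<nu> (\<lambda>x r p. - H x (- r) (- p)) (\<lambda>z. - f z) \<delta> (\<lambda>z. - v z) \<psi> g x t)
     (- v (x, t) - - u0 x) \<le> 0" if "t = 0"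
    using s that unfolding E by (auto simp: min_le_iff_disj le_max_iff_disj)
qed

lemma super_ineq:
  assumes sup: "visc_supersolution \<Omega> \<nu> H f \<phi> u0 v" and lb: "locally_bounded_on (Qbar \<Omega>) v"
    and \<psi>: "C1_gradient_on (Qbar \<Omega>) \<psi> g" and z0: "(x, t) \<in> Qbar \<Omega>" and d: "0 < d"
    and min: "\<And>z. z \<in> Qbar \<Omega> \<Longrightarrow> norm (z - (x, t)) < d \<Longrightarrow> v (x, t) - \<psi> (x, t) \<le> v z - \<psi> z"
    and pos: "(x, t) \<in> Qcyl \<Omega> \<or> ((x, t) \<in> lateral \<Omega> \<and> v (x, t) < \<phi> (x, t)) \<or> (t = 0 \<and> v (x, t) < u0 x)"
    and \<delta>0: "0 < \<delta>0"
    and incr: "AE z in \<nu> x. z \<noteq> 0 \<longrightarrow> norm z < \<delta>0 \<longrightarrow> x + z \<in> closure \<Omega> \<longrightarrow> - k z \<le> v (x + z, t) - v (x, t)"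
    and k: "\<And>z. 0 \<le> k z" "(\<integral>\<^sup>+z\<in>ball 0 \<delta>0. ennreal (k z) \<partial>\<nu> x) \<le> ennreal J" and J: "0 \<le> J"
  shows "nonlocal_op \<Omega> \<nu> (- ball 0 \<delta>0) (\<lambda>y. v (y, t)) x - J
    \<le> snd (g (x, t)) + H x (v (x, t)) (fst (g (x, t))) - f (x, t)"
proof -
  have lb': "locally_bounded_on (Qbar \<Omega>) (\<lambda>z. - v z)"
    using lb by (auto simp: locally_bounded_on_def bounded_iff)
  have "AE z in \<nu> x. z \<noteq> 0 \<longrightarrow> norm z < \<delta>0 \<longrightarrow> x + z \<in> closure \<Omega> \<longrightarrow> - v (x + z, t) - - v (x, t) \<le> k z"
    using incr by eventually_elim auto
  note ae = this
  have m: "- v z - - \<psi> z \<le> - v (x, t) - - \<psi> (x, t)" if "z \<in> Qbar \<Omega>" "norm (z - (x, t)) < d" for z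
    using min[OF that] by linarith
  have p: "(x, t) \<in> Qcyl \<Omega> \<or> ((x, t) \<in> lateral \<Omega> \<and> - \<phi> (x, t) < - v (x, t)) \<or> (t = 0 \<and> - u0 x < - v (x, t))"
    using pos by auto
  from sub_ineq[OF visc_super_minus[OF sup] lb' C1_gradient_on_minus[OF \<psi>] z0 d m p \<delta>0 ae k J]
  show ?thesis by (simp add: nonlocal_op_minus)
qed

end

section \<open>Comparison of powers, and local defining functions of the domain\<close>

text \<open>Coercivity of order \<open>m\<close> against a nonlocal term of order
  \<open>\<sigma>\<close>: this provides the large slopes \<open>K\<close> in
  \<open>lateral_le\<close> and \<open>L\<close> in \<open>lipschitz_estimate\<close>.\<close>

lemma powr_dominates:
  fixes \<sigma> m c A B :: real
  assumes "0 < \<sigma>" "\<sigma> < m" "0 < c"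
  shows "\<forall>\<^sub>F K in at_top. A + B * K powr \<sigma> < c * K powr m"
proof -
  let ?C = "(\<bar>A\<bar> + \<bar>B\<bar> + 1) / c"
  have C: "0 < ?C" using assms by (auto intro!: divide_pos_pos add_nonneg_pos)
  have 1: "\<forall>\<^sub>F K in at_top. ?C \<le> K powr (m - \<sigma>)"
    using eventually_ge_at_top[of "?C powr (1 / (m - \<sigma>))"]
  proof eventually_elim
    case (elim K)
    have "?C = (?C powr (1 / (m - \<sigma>))) powr (m - \<sigma>)" using assms C by (simp add: powr_powr)
    also have "\<dots> \<le> K powr (m - \<sigma>)" using assms elim by (intro powr_mono2) auto
    finally show ?case .
  qed
  show ?thesis using 1 eventually_ge_at_top[of "1::real"]
  proof eventually_elim
    case (elim K)
    have K1: "1 \<le> K powr \<sigma>" using elim assms by (intro ge_one_powr_ge_zero) auto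
    have "\<bar>A\<bar> + \<bar>B\<bar> + 1 \<le> c * K powr (m - \<sigma>)" using elim assms by (simp add: field_simps)
    then have "(\<bar>A\<bar> + \<bar>B\<bar> + 1) * K powr \<sigma> \<le> (c * K powr (m - \<sigma>)) * K powr \<sigma>"
      using K1 by (intro mult_right_mono) auto
    also have "\<dots> = c * K powr m" by (simp add: powr_add[symmetric] mult.assoc)
    finally have "\<bar>A\<bar> * K powr \<sigma> + \<bar>B\<bar> * K powr \<sigma> + K powr \<sigma> \<le> c * K powr m" by (simp add: algebra_simps)
    moreover have "A \<le> \<bar>A\<bar> * K powr \<sigma>" using K1 mult_left_mono[of 1 "K powr \<sigma>" "\<bar>A\<bar>"] by auto
    moreover have "B * K powr \<sigma> \<le> \<bar>B\<bar> * K powr \<sigma>" by (intro mult_right_mono) auto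
    ultimately show ?case using K1 by linarith
  qed
qed

lemma norm_fst_diff: "norm (fst z - a) \<le> norm (z - (a, b))"
  using norm_fst_le[of "fst z - a" "snd z - b"] by (cases z) simp

lemma norm_snd_diff: "norm (snd z - b) \<le> norm (z - (a, b))"
  using norm_snd_le[of "snd z - b" "fst z - a"] by (cases z) simp

lemma C1_gradient_on_sq_penalty:
  fixes z0 :: "'b::euclidean_space"
  shows "C1_gradient_on S (\<lambda>z. Q * ((z - z0) \<bullet> (z - z0))) (\<lambda>z. (2 * Q) *\<^sub>R (z - z0))"
  unfolding C1_gradient_on_def
  by (auto intro!: continuous_intros derivative_eq_intros simp: inner_commute)

lemma C1_gradient_on_fst:
  assumes "C1_gradient_on UNIV g Dg"
  shows "C1_gradient_on S (\<lambda>z. g (fst z)) (\<lambda>z. (Dg (fst z), 0))"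
  unfolding C1_gradient_on_def
proof (intro conjI ballI)
  show "continuous_on S (\<lambda>z. (Dg (fst z), 0))"
    using assms by (intro continuous_intros continuous_on_compose2[of UNIV Dg _ fst]) (auto simp: C1_gradient_on_def)
  fix x assume "x \<in> S"
  have "(g has_derivative (\<lambda>h. Dg (fst x) \<bullet> h)) (at (fst x))" using assms by (auto simp: C1_gradient_on_def)
  from has_derivative_compose[OF has_derivative_fst[OF has_derivative_ident] this]
  show "((\<lambda>z. g (fst z)) has_derivative (\<lambda>h. (Dg (fst x), 0) \<bullet> h)) (at x within S)"
    by (simp add: inner_prod_def)
qed

lemma C1_gradient_on_snd:
  assumes "\<And>t. (\<theta> has_real_derivative \<theta>' t) (at t)" "continuous_on UNIV \<theta>'"
  shows "C1_gradient_on S (\<lambda>z. \<theta> (snd z)) (\<lambda>z. (0, \<theta>' (snd z)))"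
  unfolding C1_gradient_on_def
proof (intro conjI ballI)
  show "continuous_on S (\<lambda>z. (0, \<theta>' (snd z)))"
    by (intro continuous_intros continuous_on_compose2[OF assms(2)]) auto
  fix x assume "x \<in> S"
  have "(\<theta> has_derivative (\<lambda>h. \<theta>' (snd x) * h)) (at (snd x))" using assms(1) has_field_derivative_def by blast
  from has_derivative_compose[OF has_derivative_snd[OF has_derivative_ident] this]
  show "((\<lambda>z. \<theta> (snd z)) has_derivative (\<lambda>h. (0, \<theta>' (snd x)) \<bullet> h)) (at x within S)"
    by (simp add: inner_prod_def)
qed

lemma C1_gradient_on_continuous:
  "C1_gradient_on S f g \<Longrightarrow> continuous_on S f"
  unfolding C1_gradient_on_def by (auto intro: has_derivative_continuous_on)

text \<open>A local defining function with its bounds, in a form that also fits interior points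
  (\<open>g = 1\<close>, \<open>e = 0\<close>), so that later proofs need not distinguish the two
  kinds. The clause with \<open>g x \<le> g y / 2\<close> concerns points much closer to the
  boundary than \<open>y\<close>: there the gradient of \<open>g\<close> does not degenerate and
  hardly points along \<open>x - y\<close>. By the last clause a small ball around
  \<open>y + \<epsilon> *\<^sub>R e\<close> lies inside, even if \<open>y\<close> is a boundary
  point.\<close>

definition patch :: "'a::euclidean_space set \<Rightarrow> 'a \<Rightarrow> real \<Rightarrow> real \<Rightarrow> 'a \<Rightarrow> ('a \<Rightarrow> real) \<Rightarrow> ('a \<Rightarrow> 'a) \<Rightarrow> bool" where
  "patch \<Omega> x0 r G e g Dg \<longleftrightarrow> 0 < r \<and> r \<le> 1 \<and> 1 \<le> G \<and> norm e \<le> 1 \<and> C1_gradient_on UNIV g Dg \<and>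
     (\<forall>x\<in>ball x0 r. (x \<in> \<Omega> \<longleftrightarrow> 0 < g x) \<and> (x \<in> closure \<Omega> \<longrightarrow> 0 \<le> g x) \<and> g x \<le> 1 \<and> norm (Dg x) \<le> G) \<and>
     (\<forall>x\<in>ball x0 r. \<forall>y\<in>ball x0 r. \<bar>g x - g y\<bar> \<le> G * norm (x - y)) \<and>
     (x0 \<in> frontier \<Omega> \<longrightarrow> (\<forall>x\<in>ball x0 r. 1 \<le> norm (Dg x))) \<and>
     (\<forall>x\<in>ball x0 r \<inter> \<Omega>. \<forall>y\<in>ball x0 r \<inter> \<Omega>. g x \<le> g y / 2 \<longrightarrow>
        1 \<le> norm (Dg x) \<and> Dg x \<bullet> (x - y) \<le> norm (x - y) / 8) \<and>
     (\<forall>y\<in>ball x0 (r/2) \<inter> closure \<Omega>. \<forall>\<epsilon> x. 0 < \<epsilon> \<longrightarrow> \<epsilon> < r / 4 \<longrightarrow> norm (x - y - \<epsilon> *\<^sub>R e) \<le> \<epsilon> / (2 * G) \<longrightarrow> x \<in> \<Omega>)"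

text \<open>The reference vector \<open>a\<close> serves two purposes: 0 gives the Lipschitz bound
  of \<open>g\<close>, and \<open>Dg x\<close> its linearization error.\<close>

lemma C1_gradient_mvt:
  fixes g :: "'a::euclidean_space \<Rightarrow> real"
  assumes g: "C1_gradient_on UNIV g Dg" and S: "convex S" and xy: "x \<in> S" "y \<in> S"
    and B: "\<And>z. z \<in> S \<Longrightarrow> norm (Dg z - a) \<le> B"
  shows "\<bar>g x - g y - a \<bullet> (x - y)\<bar> \<le> B * norm (x - y)"
proof -
  have "norm ((g x - a \<bullet> x) - (g y - a \<bullet> y)) \<le> B * norm (x - y)"
  proof (rule differentiable_bound[OF S])
    fix z assume z: "z \<in> S"
    have "(g has_derivative (\<lambda>h. Dg z \<bullet> h)) (at z within S)"
      using g by (auto simp: C1_gradient_on_def intro: has_derivative_at_withinI)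
    then show "((\<lambda>z. g z - a \<bullet> z) has_derivative (\<lambda>h. (Dg z - a) \<bullet> h)) (at z within S)"
      by (auto intro!: derivative_eq_intros simp: inner_diff_left)
    show "onorm (\<lambda>h. (Dg z - a) \<bullet> h) \<le> B"
      by (rule onorm_le) (metis B[OF z] Cauchy_Schwarz_ineq2 mult_right_mono norm_ge_zero order_trans real_norm_def)
  qed (use xy in auto)
  then show ?thesis by (simp add: inner_diff_right algebra_simps)
qed

context levy_setting begin

lemma patch_interior:
  assumes x0: "x0 \<in> \<Omega>"
  obtains r where "patch \<Omega> x0 r 1 0 (\<lambda>_. 1) (\<lambda>_. 0)"
proof -
  obtain r0 where r0: "0 < r0" "ball x0 r0 \<subseteq> \<Omega>" using open_dom x0 open_contains_ball by blast
  define r where "r = min r0 1"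
  have r: "0 < r" "r \<le> 1" "ball x0 r \<subseteq> \<Omega>" using r0 by (auto simp: r_def)
  have last: "x \<in> \<Omega>" if "y \<in> ball x0 (r/2)" "0 < \<epsilon>" "\<epsilon> < r / 4" "norm (x - y) \<le> \<epsilon> / 2" for x y and \<epsilon> :: real
  proof -
    have "dist x0 x < r" using dist_triangle[of x0 x y] that by (simp add: dist_norm[of y x] norm_minus_commute)
    then show ?thesis using r by auto
  qed
  show thesis
    by (rule that[of r]) (use r last x0 open_dom in
      \<open>auto simp: patch_def C1_gradient_on_def frontier_def interior_open closure_subset[THEN subsetD]\<close>)
qed

lemma patch_boundary:
  assumes x0: "x0 \<in> frontier \<Omega>"
  obtains r G e g Dg where "patch \<Omega> x0 r G e g Dg"
proof -
  obtain r0 e \<gamma> where r0: "r0 > 0" "norm e = 1" "C1_on UNIV \<gamma>"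
    and eq: "\<Omega> \<inter> ball x0 r0 = {x \<in> ball x0 r0. \<gamma> (x - (x \<bullet> e) *\<^sub>R e) < x \<bullet> e}"
    using C1_bdry x0 unfolding C1_boundary_def by meson
  obtain D\<gamma> where D\<gamma>: "C1_gradient_on UNIV \<gamma> D\<gamma>" using r0(3) by (auto simp: C1_on_def)
  have \<gamma>: "continuous_on UNIV \<gamma>" using C1_gradient_imp_continuous[OF D\<gamma>] .
  have ee: "e \<bullet> e = 1" using r0(2) by (simp add: dot_square_norm)
  define P where "P x = x - (x \<bullet> e) *\<^sub>R e" for x
  have P_self: "a \<bullet> P b = P a \<bullet> b" for a b
    by (simp add: P_def inner_diff_left inner_diff_right) (simp add: inner_commute)
  have dP: "(P has_derivative P) F" for F
    unfolding P_def by (auto intro!: derivative_eq_intros)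
  have cP: "continuous_on UNIV P" unfolding P_def by (intro continuous_intros)
  define g where "g x = x \<bullet> e - \<gamma> (P x)" for x
  define Dg where "Dg x = e - P (D\<gamma> (P x))" for x
  have D\<gamma>d: "(\<gamma> has_derivative (\<lambda>h. D\<gamma> x \<bullet> h)) (at x)" and cD\<gamma>: "continuous_on UNIV D\<gamma>" for x
    using D\<gamma> by (auto simp: C1_gradient_on_def)
  have Dg: "C1_gradient_on UNIV g Dg"
    unfolding C1_gradient_on_def
  proof (intro conjI ballI)
    show "continuous_on UNIV Dg" unfolding Dg_def
      by (intro continuous_intros continuous_on_compose2[OF cP] continuous_on_compose2[OF cD\<gamma>] cP) auto
    fix x
    have d\<gamma>: "((\<lambda>x. \<gamma> (P x)) has_derivative (\<lambda>h. D\<gamma> (P x) \<bullet> P h)) (at x)"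
      using has_derivative_compose[OF dP D\<gamma>d] by simp
    show "(g has_derivative (\<lambda>h. Dg x \<bullet> h)) (at x)"
      using has_derivative_diff[OF has_derivative_inner_left[OF has_derivative_ident, of e] d\<gamma>]
      by (simp add: g_def[abs_def] Dg_def inner_diff_left P_self inner_commute[of _ e])
  qed
  \<comment> \<open>The range of \<open>P\<close> is orthogonal to \<open>e\<close>, so the vertical
    derivative of \<open>g\<close> is 1 and its gradient cannot vanish.\<close>
  have Dge: "Dg x \<bullet> e = 1" for x
    by (simp add: Dg_def inner_diff_left ee P_def)
  then have Dg1: "1 \<le> norm (Dg x)" for x
    using Cauchy_Schwarz_ineq2[of "Dg x" e] r0(2) by (simp add: Dge)
  define G where "G = norm (Dg x0) + 1"
  have G: "1 \<le> G" by (simp add: G_def)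
  have "continuous (at x0) Dg" using Dg by (auto simp: C1_gradient_on_def continuous_on_eq_continuous_at)
  \<comment> \<open>The tolerance \<open>1/16\<close> makes \<open>Dg\<close> oscillate by at most
    \<open>1/8\<close> over the ball, which is the constant in \<open>patch\<close>.\<close>
  then obtain r1 where r1: "0 < r1" "\<And>x. dist x x0 < r1 \<Longrightarrow> dist (Dg x) (Dg x0) < 1/16"
    unfolding continuous_at_eps_delta using that by (auto dest!: spec[of _ "1/16"])
  \<comment> \<open>The bound \<open>1 / G\<close> keeps \<open>g \<le> 1\<close> on the ball, as
    \<open>g\<close> vanishes at \<open>x0\<close> and has slope at most \<open>G\<close>.\<close>
  define r where "r = min (min r0 r1) (1 / G)"
  have r: "0 < r" "r \<le> 1" "r \<le> r0" "r \<le> r1" "G * r \<le> 1"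
  proof -
    have G1: "1 / G \<le> 1" "0 < 1 / G" using G by auto
    have rG: "r \<le> 1 / G" by (simp add: r_def)
    have "G * r \<le> G * (1 / G)" using rG G by (intro mult_left_mono) auto
    then show "G * r \<le> 1" using G by simp
    show "r \<le> 1" using rG G1 by linarith
    show "0 < r" "r \<le> r0" "r \<le> r1" using r0 r1 G1 by (auto simp: r_def)
  qed
  have Dg0: "norm (Dg x - Dg x0) \<le> 1/16" if "x \<in> ball x0 r" for x
    using r1(2)[of x] that r by (simp add: dist_norm norm_minus_commute[of x0 x])
  have Dgxy: "norm (Dg y - Dg x) \<le> 1/8" if "x \<in> ball x0 r" "y \<in> ball x0 r" for x y
    using norm_triangle_ineq4[of "Dg y - Dg x0" "Dg x - Dg x0"] Dg0[OF that(1)] Dg0[OF that(2)] by simp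
  have DgG: "norm (Dg x) \<le> G" if "x \<in> ball x0 r" for x
    using norm_triangle_ineq[of "Dg x - Dg x0" "Dg x0"] Dg0[OF that] by (simp add: G_def)
  have lip: "\<bar>g x - g y\<bar> \<le> G * norm (x - y)" if "x \<in> ball x0 r" "y \<in> ball x0 r" for x y
    using C1_gradient_mvt[OF Dg convex_ball that, of 0 G] DgG by simp
  have mv: "\<bar>g x - g y - Dg x \<bullet> (x - y)\<bar> \<le> 1/8 * norm (x - y)" if "x \<in> ball x0 r" "y \<in> ball x0 r" for x y
    using C1_gradient_mvt[OF Dg convex_ball that, of "Dg x" "1/8"] Dgxy that by simp
  note fg = frontier_graph[OF open_dom \<gamma> eq, folded P_def, folded g_def]
  have g0: "g x0 = 0" using fg(3)[of x0] x0 r0(1) by simp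
  have br: "x \<in> ball x0 r0" if "x \<in> ball x0 r" for x using that r by auto
  have g1: "g x \<le> 1" if "x \<in> ball x0 r" for x
  proof -
    have "g x \<le> G * norm (x - x0)" using lip[OF that, of x0] r g0 by simp
    also have "\<dots> \<le> G * r" using that G by (intro mult_left_mono) (auto simp: dist_norm norm_minus_commute)
    finally show ?thesis using r by simp
  qed
  have ge: "g (y + \<epsilon> *\<^sub>R e) = g y + \<epsilon>" for y \<epsilon>
    by (simp add: g_def P_def inner_add_left ee algebra_simps)
  have last: "x \<in> \<Omega>" if y: "y \<in> ball x0 (r/2)" "y \<in> closure \<Omega>" and \<epsilon>: "0 < \<epsilon>" "\<epsilon> < r / 4"
    and x: "norm (x - y - \<epsilon> *\<^sub>R e) \<le> \<epsilon> / (2 * G)" for x y \<epsilon>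
  proof -
    have "\<epsilon> / (2 * G) \<le> \<epsilon> / 2" using G \<epsilon> by (intro divide_left_mono) auto
    have ye: "y + \<epsilon> *\<^sub>R e \<in> ball x0 r"
      using norm_triangle_ineq[of "y - x0" "\<epsilon> *\<^sub>R e"] y(1) \<epsilon> r0(2)
      by (simp add: dist_norm norm_minus_commute[of x0] algebra_simps)
    have "norm (x - x0) \<le> norm (y - x0) + norm (\<epsilon> *\<^sub>R e) + norm (x - y - \<epsilon> *\<^sub>R e)"
      using norm_triangle_ineq[of "y - x0 + \<epsilon> *\<^sub>R e" "x - y - \<epsilon> *\<^sub>R e"] norm_triangle_ineq[of "y - x0" "\<epsilon> *\<^sub>R e"]
      by (simp add: algebra_simps)
    also have "\<dots> < r" using y(1) \<epsilon> r0(2) x \<open>\<epsilon> / (2 * G) \<le> \<epsilon> / 2\<close>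
      by (simp add: dist_norm norm_minus_commute[of x0])
    finally have xb: "x \<in> ball x0 r" by (simp add: dist_norm norm_minus_commute)
    \<comment> \<open>The point \<open>y + \<epsilon> *\<^sub>R e\<close> has height at least
      \<open>\<epsilon>\<close>, and within \<open>\<epsilon> / (2 * G)\<close> of it the height
      varies by at most \<open>\<epsilon> / 2\<close>.\<close>
    have "\<bar>g x - g (y + \<epsilon> *\<^sub>R e)\<bar> \<le> G * norm (x - (y + \<epsilon> *\<^sub>R e))" by (rule lip[OF xb ye])
    also have "\<dots> \<le> G * (\<epsilon> / (2 * G))" using x G by (intro mult_left_mono) (auto simp: algebra_simps)
    also have "\<dots> = \<epsilon> / 2" using G by simp
    finally have "g x \<ge> g y + \<epsilon> - \<epsilon> / 2" unfolding ge by linarith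
    moreover have "g y \<ge> 0" using fg(2)[of y] y r by auto
    ultimately show ?thesis using fg(1)[OF br[OF xb]] \<epsilon> by simp
  qed
  have "patch \<Omega> x0 r G e g Dg"
    unfolding patch_def
  proof (intro conjI ballI allI impI)
    show "Dg x \<bullet> (x - y) \<le> norm (x - y) / 8"
      if "x \<in> ball x0 r \<inter> \<Omega>" "y \<in> ball x0 r \<inter> \<Omega>" "g x \<le> g y / 2" for x y
    proof -
      \<comment> \<open>\<open>Dg x \<bullet> (x - y)\<close> exceeds \<open>g x - g y\<close> by at
        most an eighth of the distance, and this difference is negative.\<close>
      have "0 < g y" "\<bar>g x - g y - Dg x \<bullet> (x - y)\<bar> \<le> 1/8 * norm (x - y)"
        using mv[of x y] fg(1)[of y] br[of y] that by auto
      then show ?thesis using that(3) by linarith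
    qed
    show "0 < r" "r \<le> 1" "1 \<le> G" "norm e \<le> 1" "C1_gradient_on UNIV g Dg" using r G r0(2) Dg by auto
    show "(x \<in> \<Omega>) = (0 < g x)" "g x \<le> 1" "norm (Dg x) \<le> G" "1 \<le> norm (Dg x)" if "x \<in> ball x0 r" for x
      using fg(1)[OF br[OF that]] g1[OF that] DgG[OF that] Dg1 by auto
    show "0 \<le> g x" if "x \<in> ball x0 r" "x \<in> closure \<Omega>" for x using fg(2)[OF br] that by simp
    show "\<bar>g x - g y\<bar> \<le> G * norm (x - y)" if "x \<in> ball x0 r" "y \<in> ball x0 r" for x y
      using lip that by simp
    show "x \<in> \<Omega>" if "y \<in> ball x0 (r / 2) \<inter> closure \<Omega>" "0 < \<epsilon>" "\<epsilon> < r / 4"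
      "norm (x - y - \<epsilon> *\<^sub>R e) \<le> \<epsilon> / (2 * G)" for x y \<epsilon>
      using last[of y \<epsilon> x] that by simp
    show "1 \<le> norm (Dg x)" for x by (rule Dg1)
  qed
  then show thesis by (rule that)
qed

lemma patch_exists:
  assumes "x0 \<in> closure \<Omega>"
  obtains r G e g Dg where "patch \<Omega> x0 r G e g Dg"
proof (cases "x0 \<in> \<Omega>")
  case True
  show thesis by (rule patch_interior[OF True]) (rule that)
next
  case False
  have "x0 \<in> frontier \<Omega>" using False assms open_dom by (simp add: frontier_def interior_open)
  show thesis by (rule patch_boundary[OF \<open>x0 \<in> frontier \<Omega>\<close>]) (rule that)
qed

end

section \<open>Initial and lateral boundary values\<close>

lemma sq_penalty_increment:
  fixes a b z :: "'b::real_inner"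
  assumes "norm a \<le> 1" "norm z \<le> 1"
  shows "\<bar>(a + z) \<bullet> (a + z) - a \<bullet> a\<bar> \<le> 3 * norm z"
proof -
  have "(a + z) \<bullet> (a + z) - a \<bullet> a = 2 * (a \<bullet> z) + z \<bullet> z" by (simp add: inner_add_left inner_add_right inner_commute)
  moreover have "\<bar>a \<bullet> z\<bar> \<le> 1 * norm z"
    using Cauchy_Schwarz_ineq2[of a z] mult_right_mono[OF assms(1), of "norm z"] by simp
  moreover have "z \<bullet> z \<le> 1 * norm z" "0 \<le> z \<bullet> z" unfolding dot_square_norm power2_eq_square
    by (intro mult_right_mono assms) auto
  ultimately show ?thesis by linarith
qed

context levy_setting begin

lemma closed_Qbar: "closed (Qbar \<Omega>)"
  unfolding Qbar_def by (intro closed_Times) auto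

text \<open>The quadratic penalty forces the maximum into the half ball.\<close>

lemma penalized_max:
  assumes usc: "usc_on (Qbar \<Omega>) u" and \<psi>: "continuous_on (Qbar \<Omega>) \<psi>" and z0: "z0 \<in> Qbar \<Omega>" and d: "0 < d"
    and R: "\<And>z. z \<in> Qbar \<Omega> \<Longrightarrow> norm (z - z0) \<le> d \<Longrightarrow> \<bar>u z\<bar> \<le> R"
    and \<psi>0: "\<And>z. z \<in> Qbar \<Omega> \<Longrightarrow> norm (z - z0) \<le> d \<Longrightarrow> \<psi> z0 \<le> \<psi> z"
    and Q: "2 * R < Q * (d/2)\<^sup>2"
  obtains z where "z \<in> Qbar \<Omega>" "norm (z - z0) < d / 2" "u z0 \<le> u z"
    "\<And>w. w \<in> Qbar \<Omega> \<Longrightarrow> norm (w - z0) \<le> d \<Longrightarrow>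
       u w - (\<psi> w + Q * ((w - z0) \<bullet> (w - z0))) \<le> u z - (\<psi> z + Q * ((z - z0) \<bullet> (z - z0)))"
proof -
  let ?K = "Qbar \<Omega> \<inter> cball z0 d"
  have "compact ?K" using closed_Qbar by (simp add: closed_Int_compact)
  moreover have "z0 \<in> ?K" using z0 d by simp
  moreover have "usc_on ?K (\<lambda>w. u w + - (\<psi> w + Q * ((w - z0) \<bullet> (w - z0))))"
    by (intro usc_on_add usc_on_subset[OF usc] continuous_imp_usc_on continuous_intros
      continuous_on_subset[OF \<psi>]) auto
  ultimately obtain z where z: "z \<in> ?K"
    and max: "\<forall>w\<in>?K. u w - (\<psi> w + Q * ((w - z0) \<bullet> (w - z0))) \<le> u z - (\<psi> z + Q * ((z - z0) \<bullet> (z - z0)))"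
    using usc_attains_sup[of ?K "\<lambda>w. u w + - (\<psi> w + Q * ((w - z0) \<bullet> (w - z0)))"]
    by (metis (no_types, lifting) add_uminus_conv_diff empty_iff)
  have zd: "norm (z - z0) \<le> d" using z by (simp add: dist_norm norm_minus_commute)
  \<comment> \<open>\<open>\<psi>\<close> is least at \<open>z0\<close>, so comparison with
    \<open>z0\<close> bounds the quadratic penalty by the oscillation of \<open>u\<close>, at most
    \<open>2 * R\<close>.\<close>
  have le: "u z0 + Q * ((z - z0) \<bullet> (z - z0)) \<le> u z"
    using max[rule_format, of z0] z0 d \<psi>0[of z] z zd by simp
  have "0 \<le> R" using R[OF z0] d by simp
  then have "0 < Q * (d/2)\<^sup>2" using Q by linarith
  then have Q0: "0 < Q" using d by (simp add: zero_less_mult_iff)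
  have "u z \<le> R" "- R \<le> u z0" using R[of z] R[of z0] z zd z0 d by auto
  then have "Q * (norm (z - z0))\<^sup>2 < Q * (d/2)\<^sup>2" using le Q by (simp add: power2_norm_eq_inner)
  then have "norm (z - z0) < d/2" using Q0 d by (intro power_less_imp_less_base[of "norm (z - z0)" 2]) auto
  then show thesis
  proof (rule that[rotated])
    have "0 \<le> Q * ((z - z0) \<bullet> (z - z0))" using Q0 by simp
    then show "u z0 \<le> u z" using le by linarith
  qed (use z max in \<open>auto simp: dist_norm norm_minus_commute\<close>)
qed

lemma continuous_slice_bounded:
  assumes "bounded \<Omega>" "continuous_on (Qbar \<Omega>) (f :: 'a \<times> real \<Rightarrow> real)"
  obtains F where "0 \<le> F" "\<And>x t. x \<in> closure \<Omega> \<Longrightarrow> 0 \<le> t \<Longrightarrow> t \<le> T \<Longrightarrow> \<bar>f (x, t)\<bar> \<le> F"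
proof -
  have "locally_bounded_on (Qbar \<Omega>) f"
    unfolding locally_bounded_on_def using assms(2)
    by (meson compact_continuous_image compact_imp_bounded continuous_on_subset)
  from slice_bounded[OF assms(1) this, of T] show thesis by (metis that less_imp_le)
qed

text \<open>A steep slope in time contradicts the equation. If \<open>u\<close> exceeded
  \<open>u0\<close> at \<open>x0\<close>, then \<open>K * t\<close> plus a quadratic penalty would
  touch \<open>u\<close> near \<open>(x0, 0)\<close> at a point where \<open>u\<close> is still
  above the data, so that the equation holds there. Jumps take place at fixed time, so all other
  terms are bounded independently of \<open>K\<close>. The Hamiltonian enters through a lower bound
  on bounded gradients, a property that survives the reflection in
  \<open>visc_super_minus\<close>.\<close>

lemma initial_le:
  assumes sub: "visc_subsolution \<Omega> \<nu> H f \<phi> u0 u" and lb: "locally_bounded_on (Qbar \<Omega>) u"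
    and f: "continuous_on (Qbar \<Omega>) f" and \<phi>: "continuous_on (frontier \<Omega> \<times> {0..}) \<phi>"
    and u0: "continuous_on (closure \<Omega>) u0" and compat: "\<And>x. x \<in> frontier \<Omega> \<Longrightarrow> u0 x = \<phi> (x, 0)"
    and Hlow: "\<And>R P. \<exists>C. \<forall>x\<in>closure \<Omega>. \<forall>r p. \<bar>r\<bar> \<le> R \<longrightarrow> norm p \<le> P \<longrightarrow> - C \<le> H x r p"
    and x0: "x0 \<in> closure \<Omega>"
  shows "u (x0, 0) \<le> u0 x0"
proof (rule ccontr)
  assume "\<not> u (x0, 0) \<le> u0 x0"
  then have gt: "u0 x0 < u (x0, 0)" by simp
  obtain d1 where d1: "0 < d1" "\<And>x. x \<in> closure \<Omega> \<Longrightarrow> norm (x - x0) < d1 \<Longrightarrow> u0 x < u (x0, 0)"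
    using usc_onD[OF continuous_imp_usc_on[OF u0] x0 gt] unfolding eventually_nhds_metric dist_norm by auto
  obtain d2 where d2: "0 < d2" "\<And>z. z \<in> lateral \<Omega> \<Longrightarrow> norm (z - (x0, 0)) < d2 \<Longrightarrow> \<phi> z < u (x0, 0)"
  proof (cases "x0 \<in> \<Omega>")
    case True
    then obtain r where r: "0 < r" "ball x0 r \<subseteq> \<Omega>" using open_dom open_contains_ball by blast
    show thesis
    proof (rule that[of r])
      fix z assume z: "z \<in> lateral \<Omega>" "norm (z - (x0, 0)) < r"
      then have "norm (fst z - x0) < r" using norm_fst_diff[of z x0 0] by linarith
      then have "fst z \<in> \<Omega>" using r by (auto simp: subset_eq dist_norm norm_minus_commute)
      then show "\<phi> z < u (x0, 0)" using z(1) open_dom by (auto simp: lateral_def frontier_def interior_open)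
    qed fact
  next
    case False
    then have x0f: "x0 \<in> frontier \<Omega>" using x0 open_dom by (simp add: frontier_def interior_open)
    then have "\<phi> (x0, 0) < u (x0, 0)" using gt compat by simp
    from usc_onD[OF continuous_imp_usc_on[OF \<phi>] _ this] x0f
    obtain r where "0 < r" "\<And>z. norm (z - (x0, 0)) < r \<Longrightarrow> z \<in> frontier \<Omega> \<times> {0..} \<Longrightarrow> \<phi> z < u (x0, 0)"
      unfolding eventually_nhds_metric dist_norm by auto
    then show thesis by (intro that[of r]) (auto simp: lateral_def)
  qed
  define d where "d = min (min d1 d2) 1"
  have d: "0 < d" "d \<le> d1" "d \<le> d2" "d \<le> 1" using d1 d2 by (auto simp: d_def)
  obtain R where R: "0 < R" "\<And>x t. x \<in> closure \<Omega> \<Longrightarrow> 0 \<le> t \<Longrightarrow> t \<le> 1 \<Longrightarrow> \<bar>u (x, t)\<bar> \<le> R"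
    using slice_bounded[OF bounded_dom lb, of 1] by metis
  obtain F where F: "0 \<le> F" "\<And>x t. x \<in> closure \<Omega> \<Longrightarrow> 0 \<le> t \<Longrightarrow> t \<le> 1 \<Longrightarrow> \<bar>f (x, t)\<bar> \<le> F"
    using continuous_slice_bounded[OF bounded_dom f, of 1] by metis
  define Q where "Q = (2 * R + 1) / (d/2)\<^sup>2"
  have Q: "0 < Q" "2 * R < Q * (d/2)\<^sup>2" using R d by (auto simp: Q_def)
  obtain C where C: "\<And>x r p. x \<in> closure \<Omega> \<Longrightarrow> \<bar>r\<bar> \<le> R \<Longrightarrow> norm p \<le> 2 * Q \<Longrightarrow> - C \<le> H x r p"
    using Hlow[of R "2 * Q"] by metis
  define J where "J = 3 * Q * (C2 * (d/2) powr (1 - \<sigma>))"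
  \<comment> \<open>The slope exceeds all other terms at the contact point; \<open>J\<close> bounds
    the jumps below size \<open>d / 2\<close>, the term with \<open>C1\<close> those above.\<close>
  define K where "K = max 0 (C + F + J + 2 * R * (C1 * (d/2) powr (- \<sigma>)) + 1)"
  have z0: "(x0, 0) \<in> Qbar \<Omega>" using x0 by (simp add: Qbar_def)
  have near_t: "0 \<le> snd z \<and> snd z \<le> 1 \<and> fst z \<in> closure \<Omega>" if "z \<in> Qbar \<Omega>" "norm (z - (x0, 0)) \<le> d" for z
    using that norm_snd_diff[of z 0 x0] d by (auto simp: Qbar_def)
  have usc: "usc_on (Qbar \<Omega>) u" using sub by (simp add: visc_subsolution_def)
  have \<psi>: "C1_gradient_on (Qbar \<Omega>) (\<lambda>z. K * snd z) (\<lambda>z. (0, K))"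
    using C1_gradient_on_snd[of "\<lambda>t. K * t" "\<lambda>_. K"] by (auto intro!: derivative_eq_intros)
  obtain z where z: "z \<in> Qbar \<Omega>" "norm (z - (x0, 0)) < d / 2" "u (x0, 0) \<le> u z"
    and max: "\<And>w. w \<in> Qbar \<Omega> \<Longrightarrow> norm (w - (x0, 0)) \<le> d \<Longrightarrow>
       u w - (K * snd w + Q * ((w - (x0, 0)) \<bullet> (w - (x0, 0)))) \<le> u z - (K * snd z + Q * ((z - (x0, 0)) \<bullet> (z - (x0, 0))))"
  proof (rule penalized_max[OF usc C1_gradient_on_continuous[OF \<psi>] z0 d(1)])
    show "\<bar>u z\<bar> \<le> R" if "z \<in> Qbar \<Omega>" "norm (z - (x0, 0)) \<le> d" for z
      using near_t[OF that] R(2)[of "fst z" "snd z"] by simp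
    show "K * snd (x0, 0) \<le> K * snd z" if "z \<in> Qbar \<Omega>" "norm (z - (x0, 0)) \<le> d" for z
      using near_t[OF that] by (simp add: K_def)
  qed (use Q in auto)
  obtain x t where zxt: "z = (x, t)" by (cases z)
  have xt: "x \<in> closure \<Omega>" "0 \<le> t" "t \<le> 1" using near_t[OF z(1)] z(2) d by (auto simp: zxt)
  have nx: "norm (x - x0) < d / 2" using z(2) norm_fst_diff[of z x0 0] by (simp add: zxt)
  have pos: "(x, t) \<in> Qcyl \<Omega> \<or> ((x, t) \<in> lateral \<Omega> \<and> \<phi> (x, t) < u (x, t)) \<or> (t = 0 \<and> u0 x < u (x, t))"
  proof (cases "t = 0")
    case True
    then show ?thesis using d1(2)[OF xt(1)] nx d z(3) by (auto simp: zxt)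
  next
    case False
    show ?thesis
    proof (cases "x \<in> \<Omega>")
      case False
      then have "(x, t) \<in> lateral \<Omega>" using xt \<open>t \<noteq> 0\<close> open_dom by (auto simp: lateral_def frontier_def interior_open)
      then show ?thesis using d2(2)[of "(x, t)"] z d by (auto simp: zxt)
    qed (use False xt in \<open>auto simp: Qcyl_def\<close>)
  qed
  have J0: "0 \<le> J" using Q C2_pos by (simp add: J_def)
  have "snd ((0, K) + (2 * Q) *\<^sub>R ((x, t) - (x0, 0))) + H x (u (x, t)) (fst ((0, K) + (2 * Q) *\<^sub>R ((x, t) - (x0, 0)))) - f (x, t)
    \<le> J + nonlocal_op \<Omega> \<nu> (- ball 0 (d/2)) (\<lambda>y. u (y, t)) x"
  proof (rule sub_ineq[OF sub lb C1_gradient_on_add[OF \<psi> C1_gradient_on_sq_penalty], where d="d/2" and k="\<lambda>w. 3 * Q * norm w"])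
    show "u w - (K * snd w + Q * ((w - (x0, 0)) \<bullet> (w - (x0, 0)))) \<le> u (x, t) - (K * snd (x, t) + Q * (((x, t) - (x0, 0)) \<bullet> ((x, t) - (x0, 0))))"
      if "w \<in> Qbar \<Omega>" "norm (w - (x, t)) < d / 2" for w
      using max[OF that(1)] dist_triangle[of w "(x0, 0)" "(x, t)", unfolded dist_norm] that(2) z(2)[unfolded zxt] unfolding zxt by linarith
    show "AE w in \<nu> x. w \<noteq> 0 \<longrightarrow> norm w < d / 2 \<longrightarrow> x + w \<in> closure \<Omega> \<longrightarrow> u (x + w, t) - u (x, t) \<le> 3 * Q * norm w"
    proof (intro AE_I2 impI)
      fix w assume w: "norm w < d / 2" "x + w \<in> closure \<Omega>"
      let ?a = "(x, t) - (x0, 0)"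
      have e: "(x + w, t) - (x0, 0) = ?a + (w, 0)" by simp
      have "\<bar>(?a + (w, 0)) \<bullet> (?a + (w, 0)) - ?a \<bullet> ?a\<bar> \<le> 3 * norm (w, 0::real)"

      proof (rule sq_penalty_increment)
        show "norm ?a \<le> 1" using z(2) d unfolding zxt by linarith
        show "norm (w, 0::real) \<le> 1" using w d by (simp add: norm_Pair)
      qed
      then have "(?a + (w, 0)) \<bullet> (?a + (w, 0)) - ?a \<bullet> ?a \<le> 3 * norm w" by (simp add: norm_Pair)
      from mult_left_mono[OF this, of Q]
      have 1: "Q * ((?a + (w, 0)) \<bullet> (?a + (w, 0))) - Q * (?a \<bullet> ?a) \<le> 3 * Q * norm w" using Q by (simp add: algebra_simps)
      have "norm (?a + (w, 0)) \<le> d" using norm_triangle_ineq[of ?a "(w, 0)"] z(2) w by (simp add: zxt norm_Pair)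
      then show "u (x + w, t) - u (x, t) \<le> 3 * Q * norm w"
        using max[of "(x + w, t)"] w xt 1 unfolding e by (simp add: zxt Qbar_def e)
    qed
    show "(\<integral>\<^sup>+ w\<in>ball 0 (d/2). ennreal (3 * Q * norm w) \<partial>\<nu> x) \<le> ennreal J"
      unfolding J_def using nn_integral_linear[OF xt(1), of "d/2" "3 * Q"] d Q by simp
  qed (use z zxt d pos J0 Q in auto)
  moreover have "nonlocal_op \<Omega> \<nu> (- ball 0 (d/2)) (\<lambda>y. u (y, t)) x \<le> 2 * R * (C1 * (d/2) powr (- \<sigma>))"
    using R xt d by (intro nonlocal_op_tail_le) auto
  moreover have "- C \<le> H x (u (x, t)) ((2 * Q) *\<^sub>R (x - x0))"
    using R xt nx d Q mult_left_mono[of "norm (x - x0)" 1 "2 * Q"] by (intro C) auto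
  moreover have "\<bar>f (x, t)\<bar> \<le> F" using F xt by simp
  moreover have "0 \<le> 2 * Q * t" using Q xt by simp
  ultimately show False unfolding K_def by simp
qed

text \<open>A steep slope \<open>K\<close> along the defining function contradicts coercivity: the
  Hamiltonian is at least of order \<open>K powr m\<close>, the nonlocal term at most of order
  \<open>K powr \<sigma>\<close>. As (H2) is lost under reflection, the argument has no counterpart
  for \<open>v\<close>.\<close>

lemma lateral_le:
  assumes sub: "visc_subsolution \<Omega> \<nu> H f \<phi> u0 u" and lb: "locally_bounded_on (Qbar \<Omega>) u"
    and f: "continuous_on (Qbar \<Omega>) f" and \<phi>: "continuous_on (frontier \<Omega> \<times> {0..}) \<phi>"
    and H2: "assm_H2 m \<Omega> H" and m: "\<sigma> < m"
    and z0: "(x0, t0) \<in> lateral \<Omega>"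
  shows "u (x0, t0) \<le> \<phi> (x0, t0)"
proof (rule ccontr)
  assume "\<not> u (x0, t0) \<le> \<phi> (x0, t0)"
  then have gt: "\<phi> (x0, t0) < u (x0, t0)" by simp
  have x0: "x0 \<in> frontier \<Omega>" and t0: "0 < t0" using z0 by (auto simp: lateral_def)
  have x0c: "x0 \<in> closure \<Omega>" "x0 \<notin> \<Omega>" using x0 open_dom by (auto simp: frontier_def interior_open)
  obtain c where c: "0 < c" and Hc: "\<And>R. R > 0 \<Longrightarrow> \<exists>CR\<ge>0. \<forall>x\<in>closure \<Omega>. \<forall>p r. \<bar>r\<bar> \<le> R \<longrightarrow> c * norm p powr m - CR \<le> H x r p"
    using H2 unfolding assm_H2_def by auto
  obtain r G e g Dg where "patch \<Omega> x0 r G e g Dg" using patch_boundary[OF x0] by blast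
  note P = this[unfolded patch_def]
  have r: "0 < r" "r \<le> 1" "1 \<le> G" and Dg: "C1_gradient_on UNIV g Dg" using P by auto
  have g: "\<And>x. x \<in> ball x0 r \<Longrightarrow> (x \<in> \<Omega> \<longleftrightarrow> 0 < g x)" "\<And>x. x \<in> ball x0 r \<Longrightarrow> x \<in> closure \<Omega> \<Longrightarrow> 0 \<le> g x"
    "\<And>x. x \<in> ball x0 r \<Longrightarrow> 1 \<le> norm (Dg x)"
    "\<And>x y. x \<in> ball x0 r \<Longrightarrow> y \<in> ball x0 r \<Longrightarrow> \<bar>g x - g y\<bar> \<le> G * norm (x - y)"
    using P x0 by auto
  have g0: "g x0 = 0" using g(1)[of x0] g(2)[of x0] x0c r by force
  obtain d2 where d2: "0 < d2" "\<And>z. z \<in> lateral \<Omega> \<Longrightarrow> norm (z - (x0, t0)) < d2 \<Longrightarrow> \<phi> z < u (x0, t0)"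
  proof -
    from usc_onD[OF continuous_imp_usc_on[OF \<phi>] _ gt] x0 t0
    obtain r where "0 < r" "\<And>z. norm (z - (x0, t0)) < r \<Longrightarrow> z \<in> frontier \<Omega> \<times> {0..} \<Longrightarrow> \<phi> z < u (x0, t0)"
      unfolding eventually_nhds_metric dist_norm by auto
    then show thesis by (intro that[of r]) (auto simp: lateral_def)
  qed
  \<comment> \<open>The bound by \<open>t0\<close> keeps the contact point at positive times, the
    bound by \<open>r/2\<close> keeps it in the patch.\<close>
  define d where "d = min (min d2 t0) (r/2)"
  have d: "0 < d" "d \<le> d2" "d \<le> t0" "d < r" "d \<le> 1" using d2 t0 r by (auto simp: d_def)
  obtain R where R: "0 < R" "\<And>x t. x \<in> closure \<Omega> \<Longrightarrow> 0 \<le> t \<Longrightarrow> t \<le> t0 + 1 \<Longrightarrow> \<bar>u (x, t)\<bar> \<le> R"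
    using slice_bounded[OF bounded_dom lb, of "t0 + 1"] by metis
  obtain F where F: "0 \<le> F" "\<And>x t. x \<in> closure \<Omega> \<Longrightarrow> 0 \<le> t \<Longrightarrow> t \<le> t0 + 1 \<Longrightarrow> \<bar>f (x, t)\<bar> \<le> F"
    using continuous_slice_bounded[OF bounded_dom f, of "t0 + 1"] by metis
  define Q where "Q = (2 * R + 1) / (d/2)\<^sup>2"
  have Q: "0 < Q" "2 * R < Q * (d/2)\<^sup>2" using R d by (auto simp: Q_def)
  obtain CR where CR: "\<And>x r p. x \<in> closure \<Omega> \<Longrightarrow> \<bar>r\<bar> \<le> R \<Longrightarrow> c * norm p powr m - CR \<le> H x r p"
    using Hc[OF R(1)] by metis
  have "\<forall>\<^sub>F K in at_top. (CR + F + 2 * Q) + ((G + 3 * Q) * C2 + 2 * R * C1) * K powr \<sigma> < (c * (1/2) powr m) * K powr m"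
    using sigma_pos m c by (intro powr_dominates) auto
  moreover have "\<forall>\<^sub>F K in at_top. max (max 1 (4 * Q)) (4 / d) \<le> K" by (rule eventually_ge_at_top)
  ultimately have "\<forall>\<^sub>F K in at_top. (CR + F + 2 * Q) + ((G + 3 * Q) * C2 + 2 * R * C1) * K powr \<sigma> < (c * (1/2) powr m) * K powr m
    \<and> max (max 1 (4 * Q)) (4 / d) \<le> K" by eventually_elim simp
  then obtain K where K: "(CR + F + 2 * Q) + ((G + 3 * Q) * C2 + 2 * R * C1) * K powr \<sigma> < (c * (1/2) powr m) * K powr m"
    "1 \<le> K" "4 * Q \<le> K" "4 / d \<le> K" using eventually_happens[of _ "at_top :: real filter"] by force
  \<comment> \<open>Jumps below this size contribute at the order
    \<open>K * \<delta> powr (1 - \<sigma>)\<close>, larger ones at the order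
    \<open>\<delta> powr (- \<sigma>)\<close>; both equal \<open>K powr \<sigma>\<close>.\<close>
  define \<delta> where "\<delta> = 1 / K"
  have \<delta>: "0 < \<delta>" "\<delta> < d / 2" "\<delta> < 1"
  proof -
    show "0 < \<delta>" using K by (simp add: \<delta>_def)
    have "4 \<le> K * d" using K(4) d by (simp add: field_simps)
    then have "\<delta> \<le> d / 4" using K(2) by (simp add: \<delta>_def field_simps)
    then show "\<delta> < d / 2" "\<delta> < 1" using d by auto
  qed
  have near_t: "0 \<le> snd z \<and> snd z \<le> t0 + 1 \<and> fst z \<in> closure \<Omega> \<and> fst z \<in> ball x0 r" if "z \<in> Qbar \<Omega>" "norm (z - (x0, t0)) \<le> d" for z
    using that norm_snd_diff[of z t0 x0] norm_fst_diff[of z x0 t0] d by (auto simp: Qbar_def dist_norm norm_minus_commute[of x0])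
  have usc: "usc_on (Qbar \<Omega>) u" using sub by (simp add: visc_subsolution_def)
  have "C1_gradient_on UNIV (\<lambda>x. K * g x) (\<lambda>x. K *\<^sub>R Dg x)"
    using Dg unfolding C1_gradient_on_def by (auto intro!: derivative_eq_intros continuous_intros)
  then have \<psi>: "C1_gradient_on (Qbar \<Omega>) (\<lambda>z. K * g (fst z)) (\<lambda>z. (K *\<^sub>R Dg (fst z), 0))"
    by (rule C1_gradient_on_fst)
  have z0Q: "(x0, t0) \<in> Qbar \<Omega>" using x0c t0 by (simp add: Qbar_def)
  obtain z where z: "z \<in> Qbar \<Omega>" "norm (z - (x0, t0)) < d / 2" "u (x0, t0) \<le> u z"
    and max: "\<And>w. w \<in> Qbar \<Omega> \<Longrightarrow> norm (w - (x0, t0)) \<le> d \<Longrightarrow>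
       u w - (K * g (fst w) + Q * ((w - (x0, t0)) \<bullet> (w - (x0, t0)))) \<le> u z - (K * g (fst z) + Q * ((z - (x0, t0)) \<bullet> (z - (x0, t0))))"
  proof (rule penalized_max[OF usc C1_gradient_on_continuous[OF \<psi>] z0Q d(1)])
    show "\<bar>u z\<bar> \<le> R" if "z \<in> Qbar \<Omega>" "norm (z - (x0, t0)) \<le> d" for z
      using near_t[OF that] R(2)[of "fst z" "snd z"] by simp
    show "K * g (fst (x0, t0)) \<le> K * g (fst z)" if "z \<in> Qbar \<Omega>" "norm (z - (x0, t0)) \<le> d" for z
      using near_t[OF that] g(2)[of "fst z"] K by (simp add: g0)
  qed (use Q in auto)
  obtain x t where zxt: "z = (x, t)" by (cases z)
  have xt: "x \<in> closure \<Omega>" "0 \<le> t" "t \<le> t0 + 1" "x \<in> ball x0 r" using near_t[OF z(1)] z(2) d by (auto simp: zxt)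
  have nx: "norm (x - x0) < d / 2" and nt: "\<bar>t - t0\<bar> < d / 2"
    using z(2) norm_fst_diff[of z x0 t0] norm_snd_diff[of z t0 x0] by (auto simp: zxt)
  have tpos: "0 < t" using nt d by linarith
  have pos: "(x, t) \<in> Qcyl \<Omega> \<or> ((x, t) \<in> lateral \<Omega> \<and> \<phi> (x, t) < u (x, t)) \<or> (t = 0 \<and> u0 x < u (x, t))"
  proof (cases "x \<in> \<Omega>")
    case False
    then have "(x, t) \<in> lateral \<Omega>" using xt tpos open_dom by (auto simp: lateral_def frontier_def interior_open)
    then show ?thesis using d2(2)[of "(x, t)"] z d by (auto simp: zxt)
  qed (use tpos in \<open>auto simp: Qcyl_def\<close>)
  define \<Lambda> where "\<Lambda> = K * G + 3 * Q"
  have \<Lambda>: "0 \<le> \<Lambda>" using K r Q by (simp add: \<Lambda>_def)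
  let ?p = "K *\<^sub>R Dg x + (2 * Q) *\<^sub>R (x - x0)"
  have "snd ((K *\<^sub>R Dg (fst (x, t)), 0) + (2 * Q) *\<^sub>R ((x, t) - (x0, t0))) + H x (u (x, t)) (fst ((K *\<^sub>R Dg (fst (x, t)), 0) + (2 * Q) *\<^sub>R ((x, t) - (x0, t0)))) - f (x, t)
    \<le> \<Lambda> * (C2 * \<delta> powr (1 - \<sigma>)) + nonlocal_op \<Omega> \<nu> (- ball 0 \<delta>) (\<lambda>y. u (y, t)) x"
  proof (rule sub_ineq[OF sub lb C1_gradient_on_add[OF \<psi> C1_gradient_on_sq_penalty], where d="d/2" and k="\<lambda>w. \<Lambda> * norm w"])
    show "u w - (K * g (fst w) + Q * ((w - (x0, t0)) \<bullet> (w - (x0, t0)))) \<le> u (x, t) - (K * g (fst (x, t)) + Q * (((x, t) - (x0, t0)) \<bullet> ((x, t) - (x0, t0))))"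
      if "w \<in> Qbar \<Omega>" "norm (w - (x, t)) < d / 2" for w
      using max[OF that(1)] dist_triangle[of w "(x0, t0)" "(x, t)", unfolded dist_norm] that(2) z(2)[unfolded zxt] unfolding zxt by linarith
    show "AE w in \<nu> x. w \<noteq> 0 \<longrightarrow> norm w < \<delta> \<longrightarrow> x + w \<in> closure \<Omega> \<longrightarrow> u (x + w, t) - u (x, t) \<le> \<Lambda> * norm w"
    proof (intro AE_I2 impI)
      fix w assume w': "norm w < \<delta>" "x + w \<in> closure \<Omega>"
      have w: "norm w < d / 2" using w' \<delta> by simp
      let ?a = "(x, t) - (x0, t0)"
      have e: "(x + w, t) - (x0, t0) = ?a + (w, 0)" by simp
      have "\<bar>(?a + (w, 0)) \<bullet> (?a + (w, 0)) - ?a \<bullet> ?a\<bar> \<le> 3 * norm (w, 0::real)"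

      proof (rule sq_penalty_increment)
        show "norm ?a \<le> 1" using z(2) d unfolding zxt by linarith
        show "norm (w, 0::real) \<le> 1" using w d by (simp add: norm_Pair)
      qed
      then have "(?a + (w, 0)) \<bullet> (?a + (w, 0)) - ?a \<bullet> ?a \<le> 3 * norm w" by (simp add: norm_Pair)
      from mult_left_mono[OF this, of Q]
      have 1: "Q * ((?a + (w, 0)) \<bullet> (?a + (w, 0))) - Q * (?a \<bullet> ?a) \<le> 3 * Q * norm w" using Q by (simp add: algebra_simps)
      have le: "norm ((x + w, t) - (x0, t0)) \<le> d" unfolding e using norm_triangle_ineq[of ?a "(w, 0)"] z(2) w by (simp add: zxt norm_Pair)
      have Qw: "(x + w, t) \<in> Qbar \<Omega>" using w' xt by (simp add: Qbar_def)
      have "x + w \<in> ball x0 r" using near_t[OF Qw le] by simp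
      then have "g (x + w) - g x \<le> G * norm w" using g(4)[of "x + w" x] xt by auto
      then have "K * (g (x + w) - g x) \<le> K * (G * norm w)" using K by (intro mult_left_mono) auto
      then have 2: "K * g (x + w) - K * g x \<le> K * G * norm w" by (simp add: algebra_simps)
      show "u (x + w, t) - u (x, t) \<le> \<Lambda> * norm w"
        using max[OF Qw le] 1 2 unfolding e by (simp add: zxt \<Lambda>_def distrib_right)
    qed
    show "(\<integral>\<^sup>+ w\<in>ball 0 \<delta>. ennreal (\<Lambda> * norm w) \<partial>\<nu> x) \<le> ennreal (\<Lambda> * (C2 * \<delta> powr (1 - \<sigma>)))"
      using nn_integral_linear[OF xt(1) \<delta>(1,3) \<Lambda>] .
  qed (use z zxt d \<delta> pos \<Lambda> C2_pos in auto)
  moreover have "nonlocal_op \<Omega> \<nu> (- ball 0 \<delta>) (\<lambda>y. u (y, t)) x \<le> 2 * R * (C1 * \<delta> powr (- \<sigma>))"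
    using R xt \<delta> by (intro nonlocal_op_tail_le) auto
  moreover have "c * norm ?p powr m - CR \<le> H x (u (x, t)) ?p" using R xt by (intro CR) auto
  moreover have "\<bar>f (x, t)\<bar> \<le> F" using F xt by simp
  moreover have "- (2 * Q) \<le> 2 * Q * (t - t0)"
  proof -
    have "-1 \<le> t - t0" using nt d by linarith
    from mult_left_mono[OF this, of "2 * Q"] show ?thesis using Q by simp
  qed
  ultimately have "c * norm ?p powr m \<le> CR + F + 2 * Q + \<Lambda> * (C2 * \<delta> powr (1 - \<sigma>)) + 2 * R * (C1 * \<delta> powr (- \<sigma>))" by simp
  moreover have "\<delta> powr (- \<sigma>) = K powr \<sigma>" unfolding \<delta>_def using K by (simp add: powr_divide powr_minus)
  moreover have "\<Lambda> * (C2 * \<delta> powr (1 - \<sigma>)) \<le> (G + 3 * Q) * C2 * K powr \<sigma>"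
  proof -
    have "\<delta> powr (1 - \<sigma>) = K powr \<sigma> / K"
      unfolding \<delta>_def using K by (simp add: powr_divide powr_diff field_simps)
    moreover have "\<Lambda> \<le> K * (G + 3 * Q)" using K Q by (simp add: \<Lambda>_def algebra_simps)
    then have "\<Lambda> * (C2 * (K powr \<sigma> / K)) \<le> K * (G + 3 * Q) * (C2 * (K powr \<sigma> / K))"
      using C2_pos K by (intro mult_right_mono) auto
    ultimately show ?thesis using K by simp
  qed
  moreover have "c * ((1/2) powr m * K powr m) \<le> c * norm ?p powr m"
  proof -
    have "K \<le> norm (K *\<^sub>R Dg x)" using g(3)[OF xt(4)] K by (simp add: mult_le_cancel_left1)
    moreover have "norm ((2 * Q) *\<^sub>R (x - x0)) \<le> 2 * Q"
      using Q nx d mult_left_mono[of "norm (x - x0)" 1 "2 * Q"] by simp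
    moreover have "norm (K *\<^sub>R Dg x) - norm ((2 * Q) *\<^sub>R (x - x0)) \<le> norm ?p"
      by (metis add_diff_cancel norm_triangle_ineq2 norm_minus_cancel diff_minus_eq_add)
    ultimately have "K / 2 \<le> norm ?p" using K(3) by linarith
    then have "(K / 2) powr m \<le> norm ?p powr m" using K m sigma_pos by (intro powr_mono2) auto
    then show ?thesis using c K by (simp add: powr_divide field_simps)
  qed
  ultimately show False using K(1) by (simp add: algebra_simps)
qed

end

section \<open>Barriers: smoothness, maximum points and arithmetic\<close>

text \<open>The smooth norm, the square root of
  \<open>(norm w)\<^sup>2 + \<epsilon>\<^sup>2\<close>, written as the norm of a pair so that
  derivative and triangle inequality are inherited.\<close>

definition snorm :: "real \<Rightarrow> 'a::euclidean_space \<Rightarrow> real" where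
  "snorm \<epsilon> w = norm (w, \<epsilon>)"

lemma snorm_ge: "norm w \<le> snorm \<epsilon> w"
  unfolding snorm_def by (rule norm_fst_le)

lemma snorm_pos: "0 < \<epsilon> \<Longrightarrow> 0 < snorm \<epsilon> w"
  by (simp add: snorm_def zero_prod_def)

lemma snorm_le: "0 \<le> \<epsilon> \<Longrightarrow> snorm \<epsilon> w \<le> norm w + \<epsilon>"
  using norm_Pair_le[of w \<epsilon>] by (simp add: snorm_def)

lemma snorm_triangle: "snorm \<epsilon> (w + z) \<le> snorm \<epsilon> w + norm z"
  using norm_triangle_ineq[of "(w, \<epsilon>)" "(z, 0)"] by (simp add: snorm_def norm_Pair)

lemma C1_gradient_on_snorm:
  assumes "0 < \<epsilon>"
  shows "C1_gradient_on S (\<lambda>x. snorm \<epsilon> (x - y)) (\<lambda>x. (1 / snorm \<epsilon> (x - y)) *\<^sub>R (x - y))"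
  unfolding C1_gradient_on_def
proof (intro conjI ballI)
  show "continuous_on S (\<lambda>x. (1 / snorm \<epsilon> (x - y)) *\<^sub>R (x - y))"
    unfolding snorm_def using assms by (intro continuous_intros) (auto simp: zero_prod_def)
  fix x assume "x \<in> S"
  have d: "((\<lambda>x. (x - y, \<epsilon>)) has_derivative (\<lambda>h. (h, 0))) (at x within S)"
    by (auto intro!: derivative_eq_intros)
  have n: "(norm has_derivative (\<lambda>h. sgn (x - y, \<epsilon>) \<bullet> h)) (at (x - y, \<epsilon>))"
    using has_derivative_norm[of "(x - y, \<epsilon>)"] assms by (simp add: inner_commute zero_prod_def)
  show "((\<lambda>x. snorm \<epsilon> (x - y)) has_derivative (\<lambda>h. (1 / snorm \<epsilon> (x - y)) *\<^sub>R (x - y) \<bullet> h)) (at x within S)"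
    using has_derivative_compose[OF d n] unfolding snorm_def
    by (simp add: sgn_div_norm inner_prod_def divide_inverse)
qed

text \<open>The barrier lives on positive arguments, but test functions must be C^1 everywhere. Its
  argument is replaced by a C^1 function \<open>p\<close> that is the identity from \<open>b\<close>
  on and never falls below \<open>3 * b / 4\<close>.\<close>

lemma barrier_extension:
  fixes A \<rho> a b :: real
  assumes b: "0 < b"
  obtains F F' where "\<And>r. (F has_real_derivative F' r) (at r)" "continuous_on UNIV F'"
    "\<And>r. b \<le> r \<Longrightarrow> F r = A * r powr a + \<rho> * ln r"
    "\<And>r. b \<le> r \<Longrightarrow> F' r = A * (a * r powr (a - 1)) + \<rho> / r"
proof -
  define p where "p r = r + (max 0 (b - r))\<^sup>2 / b" for r
  define p' where "p' r = 1 - 2 * max 0 (b - r) / b" for r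
  have pos: "0 < p r" for r
  proof -
    define q where "q = max 0 (b - r)"
    have "0 \<le> (q - b / 2)\<^sup>2" by simp
    then have "q * b \<le> q\<^sup>2 + b\<^sup>2 / 4" by (simp add: power2_diff field_simps power2_eq_square)
    then have "q \<le> (q\<^sup>2 + b\<^sup>2 / 4) / b" using b by (simp add: le_divide_eq)
    also have "\<dots> = q\<^sup>2 / b + b / 4" using b by (simp add: add_divide_distrib power2_eq_square)
    finally have "q \<le> q\<^sup>2 / b + b / 4" .
    moreover have "b - r \<le> q" by (simp add: q_def)
    ultimately show ?thesis using b unfolding p_def q_def[symmetric] by linarith
  qed
  have dp: "(p has_real_derivative p' r) (at r)" for r
  proof -
    have "((\<lambda>r. (max 0 (b - r))\<^sup>2) has_real_derivative 2 * max 0 (b - r) * (- 1)) (at r)"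
      by (rule DERIV_chain2[OF max_sq_deriv]) (auto intro!: derivative_eq_intros)
    from DERIV_add[OF DERIV_ident DERIV_cdivide[OF this, of b]]
    show ?thesis unfolding p_def[abs_def] p'_def by simp
  qed
  have cp: "continuous_on UNIV p" unfolding p_def using b by (intro continuous_intros) auto
  show thesis
  proof (rule that)
    fix r
    show "((\<lambda>r. A * p r powr a + \<rho> * ln (p r)) has_real_derivative
        (A * (a * p r powr (a - 1)) + \<rho> / p r) * p' r) (at r)"
      using pos[of r] dp[of r] by (auto intro!: derivative_eq_intros simp: field_simps)
    show "continuous_on UNIV (\<lambda>r. (A * (a * p r powr (a - 1)) + \<rho> / p r) * p' r)"
      unfolding p'_def using pos b by (intro continuous_intros cp) (auto simp: less_imp_neq[THEN not_sym])
    assume "b \<le> r"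
    then have "p r = r" "p' r = 1" by (auto simp: p_def p'_def)
    then show "A * p r powr a + \<rho> * ln (p r) = A * r powr a + \<rho> * ln r"
      "(A * (a * p r powr (a - 1)) + \<rho> / p r) * p' r = A * (a * r powr (a - 1)) + \<rho> / r" by simp_all
  qed
qed

text \<open>The slope of the barrier decreases with its argument, and between \<open>s\<close> and
  \<open>s / 2\<close> it at most doubles.\<close>

lemma barrier_decrease:
  fixes A \<rho> a :: real
  assumes A: "0 \<le> A" and \<rho>: "0 \<le> \<rho>" and a: "0 < a" "a < 1" and q: "0 < s" "s / 2 \<le> q"
  shows "(A * s powr a + \<rho> * ln s) - (A * q powr a + \<rho> * ln q)
     \<le> 2 * (A * (a * s powr (a - 1)) + \<rho> / s) * \<bar>s - q\<bar>"
proof (cases "q < s")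
  case True
  let ?\<phi> = "\<lambda>r. A * r powr a + \<rho> * ln r" and ?d = "\<lambda>r. A * (a * r powr (a - 1)) + \<rho> / r"
  have q0: "0 < q" using q by linarith
  have "\<exists>\<xi>>q. \<xi> < s \<and> ?\<phi> s - ?\<phi> q = (s - q) * ?d \<xi>"
    by (rule MVT2[OF True]) (use q0 in \<open>auto intro!: derivative_eq_intros simp: field_simps\<close>)
  then obtain \<xi> where \<xi>: "q < \<xi>" "\<xi> < s" "?\<phi> s - ?\<phi> q = (s - q) * ?d \<xi>" by blast
  have x: "s / 2 \<le> \<xi>" "0 < \<xi>" using \<xi> q q0 by linarith+
  have "\<xi> powr (a - 1) \<le> (s / 2) powr (a - 1)" using x q a by (intro powr_mono2') auto
  also have "\<dots> = s powr (a - 1) * 2 powr (1 - a)"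
    using q by (simp add: powr_divide powr_diff field_simps)
  also have "\<dots> \<le> s powr (a - 1) * 2 powr 1" using a by (intro mult_left_mono powr_mono) auto
  finally have "A * (a * \<xi> powr (a - 1)) \<le> A * (a * (s powr (a - 1) * 2))" using A a by (intro mult_left_mono) auto
  moreover have "\<rho> / \<xi> \<le> \<rho> / (s / 2)" using x q \<rho> by (intro divide_left_mono) auto
  ultimately have "?d \<xi> \<le> 2 * ?d s" by (simp add: algebra_simps)
  then have "(s - q) * ?d \<xi> \<le> (s - q) * (2 * ?d s)" using True by (intro mult_left_mono) auto
  then show ?thesis using \<xi>(3) True by (simp add: algebra_simps)
next
  case False
  then have "s powr a \<le> q powr a" "ln s \<le> ln q" using q a by (auto intro!: powr_mono2)
  then have "A * s powr a \<le> A * q powr a" "\<rho> * ln s \<le> \<rho> * ln q" using A \<rho> by (auto intro!: mult_left_mono)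
  moreover have "0 \<le> 2 * (A * (a * s powr (a - 1)) + \<rho> / s) * \<bar>s - q\<bar>" using A \<rho> a q by auto
  ultimately show ?thesis by linarith
qed

text \<open>The logarithmic barrier produces maximum points at which \<open>\<gamma>\<close> is positive and which are almost
  maximum points of the unperturbed function.\<close>

lemma barrier_max:
  fixes M0 :: "'b::topological_space \<Rightarrow> real"
  assumes usc: "usc_on Z M0" and B: "\<And>z. z \<in> Z \<Longrightarrow> M0 z \<le> B" and ne: "Z \<noteq> {}"
    and \<gamma>: "continuous_on Z \<gamma>" "\<And>z. z \<in> Z \<Longrightarrow> 0 < \<gamma> z" "\<And>z. z \<in> Z \<Longrightarrow> \<gamma> z \<le> 1"
    and cpt: "\<And>k0. 0 < k0 \<Longrightarrow> compact {z \<in> Z. k0 \<le> \<gamma> z}" and \<gamma>0: "(0::real) < \<gamma>0"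
  obtains \<rho> z where "0 < \<rho>" "\<rho> \<le> \<gamma>0" "z \<in> Z"
    "\<And>w. w \<in> Z \<Longrightarrow> M0 w + \<rho> * ln (\<gamma> w) \<le> M0 z + \<rho> * ln (\<gamma> z)"
    "\<And>w. w \<in> Z \<Longrightarrow> M0 w \<le> M0 z + \<gamma>0"
proof -
  have bdd: "bdd_above (M0 ` Z)" using B by (auto intro!: bdd_aboveI)
  have "Sup (M0 ` Z) - \<gamma>0 / 2 < Sup (M0 ` Z)" using \<gamma>0 by simp
  then obtain z2 where z2: "z2 \<in> Z" "Sup (M0 ` Z) - \<gamma>0 / 2 < M0 z2"
    using less_cSUP_iff[OF ne bdd] by auto
  have z2': "M0 w \<le> M0 z2 + \<gamma>0 / 2" if "w \<in> Z" for w
    using cSUP_upper[OF that bdd] z2(2) by linarith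
  define l where "l = - ln (\<gamma> z2)"
  have l: "0 \<le> l" using \<gamma>(2,3)[OF z2(1)] by (simp add: l_def)
  \<comment> \<open>Chosen so that the logarithm costs at most \<open>\<gamma>0 / 2\<close> at the
    near maximum point \<open>z2\<close>; the other half of \<open>\<gamma>0\<close> is the deficit
    of \<open>z2\<close>.\<close>
  define \<rho> where "\<rho> = min \<gamma>0 (\<gamma>0 / 2 / (1 + l))"
  have \<rho>: "0 < \<rho>" "\<rho> \<le> \<gamma>0" using \<gamma>0 l by (auto simp: \<rho>_def)
  have "\<rho> * l \<le> (\<gamma>0 / 2 / (1 + l)) * (1 + l)" using l \<rho> by (intro mult_mono) (auto simp: \<rho>_def)
  also have "\<dots> = \<gamma>0 / 2"
    using l by (intro nonzero_eq_divide_eq[THEN iffD1]) auto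
  finally have \<rho>l: "\<rho> * l \<le> \<gamma>0 / 2" .
  let ?N = "\<lambda>w. M0 w + \<rho> * ln (\<gamma> w)"
  \<comment> \<open>Below the level \<open>k0\<close> the logarithm already pushes the function
    under its value at \<open>z2\<close>, so the maximum over the compact set \<open>?K\<close> is
    global.\<close>
  define k0 where "k0 = min (\<gamma> z2) (exp ((?N z2 - B) / \<rho>))"
  have k0: "0 < k0" using \<gamma>(2)[OF z2(1)] by (simp add: k0_def)
  let ?K = "{z \<in> Z. k0 \<le> \<gamma> z}"
  have z2K: "z2 \<in> ?K" using z2 by (simp add: k0_def)
  have "usc_on ?K ?N"
    using k0 by (intro usc_on_add usc_on_subset[OF usc] continuous_imp_usc_on continuous_intros continuous_on_subset[OF \<gamma>(1)]) auto
  from usc_attains_sup[OF cpt[OF k0] _ this] z2K obtain z where z: "z \<in> ?K" "\<forall>w\<in>?K. ?N w \<le> ?N z" by blast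
  have max: "?N w \<le> ?N z" if w: "w \<in> Z" for w
  proof (cases "k0 \<le> \<gamma> w")
    case True then show ?thesis using z w by auto
  next
    case False
    have "\<gamma> w \<le> exp ((?N z2 - B) / \<rho>)" using False by (simp add: k0_def)
    then have "ln (\<gamma> w) \<le> (?N z2 - B) / \<rho>" using \<gamma>(2)[OF w] by (metis ln_exp ln_le_cancel_iff exp_gt_zero)
    then have "\<rho> * ln (\<gamma> w) \<le> ?N z2 - B" using \<rho> by (simp add: field_simps)
    then show ?thesis using B[OF w] z(2) z2K by fastforce
  qed
  show thesis
  proof (rule that[OF \<rho>, of z])
    fix w assume w: "w \<in> Z"
    have "M0 z2 - \<rho> * l \<le> ?N z" using max[OF z2(1)] by (simp add: l_def)
    moreover have "\<rho> * ln (\<gamma> z) \<le> 0" using \<rho> \<gamma>(2,3)[of z] z by (simp add: mult_nonneg_nonpos)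
    ultimately show "M0 w \<le> M0 z + \<gamma>0" using z2'[OF w] \<rho>l by linarith
  qed (use z max in auto)
qed

lemma powr_absorb:
  fixes \<sigma> m c K :: real
  assumes "0 < \<sigma>" "\<sigma> < m" "0 < c" "0 \<le> K"
  obtains C where "0 \<le> C" "\<And>Y. 0 \<le> Y \<Longrightarrow> K * Y powr \<sigma> \<le> c * Y powr m + C"
proof -
  obtain Y0 where Y0: "\<And>Y. Y0 \<le> Y \<Longrightarrow> 0 + K * Y powr \<sigma> < c * Y powr m"
    using powr_dominates[OF assms(1-3), of 0 K] by (auto simp: eventually_at_top_linorder)
  show thesis
  proof (rule that[of "K * (max 0 Y0) powr \<sigma>"])
    fix Y :: real assume Y: "0 \<le> Y"
    show "K * Y powr \<sigma> \<le> c * Y powr m + K * (max 0 Y0) powr \<sigma>"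
    proof (cases "Y0 \<le> Y")
      case True
      then show ?thesis using Y0[OF True] assms by (auto intro: add_increasing2)
    next
      case False
      then have "K * Y powr \<sigma> \<le> K * (max 0 Y0) powr \<sigma>" using Y assms by (intro mult_left_mono powr_mono2) auto
      then show ?thesis using assms by (auto intro: add_increasing)
    qed
  qed (use assms in auto)
qed

text \<open>The choice of \<open>a\<close> means \<open>(a - 1) * m = - \<sigma>\<close>: the
  \<open>m\<close>-th power of the slope \<open>Y\<close> is at least of order
  \<open>A powr m * s powr (- \<sigma>)\<close>. This beats the defect term directly, provided
  \<open>\<gamma>0\<close> is small against \<open>A powr m\<close>. The other term is bounded by a
  multiple of the lower power \<open>Y powr \<sigma>\<close>, with a constant free of
  \<open>A\<close>.\<close>

lemma barrier_numbers:
  fixes s A a \<sigma> m Y K2 \<gamma>0 c C4 :: real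
  assumes \<sigma>: "0 < \<sigma>" "\<sigma> < 1" "\<sigma> < m" and a: "a = 1 - \<sigma> / m" and s: "0 < s" "s \<le> 1" and A: "0 < A" "A \<le> 1"
    and Y: "A * (a * s powr (a - 1)) \<le> Y" and c: "0 < c" and K2: "0 \<le> K2"
    and \<gamma>0: "K2 * \<gamma>0 \<le> c * (A * a / 2) powr m"
    and C4: "\<And>Y. 0 \<le> Y \<Longrightarrow> K2 * (1 / a) powr \<sigma> * Y powr \<sigma> \<le> c * (1/2) powr m * Y powr m + C4"
  shows "K2 * (A * s powr (a - \<sigma>) + \<gamma>0 * s powr (- \<sigma>)) \<le> 2 * c * (Y / 2) powr m + C4"
proof -
  have a01: "0 < a" "a < 1" using \<sigma> by (auto simp: a)
  have Y0: "0 \<le> Y" using Y A a01 s by (smt (verit) mult_nonneg_nonneg powr_ge_zero)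
  have "A * s powr (a - 1) \<le> Y / a" using Y a01 by (simp add: field_simps)
  \<comment> \<open>Interpolation between the slope \<open>A * s powr (a - 1)\<close> with weight
    \<open>\<sigma>\<close> and the height \<open>A * s powr a\<close>, which is at most 1, with
    weight \<open>1 - \<sigma>\<close>.\<close>
  have "A * s powr (a - \<sigma>) = (A * s powr (a - 1)) powr \<sigma> * (A * s powr a) powr (1 - \<sigma>)"
  proof -
    have "(A * s powr (a - 1)) powr \<sigma> * (A * s powr a) powr (1 - \<sigma>)
      = (A powr \<sigma> * A powr (1 - \<sigma>)) * (s powr ((a - 1) * \<sigma>) * s powr (a * (1 - \<sigma>)))"
      using A s by (simp add: powr_mult powr_powr)
    also have "\<dots> = A * s powr (a - \<sigma>)"
      using A s by (simp add: powr_add[symmetric] algebra_simps)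
    finally show ?thesis by simp
  qed
  also have "\<dots> \<le> (Y / a) powr \<sigma> * 1"
  proof (intro mult_mono)
    show "(A * s powr (a - 1)) powr \<sigma> \<le> (Y / a) powr \<sigma>"
      using \<open>A * s powr (a - 1) \<le> Y / a\<close> A s \<sigma> by (intro powr_mono2) auto
    have "A * s powr a \<le> 1 * 1" using A s a01 by (intro mult_mono powr_le1) auto
    then show "(A * s powr a) powr (1 - \<sigma>) \<le> 1" using A s \<sigma> by (intro powr_le1) auto
  qed auto
  also have "\<dots> = (1 / a) powr \<sigma> * Y powr \<sigma>" using Y0 a01 by (simp add: powr_divide)
  finally have 1: "K2 * (A * s powr (a - \<sigma>)) \<le> K2 * (1 / a) powr \<sigma> * Y powr \<sigma>"
    using K2 by (simp add: mult_left_mono mult.assoc)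
  have am: "(a - 1) * m = - \<sigma>" using \<sigma> by (simp add: a)
  have "K2 * \<gamma>0 * s powr (- \<sigma>) \<le> c * (A * a / 2) powr m * s powr (- \<sigma>)"
    using \<gamma>0 by (intro mult_right_mono) auto
  also have "(A * a / 2) powr m * s powr (- \<sigma>) = (A * (a * s powr (a - 1)) / 2) powr m"
    using A a01 s by (simp add: powr_mult powr_divide powr_powr am)
  then have "c * (A * a / 2) powr m * s powr (- \<sigma>) = c * (A * (a * s powr (a - 1)) / 2) powr m" by simp
  also have "\<dots> \<le> c * (Y / 2) powr m"
    using c Y A a01 s \<sigma> by (intro mult_left_mono powr_mono2) auto
  finally have 2: "K2 * \<gamma>0 * s powr (- \<sigma>) \<le> c * (Y / 2) powr m" .
  have "c * (1/2) powr m * Y powr m = c * (Y / 2) powr m" using Y0 by (simp add: powr_divide)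
  then have "K2 * (1 / a) powr \<sigma> * Y powr \<sigma> \<le> c * (Y / 2) powr m + C4" using C4[OF Y0] by (simp only:)
  moreover have "K2 * (A * s powr (a - \<sigma>) + \<gamma>0 * s powr (- \<sigma>)) =
      K2 * (A * s powr (a - \<sigma>)) + K2 * \<gamma>0 * s powr (- \<sigma>)" by (simp add: algebra_simps)
  ultimately show ?thesis using 1 2 by linarith
qed

text \<open>The penalty gradient \<open>p\<close> hardly points along the barrier direction
  \<open>n\<close>, so subtracting \<open>Y *\<^sub>R n\<close> cannot cancel it: the cross term in
  the squared norm is at most \<open>Y * norm p / 4\<close>, which the two squares absorb.\<close>

lemma gradient_lower_bound:
  fixes p n :: "'a::real_inner"
  assumes "1 \<le> norm n" "n \<bullet> p \<le> norm p / 8" "0 \<le> Y"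
  shows "norm p / 2 \<le> norm (p - Y *\<^sub>R n)" "Y / 2 \<le> norm (p - Y *\<^sub>R n)"
proof -
  have "(norm (p - Y *\<^sub>R n))\<^sup>2 = (norm p)\<^sup>2 - 2 * Y * (n \<bullet> p) + Y\<^sup>2 * (norm n)\<^sup>2"
    unfolding power2_norm_eq_inner
    by (simp add: inner_diff_left inner_diff_right inner_commute power2_eq_square algebra_simps)
  moreover have "2 * Y * (n \<bullet> p) \<le> 2 * Y * (norm p / 8)" using assms by (intro mult_left_mono) auto
  moreover have "Y\<^sup>2 * 1 \<le> Y\<^sup>2 * (norm n)\<^sup>2" using assms by (intro mult_left_mono) auto
  ultimately have 1: "(norm p)\<^sup>2 - Y * norm p / 4 + Y\<^sup>2 \<le> (norm (p - Y *\<^sub>R n))\<^sup>2" by simp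
  have 2: "Y * norm p \<le> Y\<^sup>2 / 2 + (norm p)\<^sup>2 / 2"
    using sum_squares_bound[of Y "norm p"] by simp
  have "(norm p / 2)\<^sup>2 \<le> (norm (p - Y *\<^sub>R n))\<^sup>2" "(Y / 2)\<^sup>2 \<le> (norm (p - Y *\<^sub>R n))\<^sup>2"
  proof -
    have "(norm p / 2)\<^sup>2 = (norm p)\<^sup>2 / 4" "(Y / 2)\<^sup>2 = Y\<^sup>2 / 4" by (simp_all add: power_divide)
    then show "(norm p / 2)\<^sup>2 \<le> (norm (p - Y *\<^sub>R n))\<^sup>2" "(Y / 2)\<^sup>2 \<le> (norm (p - Y *\<^sub>R n))\<^sup>2"
      using 1 2 zero_le_power2[of Y] zero_le_power2[of "norm p"] by linarith+
  qed
  then show "norm p / 2 \<le> norm (p - Y *\<^sub>R n)" "Y / 2 \<le> norm (p - Y *\<^sub>R n)"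
    using power2_le_imp_le[of "norm p / 2"] power2_le_imp_le[of "Y / 2"] by auto
qed

text \<open>A tube lemma: the points where the bound fails form a compact set, whose projection to
  the first factor is closed and misses \<open>y\<close>.\<close>

lemma usc_sup_near:
  assumes "compact K" and I: "compact I" "I \<noteq> {}" and usc: "usc_on (K \<times> I) w"
    and y: "\<And>t. t \<in> I \<Longrightarrow> w (y, t) < c" "y \<in> K"
  obtains \<epsilon> where "(0::real) < \<epsilon>" "\<And>x t. x \<in> K \<Longrightarrow> t \<in> I \<Longrightarrow> norm (x - y) < \<epsilon> \<Longrightarrow> w (x, t) < c"
proof -
  define A where "A = K \<times> I - {z \<in> K \<times> I. w z < c}"
  have "closedin (top_of_set (K \<times> I)) A"
    unfolding A_def using usc_on_openin[OF usc, of c] by (simp add: openin_closedin_eq)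
  then have "compact A" by (rule closedin_compact[OF compact_Times[OF assms(1) I(1)]])
  then have "closed (fst ` A)"
    by (intro compact_imp_closed compact_continuous_image continuous_intros)
  moreover have "y \<notin> fst ` A" using y by (auto simp: A_def)
  ultimately obtain \<epsilon> where "0 < \<epsilon>" "ball y \<epsilon> \<subseteq> - fst ` A"
    by (meson ComplI openE open_Compl)
  then have "ball y \<epsilon> \<inter> fst ` A = {}" by blast
  show thesis
  proof (rule that[OF \<open>0 < \<epsilon>\<close>], rule ccontr)
    fix x t assume a: "x \<in> K" "t \<in> I" "norm (x - y) < \<epsilon>" "\<not> w (x, t) < c"
    then have "(x, t) \<in> A" by (simp add: A_def)
    then have "x \<in> fst ` A" by force
    moreover have "x \<in> ball y \<epsilon>" using a by (simp add: dist_norm norm_minus_commute)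
    ultimately show False using \<open>ball y \<epsilon> \<inter> fst ` A = {}\<close> by blast
  qed
qed

section \<open>The Lipschitz estimate for the subsolution\<close>

context levy_setting begin

text \<open>Jumps shorter than \<open>\<kappa> * s\<close> keep \<open>g\<close> above half its
  value, so the exact maximum \<open>touch\<close> controls them linearly, with the barrier slope
  \<open>Y\<close>. Longer jumps may end arbitrarily near the boundary, where the logarithm is
  unbounded; for them \<open>almost\<close>, which is free of the logarithm, gives the constant
  \<open>A * s powr a + \<gamma>0\<close>.\<close>

lemma lipschitz_touch:
  assumes sub: "visc_subsolution \<Omega> \<nu> H f \<phi> u0 u" and lb: "locally_bounded_on (Qbar \<Omega>) u"
    and patch: "patch \<Omega> x0 r G e g Dg"
    and R: "0 < R" "\<And>x t. x \<in> closure \<Omega> \<Longrightarrow> 0 \<le> t \<Longrightarrow> t \<le> T \<Longrightarrow> \<bar>u (x, t)\<bar> \<le> R"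
    and \<theta>: "\<And>t. (\<theta> has_real_derivative \<theta>' t) (at t)" "continuous_on UNIV \<theta>'"
    and y: "norm (y - x0) < r / 4" and x: "x \<in> \<Omega>" "norm (x - y) < r / 4" and t: "0 < t" "t < T"
    and \<epsilon>: "0 < \<epsilon>" and L: "0 < L" "1 / L \<le> r / 4" "1 / L < 1" and A: "0 < A" and a: "0 < a" "a < 1"
    and \<rho>: "0 < \<rho>" "\<rho> \<le> \<gamma>0" and s: "s = g x" and Y: "Y = A * (a * s powr (a - 1)) + \<rho> / s"
    and touch: "\<And>x' t'. x' \<in> \<Omega> \<Longrightarrow> norm (x' - y) \<le> r / 2 \<Longrightarrow> 0 \<le> t' \<Longrightarrow> t' \<le> T \<Longrightarrow>
       u (x', t') - \<theta> t' - L * snorm \<epsilon> (x' - y) + (A * g x' powr a + \<rho> * ln (g x'))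
       \<le> u (x, t) - \<theta> t - L * snorm \<epsilon> (x - y) + (A * g x powr a + \<rho> * ln (g x))"
    and almost: "\<And>x'. x' \<in> \<Omega> \<Longrightarrow> norm (x' - y) \<le> r / 2 \<Longrightarrow>
       u (x', t) - \<theta> t - L * snorm \<epsilon> (x' - y) + A * g x' powr a
       \<le> u (x, t) - \<theta> t - L * snorm \<epsilon> (x - y) + A * g x powr a + \<gamma>0"
  shows "\<theta>' t + H x (u (x, t)) ((L / snorm \<epsilon> (x - y)) *\<^sub>R (x - y) - Y *\<^sub>R Dg x) - f (x, t)
    \<le> (C2 + 2 * R * C1) * L powr \<sigma> +
      (2 * G * C2 * (1 / (2 * G)) powr (1 - \<sigma>) + C1 * (1 / (2 * G)) powr (- \<sigma>)) *
        (A * s powr (a - \<sigma>) + \<gamma>0 * s powr (- \<sigma>))"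
proof -
  note P = patch[unfolded patch_def]
  have r: "0 < r" "r \<le> 1" "1 \<le> G" and Dg: "C1_gradient_on UNIV g Dg" using P by auto
  have gp: "\<And>x. x \<in> ball x0 r \<Longrightarrow> (x \<in> \<Omega> \<longleftrightarrow> 0 < g x)" "\<And>x. x \<in> ball x0 r \<Longrightarrow> g x \<le> 1"
    "\<And>x y. x \<in> ball x0 r \<Longrightarrow> y \<in> ball x0 r \<Longrightarrow> \<bar>g x - g y\<bar> \<le> G * norm (x - y)"
    using P by auto
  have nb: "x' \<in> ball x0 r" "norm (x' - y) \<le> r / 2" if "norm (x' - x) < r / 4" for x'
    using norm_triangle_ineq[of "x' - x" "x - y"] norm_triangle_ineq[of "x' - y" "y - x0"] that x y r
    by (auto simp: dist_norm norm_minus_commute[of x0])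
  have xb: "x \<in> ball x0 r" using nb(1)[of x] r by simp
  have s01: "0 < s" "s \<le> 1" using gp(1,2)[OF xb] x s by auto
  define \<kappa> where "\<kappa> = 1 / (2 * G)"
  have \<kappa>: "0 < \<kappa>" "\<kappa> \<le> 1 / 2" "G * \<kappa> = 1 / 2" using r by (auto simp: \<kappa>_def field_simps)
  \<comment> \<open>The size that balances the near part
    \<open>L * \<delta> powr (1 - \<sigma>)\<close> of the penalty with the tail
    \<open>\<delta> powr (- \<sigma>)\<close>; both become \<open>L powr \<sigma>\<close>.\<close>
  define \<delta> where "\<delta> = 1 / L"
  have \<delta>: "0 < \<delta>" "\<delta> < 1" "\<delta> \<le> r / 4" using L by (auto simp: \<delta>_def)
  have \<gamma>0: "0 < \<gamma>0" using \<rho> by linarith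
  have Y0: "0 \<le> Y" unfolding Y using A a \<rho> s01 by simp
  have xc: "x \<in> closure \<Omega>" using x closure_subset by auto
  have gs: "s / 2 \<le> g x'" if "norm (x' - x) < r / 4" "norm (x' - x) < \<kappa> * s" for x'
  proof -
    have "\<bar>g x' - g x\<bar> \<le> G * norm (x' - x)" using nb(1)[OF that(1)] xb by (rule gp(3))
    also have "\<dots> \<le> G * (\<kappa> * s)" using that r by (intro mult_left_mono) auto
    also have "\<dots> = s / 2" using \<kappa>(3) by (metis mult.assoc mult.left_commute mult_1 times_divide_eq_left)
    finally show ?thesis using s by linarith
  qed
  \<comment> \<open>Starting at half the height of \<open>x\<close>, the extension agrees with the
    barrier throughout the neighbourhood of radius \<open>d\<close> fixed below.\<close>
  obtain Fb Fb' where Fb: "\<And>r. (Fb has_real_derivative Fb' r) (at r)" "continuous_on UNIV Fb'"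
    "\<And>r. s / 2 \<le> r \<Longrightarrow> Fb r = A * r powr a + \<rho> * ln r"
    "\<And>r. s / 2 \<le> r \<Longrightarrow> Fb' r = A * (a * r powr (a - 1)) + \<rho> / r"
    using barrier_extension[of "s/2" A a \<rho>] s01 by (metis half_gt_zero)
  define \<psi>1 where "\<psi>1 z = L * snorm \<epsilon> (z - y) - Fb (g z)" for z
  define D1 where "D1 z = (L / snorm \<epsilon> (z - y)) *\<^sub>R (z - y) - Fb' (g z) *\<^sub>R Dg z" for z
  have "C1_gradient_on UNIV \<psi>1 D1"
  proof -
    have "C1_gradient_on UNIV (\<lambda>z. L * snorm \<epsilon> (z - y)) (\<lambda>z. L *\<^sub>R ((1 / snorm \<epsilon> (z - y)) *\<^sub>R (z - y)))"
      using C1_gradient_on_compose[OF C1_gradient_on_snorm[OF \<epsilon>], of "\<lambda>r. L * r" "\<lambda>_. L"]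
      by (auto intro!: derivative_eq_intros)
    from C1_gradient_on_add[OF this C1_gradient_on_minus[OF C1_gradient_on_compose[OF Dg Fb(1,2)]]]
    show ?thesis unfolding \<psi>1_def[abs_def] D1_def[abs_def] by simp
  qed
  from C1_gradient_on_add[OF C1_gradient_on_snd[OF \<theta>] C1_gradient_on_fst[OF this]]
  have \<psi>: "C1_gradient_on (Qbar \<Omega>) (\<lambda>z. \<theta> (snd z) + \<psi>1 (fst z)) (\<lambda>z. (0, \<theta>' (snd z)) + (D1 (fst z), 0))" .
  have Fbx: "Fb (g x) = A * g x powr a + \<rho> * ln (g x)" "Fb' (g x) = Y"
    using Fb(3,4)[of "g x"] s01 unfolding Y s by auto
  define d where "d = min (min (r / 4) (\<kappa> * s)) (min t (T - t))"
  have d: "0 < d" "d \<le> r / 4" "d \<le> \<kappa> * s" "d \<le> t" "d \<le> T - t"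
  proof -
    have "0 < \<kappa> * s" using \<kappa> s01 by simp
    then show "0 < d" "d \<le> r / 4" "d \<le> \<kappa> * s" "d \<le> t" "d \<le> T - t" using r t unfolding d_def by linarith+
  qed
  define k where "k z = L * norm z + (if norm z < \<kappa> * s then 2 * G * Y * norm z else A * s powr a + \<gamma>0)" for z :: 'a
  define J where "J = L * (C2 * \<delta> powr (1 - \<sigma>)) + (2 * G * Y * (C2 * (\<kappa> * s) powr (1 - \<sigma>)) + (A * s powr a + \<gamma>0) * (C1 * (\<kappa> * s) powr (- \<sigma>)))"
  have \<kappa>s: "0 < \<kappa> * s" "\<kappa> * s < 1" using \<kappa> s01 mult_mono[of \<kappa> "1/2" s 1] by auto
  have As: "0 \<le> A * s powr a + \<gamma>0" using A \<gamma>0 by simp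
  have GY: "0 \<le> 2 * G * Y" using r Y0 by simp
  have J0: "0 \<le> J" unfolding J_def using L C2_pos C1_pos GY As by (auto intro!: add_nonneg_nonneg mult_nonneg_nonneg)
  have "snd ((0, \<theta>' (snd (x, t))) + (D1 (fst (x, t)), 0)) + H x (u (x, t)) (fst ((0, \<theta>' (snd (x, t))) + (D1 (fst (x, t)), 0))) - f (x, t)
    \<le> J + nonlocal_op \<Omega> \<nu> (- ball 0 \<delta>) (\<lambda>y. u (y, t)) x"
  proof (rule sub_ineq[OF sub lb \<psi> _ d(1), where k=k])
    show "(x, t) \<in> Qbar \<Omega>" "(x, t) \<in> Qcyl \<Omega> \<or> (x, t) \<in> lateral \<Omega> \<and> \<phi> (x, t) < u (x, t) \<or> t = 0 \<and> u0 x < u (x, t)"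
      using xc x t by (auto simp: Qbar_def Qcyl_def)
    fix z assume z: "z \<in> Qbar \<Omega>" "norm (z - (x, t)) < d"
    obtain x' t' where zx: "z = (x', t')" by (cases z)
    have n: "norm (x' - x) < d" "\<bar>t' - t\<bar> < d"
      using z(2) norm_fst_diff[of z x t] norm_snd_diff[of z t x] by (auto simp: zx)
    have n': "norm (x' - x) < r / 4" "norm (x' - x) < \<kappa> * s" using n d by linarith+
    have "s / 2 \<le> g x'" by (rule gs[OF n'])
    moreover have "x' \<in> \<Omega>" using gp(1)[OF nb(1)[OF n'(1)]] \<open>s / 2 \<le> g x'\<close> s01 by simp
    ultimately show "u z - (\<theta> (snd z) + \<psi>1 (fst z)) \<le> u (x, t) - (\<theta> (snd (x, t)) + \<psi>1 (fst (x, t)))"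
    proof -
      have "0 \<le> t'" "t' \<le> T" using n(2) d by linarith+
      then show ?thesis
        using touch[of x' t'] nb(2)[OF n'(1)] \<open>x' \<in> \<Omega>\<close> \<open>s / 2 \<le> g x'\<close> Fbx Fb(3)[of "g x'"] by (simp add: zx \<psi>1_def)
    qed
  next
    show "AE z in \<nu> x. z \<noteq> 0 \<longrightarrow> norm z < \<delta> \<longrightarrow> x + z \<in> closure \<Omega> \<longrightarrow> u (x + z, t) - u (x, t) \<le> k z"
      using AE_interior[OF x(1)]
    proof (eventually_elim, intro impI)
      fix z assume "z \<noteq> 0 \<longrightarrow> x + z \<in> \<Omega>" "z \<noteq> 0" and z: "norm z < \<delta>"
      then have xz: "x + z \<in> \<Omega>" by simp
      have n: "norm ((x + z) - x) < r / 4" using z \<delta> by simp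
      have sn: "L * snorm \<epsilon> (x + z - y) \<le> L * snorm \<epsilon> (x - y) + L * norm z"
      proof -
        have e: "x + z - y = x - y + z" by simp
        show ?thesis unfolding e
          using mult_left_mono[OF snorm_triangle[of \<epsilon> "x - y" z], of L] L by (simp add: distrib_left)
      qed
      show "u (x + z, t) - u (x, t) \<le> k z"
      proof (cases "norm z < \<kappa> * s")
        case True
        have "s / 2 \<le> g (x + z)" using gs[OF n] True by simp
        from barrier_decrease[OF _ _ a s01(1) this, of A \<rho>] A \<rho>
        have "(A * s powr a + \<rho> * ln s) - (A * g (x + z) powr a + \<rho> * ln (g (x + z))) \<le> 2 * Y * \<bar>s - g (x + z)\<bar>"
          unfolding Y by simp
        also have "\<dots> \<le> 2 * Y * (G * norm z)"
          using gp(3)[OF xb nb(1)[OF n]] Y0 unfolding s by (intro mult_left_mono) (auto simp: norm_minus_commute)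
        finally have "(A * s powr a + \<rho> * ln s) - (A * g (x + z) powr a + \<rho> * ln (g (x + z))) \<le> 2 * G * Y * norm z"
          by (simp add: algebra_simps)
        then show ?thesis using touch[OF xz nb(2)[OF n], of t] t sn True unfolding k_def s by simp
      next
        case False
        \<comment> \<open>The barrier value at the landing point is dropped; only its value at
          \<open>x\<close> is paid for.\<close>
        have "0 \<le> A * g (x + z) powr a" using A by simp
        then show ?thesis using almost[OF xz nb(2)[OF n]] sn False unfolding k_def s by simp
      qed
    qed
    show "0 \<le> k z" for z using L GY As by (auto simp: k_def)
    have "(\<integral>\<^sup>+z\<in>ball 0 \<delta>. ennreal (k z) \<partial>\<nu> x)
      \<le> (\<integral>\<^sup>+z. ennreal (L * norm z) * indicator (ball 0 \<delta>) z + (ennreal (2 * G * Y * norm z) * indicator (ball 0 (\<kappa> * s)) z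
         + ennreal (A * s powr a + \<gamma>0) * indicator (- ball 0 (\<kappa> * s)) z) \<partial>\<nu> x)"
    proof (intro nn_integral_mono)
      fix z
      have "ennreal (k z) = ennreal (L * norm z) + ennreal (if norm z < \<kappa> * s then 2 * G * Y * norm z else A * s powr a + \<gamma>0)"
        unfolding k_def using L GY As by (intro ennreal_plus) auto
      then show "ennreal (k z) * indicator (ball 0 \<delta>) z \<le> ennreal (L * norm z) * indicator (ball 0 \<delta>) z + (ennreal (2 * G * Y * norm z) * indicator (ball 0 (\<kappa> * s)) z
         + ennreal (A * s powr a + \<gamma>0) * indicator (- ball 0 (\<kappa> * s)) z)"
        by (auto simp: indicator_def)
    qed
    also have "\<dots> = (\<integral>\<^sup>+z\<in>ball 0 \<delta>. ennreal (L * norm z) \<partial>\<nu> x) + ((\<integral>\<^sup>+z\<in>ball 0 (\<kappa> * s). ennreal (2 * G * Y * norm z) \<partial>\<nu> x)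
         + (\<integral>\<^sup>+z\<in>- ball 0 (\<kappa> * s). ennreal (A * s powr a + \<gamma>0) \<partial>\<nu> x))"
    proof -
      have ms: "(\<lambda>z. ennreal (c * norm z) * indicator (ball 0 q) z) \<in> borel_measurable (\<nu> x)"
        "(\<lambda>z. ennreal c * indicator (- ball 0 q) z) \<in> borel_measurable (\<nu> x)" for c q
        by (auto simp: measurable_cong_sets[OF sets_nu[OF xc] refl] intro!: borel_measurable_times_ennreal borel_measurable_indicator)
      show ?thesis
        by (simp only: nn_integral_add[OF ms(1) borel_measurable_add[OF ms(1) ms(2)]] nn_integral_add[OF ms(1) ms(2)])
    qed
    also have "\<dots> \<le> ennreal (L * (C2 * \<delta> powr (1 - \<sigma>))) + (ennreal (2 * G * Y * (C2 * (\<kappa> * s) powr (1 - \<sigma>)))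
      + ennreal ((A * s powr a + \<gamma>0) * (C1 * (\<kappa> * s) powr (- \<sigma>))))"
      using nn_integral_linear[OF xc \<delta>(1,2), of L] nn_integral_linear[OF xc \<kappa>s GY] L
        nn_integral_const_tail[OF xc \<kappa>s(1) As order_refl] by (intro add_mono) auto
    also have "\<dots> = ennreal J"
    proof -
      have n: "0 \<le> L * (C2 * \<delta> powr (1 - \<sigma>))" "0 \<le> 2 * G * Y * (C2 * (\<kappa> * s) powr (1 - \<sigma>))"
        "0 \<le> (A * s powr a + \<gamma>0) * (C1 * (\<kappa> * s) powr (- \<sigma>))"
        using L C2_pos C1_pos GY As by auto
      show ?thesis
        unfolding J_def by (simp only: ennreal_plus[OF n(1) add_nonneg_nonneg[OF n(2,3)]] ennreal_plus[OF n(2,3)])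
    qed
    finally show "(\<integral>\<^sup>+z\<in>ball 0 \<delta>. ennreal (k z) \<partial>\<nu> x) \<le> ennreal J" .
  qed (use \<delta> J0 in auto)
  moreover have "nonlocal_op \<Omega> \<nu> (- ball 0 \<delta>) (\<lambda>y. u (y, t)) x \<le> 2 * R * (C1 * \<delta> powr (- \<sigma>))"
    using R xc \<delta> t by (intro nonlocal_op_tail_le) auto
  moreover have D1x: "D1 x = (L / snorm \<epsilon> (x - y)) *\<^sub>R (x - y) - Y *\<^sub>R Dg x"
    unfolding D1_def Fbx(2) ..
  ultimately have 1: "\<theta>' t + H x (u (x, t)) ((L / snorm \<epsilon> (x - y)) *\<^sub>R (x - y) - Y *\<^sub>R Dg x) - f (x, t)
    \<le> J + 2 * R * (C1 * \<delta> powr (- \<sigma>))" by simp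
  have \<delta>1: "\<delta> powr (- \<sigma>) = L powr \<sigma>" unfolding \<delta>_def using L by (simp add: powr_divide powr_minus)
  have \<delta>2: "L * \<delta> powr (1 - \<sigma>) = L powr \<sigma>"
    unfolding \<delta>_def using L by (simp add: powr_divide powr_diff field_simps)
  let ?X = "A * s powr (a - \<sigma>) + \<gamma>0 * s powr (- \<sigma>)"
  \<comment> \<open>The slope \<open>\<rho> / s\<close> of the logarithm also ends up at the order
    \<open>s powr (- \<sigma>)\<close>, with a coefficient at most \<open>\<gamma>0\<close>.\<close>
  have "Y * s powr (1 - \<sigma>) = A * a * s powr (a - \<sigma>) + \<rho> * s powr (- \<sigma>)"
  proof -
    have "s powr (a - 1) * s powr (1 - \<sigma>) = s powr (a - \<sigma>)" using s01 by (simp add: powr_add[symmetric])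
    moreover have "s powr (1 - \<sigma>) / s = s powr (- \<sigma>)" using s01 by (simp add: powr_diff powr_minus field_simps)
    moreover have "Y * s powr (1 - \<sigma>) = A * a * (s powr (a - 1) * s powr (1 - \<sigma>)) + \<rho> * (s powr (1 - \<sigma>) / s)"
      unfolding Y by (simp add: distrib_right)
    ultimately show ?thesis by simp
  qed
  also have "\<dots> \<le> ?X" using A a \<rho> by (intro add_mono mult_right_mono) (auto simp: mult_left_le)
  finally have Ys: "Y * s powr (1 - \<sigma>) \<le> ?X" .
  have "2 * G * Y * (C2 * (\<kappa> * s) powr (1 - \<sigma>)) = 2 * G * C2 * \<kappa> powr (1 - \<sigma>) * (Y * s powr (1 - \<sigma>))"
    using \<kappa> s01 by (simp add: powr_mult algebra_simps)
  also have "\<dots> \<le> 2 * G * C2 * \<kappa> powr (1 - \<sigma>) * ?X"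
    using Ys r C2_pos by (intro mult_left_mono) auto
  finally have 2: "2 * G * Y * (C2 * (\<kappa> * s) powr (1 - \<sigma>)) \<le> 2 * G * C2 * \<kappa> powr (1 - \<sigma>) * ?X" .
  have "s powr a * s powr (- \<sigma>) = s powr (a - \<sigma>)" using s01 by (simp add: powr_add[symmetric])
  then have 3: "(A * s powr a + \<gamma>0) * (C1 * (\<kappa> * s) powr (- \<sigma>)) = C1 * \<kappa> powr (- \<sigma>) * ?X"
    using \<kappa> s01 by (simp add: powr_mult algebra_simps)
  have "J + 2 * R * (C1 * \<delta> powr (- \<sigma>)) \<le> C2 * (L * \<delta> powr (1 - \<sigma>)) + 2 * R * C1 * L powr \<sigma> +
    (2 * G * C2 * \<kappa> powr (1 - \<sigma>) * ?X + C1 * \<kappa> powr (- \<sigma>) * ?X)"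
    unfolding J_def using 2 3 \<delta>1 by (simp add: algebra_simps)
  then show ?thesis using 1 unfolding \<delta>2 \<kappa>_def[symmetric] by (simp add: algebra_simps)
qed


text \<open>\<open>L\<close> is fixed before \<open>\<theta>\<close>, \<open>y\<close>,
  \<open>s0\<close> and \<open>Q\<close>, because later the time penalty moves with the second
  variable; of its derivative only the bound \<open>C0\<close> counts. Both points share one time
  variable: the bound \<open>Q\<close> at \<open>y\<close> holds for all times, which spares a
  doubling in time. The large values of \<open>\<theta>\<close> at 0 and \<open>T\<close> keep the
  maximum at interior times.\<close>

lemma lipschitz_estimate:
  assumes sub: "visc_subsolution \<Omega> \<nu> H f \<phi> u0 u" and lb: "locally_bounded_on (Qbar \<Omega>) u"
    and f: "continuous_on (Qbar \<Omega>) f" and H2: "assm_H2 m \<Omega> H" and m: "\<sigma> < m"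
    and patch: "patch \<Omega> x0 r G e g Dg"
    and R: "0 < R" "\<And>x t. x \<in> closure \<Omega> \<Longrightarrow> 0 \<le> t \<Longrightarrow> t \<le> T \<Longrightarrow> \<bar>u (x, t)\<bar> \<le> R"
    and T: "0 < T"
  obtains L where "0 < L" "\<And>\<theta> \<theta>' y s0 Q x t. (\<And>t. (\<theta> has_real_derivative \<theta>' t) (at t)) \<Longrightarrow> continuous_on UNIV \<theta>' \<Longrightarrow>
      (\<And>t. 0 \<le> t \<Longrightarrow> t \<le> T \<Longrightarrow> \<bar>\<theta>' t\<bar> \<le> C0) \<Longrightarrow> y \<in> \<Omega> \<Longrightarrow> norm (y - x0) < r / 4 \<Longrightarrow>
      0 \<le> s0 \<Longrightarrow> s0 \<le> T \<Longrightarrow> (\<And>t. 0 \<le> t \<Longrightarrow> t \<le> T \<Longrightarrow> \<theta> s0 \<le> \<theta> t + 1) \<Longrightarrow>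
      \<theta> s0 + 2 * R + 2 \<le> \<theta> 0 \<Longrightarrow> \<theta> s0 + 2 * R + 2 \<le> \<theta> T \<Longrightarrow>
      (\<And>t. 0 \<le> t \<Longrightarrow> t \<le> T \<Longrightarrow> u (y, t) - \<theta> t \<le> Q) \<Longrightarrow>
      x \<in> \<Omega> \<Longrightarrow> norm (x - x0) < r / 4 \<Longrightarrow> 0 \<le> t \<Longrightarrow> t \<le> T \<Longrightarrow> u (x, t) - \<theta> t \<le> Q + L * norm (x - y)"
proof -
  note P = patch[unfolded patch_def]
  have r: "0 < r" "r \<le> 1" "1 \<le> G" and Dg: "C1_gradient_on UNIV g Dg" using P by auto
  have gp: "\<And>x. x \<in> ball x0 r \<Longrightarrow> (x \<in> \<Omega> \<longleftrightarrow> 0 < g x)" "\<And>x. x \<in> ball x0 r \<Longrightarrow> g x \<le> 1"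
    "\<And>x. x \<in> ball x0 r \<Longrightarrow> norm (Dg x) \<le> G"
    "\<And>x y. x \<in> ball x0 r \<Longrightarrow> y \<in> ball x0 r \<Longrightarrow> x \<in> \<Omega> \<Longrightarrow> y \<in> \<Omega> \<Longrightarrow> g x \<le> g y / 2 \<Longrightarrow> 1 \<le> norm (Dg x) \<and> Dg x \<bullet> (x - y) \<le> norm (x - y) / 8"
  proof -
    show "x \<in> \<Omega> \<longleftrightarrow> 0 < g x" "g x \<le> 1" "norm (Dg x) \<le> G" if "x \<in> ball x0 r" for x using P that by blast+
    have "\<forall>x\<in>ball x0 r \<inter> \<Omega>. \<forall>y\<in>ball x0 r \<inter> \<Omega>. g x \<le> g y / 2 \<longrightarrow> 1 \<le> norm (Dg x) \<and> Dg x \<bullet> (x - y) \<le> norm (x - y) / 8"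
      using P by blast
    then show "1 \<le> norm (Dg x) \<and> Dg x \<bullet> (x - y) \<le> norm (x - y) / 8"
      if "x \<in> ball x0 r" "y \<in> ball x0 r" "x \<in> \<Omega>" "y \<in> \<Omega>" "g x \<le> g y / 2" for x y using that by blast
  qed
  have gc: "continuous_on UNIV g" using Dg by (rule C1_gradient_imp_continuous)
  have usc: "usc_on (Qbar \<Omega>) u" using sub by (simp add: visc_subsolution_def)
  obtain c where c: "0 < c" and Hc: "\<And>R. R > 0 \<Longrightarrow> \<exists>CR\<ge>0. \<forall>x\<in>closure \<Omega>. \<forall>p r. \<bar>r\<bar> \<le> R \<longrightarrow> c * norm p powr m - CR \<le> H x r p"
    using H2 unfolding assm_H2_def by auto
  obtain CR where CR: "\<And>x r p. x \<in> closure \<Omega> \<Longrightarrow> \<bar>r\<bar> \<le> R \<Longrightarrow> c * norm p powr m - CR \<le> H x r p"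
    using Hc[OF R(1)] by metis
  obtain F where F: "0 \<le> F" "\<And>x t. x \<in> closure \<Omega> \<Longrightarrow> 0 \<le> t \<Longrightarrow> t \<le> T \<Longrightarrow> \<bar>f (x, t)\<bar> \<le> F"
    using continuous_slice_bounded[OF bounded_dom f, of T] by metis
  define a where "a = 1 - \<sigma> / m"
  have a: "0 < a" "a < 1" using sigma_pos m by (auto simp: a_def)
  define K1 where "K1 = C2 + 2 * R * C1"
  define K2 where "K2 = 2 * G * C2 * (1 / (2 * G)) powr (1 - \<sigma>) + C1 * (1 / (2 * G)) powr (- \<sigma>)"
  have K2: "0 \<le> K2" using r C1_pos C2_pos by (simp add: K2_def)
  define C3 where "C3 = CR + F + C0"
  \<comment> \<open>With the share \<open>c / 8\<close> the barrier terms are at most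
    \<open>c / 4 * (Y / 2) powr m + C4\<close>, which fits into the half of the coercivity that is
    reserved for \<open>Y\<close>.\<close>
  obtain C4 where C4: "0 \<le> C4" "\<And>Y. 0 \<le> Y \<Longrightarrow> K2 * (1 / a) powr \<sigma> * Y powr \<sigma> \<le> c / 8 * (1/2) powr m * Y powr m + C4"
    by (rule powr_absorb[OF sigma_pos m, of "c / 8 * (1/2) powr m" "K2 * (1 / a) powr \<sigma>"]) (use c K2 in auto)
  have "\<forall>\<^sub>F L in at_top. (C3 + C4 + 1) + K1 * L powr \<sigma> < (c / 2 * (1/4) powr m) * L powr m"
    using sigma_pos m c by (intro powr_dominates) auto
  moreover have "\<forall>\<^sub>F L in at_top. max 2 (4 * (2 * R + 3) / r) \<le> L" by (rule eventually_ge_at_top)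
  ultimately have "\<forall>\<^sub>F L in at_top. (C3 + C4 + 1) + K1 * L powr \<sigma> < (c / 2 * (1/4) powr m) * L powr m \<and> max 2 (4 * (2 * R + 3) / r) \<le> L"
    by eventually_elim simp
  \<comment> \<open>\<open>L\<close> beats constants that are free of the barrier parameters. The
    last bound makes the penalty exceed the oscillation of \<open>u\<close> at distance
    \<open>r / 4\<close>, so the maximum stays inside the half ball around \<open>y\<close>.\<close>
  then obtain L where L: "(C3 + C4 + 1) + K1 * L powr \<sigma> < (c / 2 * (1/4) powr m) * L powr m" "2 \<le> L" "4 * (2 * R + 3) / r \<le> L"
    using eventually_happens[of _ "at_top :: real filter"] by force
  have Lr: "2 * R + 3 \<le> L * (r / 4)" using L(3) r by (simp add: field_simps)
  have L0: "0 < L" using L by simp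
  have Linv: "1 / L \<le> r / 4" "1 / L < 1"
  proof -
    have "1 \<le> L * (r / 4)" using Lr R by linarith
    then show "1 / L \<le> r / 4" using L0 by (simp add: field_simps)
  qed (use L in auto)
  have L4: "c / 2 * (L / 4) powr m = (c / 2 * (1/4) powr m) * L powr m" using L0 by (simp add: powr_divide)
  show thesis
  proof (rule that[OF L0])
    fix \<theta> \<theta>' y s0 Q x1 t1
    assume \<theta>: "\<And>t. (\<theta> has_real_derivative \<theta>' t) (at t)" "continuous_on UNIV \<theta>'"
      "\<And>t. 0 \<le> t \<Longrightarrow> t \<le> T \<Longrightarrow> \<bar>\<theta>' t\<bar> \<le> C0" and y: "y \<in> \<Omega>" "norm (y - x0) < r / 4"
      and s0: "0 \<le> s0" "s0 \<le> T" "\<And>t. 0 \<le> t \<Longrightarrow> t \<le> T \<Longrightarrow> \<theta> s0 \<le> \<theta> t + 1"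
        "\<theta> s0 + 2 * R + 2 \<le> \<theta> 0" "\<theta> s0 + 2 * R + 2 \<le> \<theta> T"
      and Q: "\<And>t. 0 \<le> t \<Longrightarrow> t \<le> T \<Longrightarrow> u (y, t) - \<theta> t \<le> Q"
      and x1: "x1 \<in> \<Omega>" "norm (x1 - x0) < r / 4" "0 \<le> t1" "t1 \<le> T"
    have yc: "y \<in> closure \<Omega>" and x1c: "x1 \<in> closure \<Omega>" using y x1 closure_subset by auto
    have c\<theta>: "continuous_on S \<theta>" for S
      using \<theta>(1) by (meson DERIV_continuous continuous_at_imp_continuous_on)
    have inb: "x \<in> ball x0 r" if "norm (x - y) \<le> r / 2" for x
      using norm_triangle_ineq[of "x - y" "y - x0"] that y r by (simp add: dist_norm norm_minus_commute[of x0])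
    show "u (x1, t1) - \<theta> t1 \<le> Q + L * norm (x1 - y)"
    proof (rule ccontr)
      assume neg: "\<not> u (x1, t1) - \<theta> t1 \<le> Q + L * norm (x1 - y)"
      \<comment> \<open>At most a quarter of the excess to be refuted; the perturbations below are
        measured against it.\<close>
      define \<mu> where "\<mu> = min (1/8) ((u (x1, t1) - \<theta> t1 - Q - L * norm (x1 - y)) / 4)"
      have \<mu>: "0 < \<mu>" "\<mu> \<le> 1/8" "4 * \<mu> \<le> u (x1, t1) - \<theta> t1 - Q - L * norm (x1 - y)"
        using neg unfolding \<mu>_def by (auto simp: min_def not_le)
      have usc_w: "usc_on (closure \<Omega> \<times> {0..T}) (\<lambda>z. u z + - \<theta> (snd z))"
        by (intro usc_on_add usc_on_subset[OF usc] continuous_imp_usc_on continuous_intros continuous_on_compose2[OF c\<theta>[of UNIV]]) (auto simp: Qbar_def)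
      \<comment> \<open>Around \<open>y\<close> the function stays below \<open>Q + \<mu>\<close> at
        all times, so the maximum cannot lie there; this later keeps the penalty gradient at length
        at least \<open>L / 2\<close>.\<close>
      obtain \<epsilon>1 where \<epsilon>1: "0 < \<epsilon>1" "\<And>x t. x \<in> closure \<Omega> \<Longrightarrow> t \<in> {0..T} \<Longrightarrow> norm (x - y) < \<epsilon>1 \<Longrightarrow> u (x, t) + - \<theta> t < Q + \<mu>"
      proof (rule usc_sup_near[OF compact_closure_dom _ _ usc_w, of y "Q + \<mu>"])
        show "u (y, t) + - \<theta> (snd (y, t)) < Q + \<mu>" if "t \<in> {0..T}" for t
          using Q[of t] that \<mu> by simp
      qed (use T yc in auto)
      define \<epsilon> where "\<epsilon> = min \<epsilon>1 (\<mu> / L)"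
      have \<epsilon>: "0 < \<epsilon>" "\<epsilon> \<le> \<epsilon>1" "L * \<epsilon> \<le> \<mu>" using \<epsilon>1 \<mu> L0 by (auto simp: \<epsilon>_def min_def field_simps)
      define \<tau> where "\<tau> = g y"
      have yb: "y \<in> ball x0 r" using inb[of y] r by simp
      have \<tau>: "0 < \<tau>" "\<tau> \<le> 1" using gp(1,2)[OF yb] y by (auto simp: \<tau>_def)
      \<comment> \<open>Where \<open>x\<close> is not much closer to the boundary than
        \<open>y\<close>, this smallness makes the barrier negligible: its jump terms stay below 1
        and its gradient below \<open>L / 4\<close>.\<close>
      define b where "b = min ((\<tau> / 2) powr \<sigma> / (K2 + 1)) (L * \<tau> / (8 * G))"
      have b: "0 < b" "b \<le> (\<tau> / 2) powr \<sigma> / (K2 + 1)" "b \<le> L * \<tau> / (8 * G)"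
        using \<tau> K2 L0 r by (auto simp: b_def)
      define A where "A = min (\<mu> / 2) (b / 2)"
      have A: "0 < A" "A \<le> \<mu> / 2" "A \<le> b / 2" "A \<le> 1" using \<mu> b by (auto simp: A_def)
      \<comment> \<open>The last bound is the smallness against \<open>A powr m\<close> that
        \<open>barrier_numbers\<close> demands, so \<open>A\<close> has to be chosen first.\<close>
      define \<gamma>0 where "\<gamma>0 = min (min (\<mu> / 4) (b / 2)) (c / 8 * (A * a / 2) powr m / (K2 + 1))"
      have \<gamma>0: "0 < \<gamma>0" "\<gamma>0 \<le> \<mu> / 4" "\<gamma>0 \<le> b / 2" "\<gamma>0 \<le> c / 8 * (A * a / 2) powr m / (K2 + 1)"
      proof -
        have "0 < c / 8 * (A * a / 2) powr m / (K2 + 1)" using c A a K2 by (intro divide_pos_pos mult_pos_pos) auto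
        then show "0 < \<gamma>0" "\<gamma>0 \<le> \<mu> / 4" "\<gamma>0 \<le> b / 2" "\<gamma>0 \<le> c / 8 * (A * a / 2) powr m / (K2 + 1)"
          using \<mu>(1) b(1) unfolding \<gamma>0_def by linarith+
      qed
      have K2\<gamma>0: "K2 * \<gamma>0 \<le> c / 8 * (A * a / 2) powr m"
      proof -
        have "(K2 + 1) * \<gamma>0 \<le> c / 8 * (A * a / 2) powr m" using \<gamma>0(4) K2 by (simp add: field_simps)
        then show ?thesis using \<gamma>0(1) by (simp add: algebra_simps)
      qed
      define Z where "Z = {x \<in> \<Omega>. norm (x - y) \<le> r / 2} \<times> {0..T}"
      define M0 where "M0 z = u z - \<theta> (snd z) - L * snorm \<epsilon> (fst z - y) + A * g (fst z) powr a" for z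
      have Zg: "0 < g (fst z)" "g (fst z) \<le> 1" if "z \<in> Z" for z
        using that gp(1,2)[OF inb] by (auto simp: Z_def)
      obtain B\<theta> where B\<theta>: "\<And>t. t \<in> {0..T} \<Longrightarrow> \<bar>\<theta> t\<bar> \<le> B\<theta>"
      proof -
        have "bounded (\<theta> ` {0..T})" using compact_imp_bounded[OF compact_continuous_image[OF c\<theta> compact_Icc]] .
        then obtain B where "\<forall>x\<in>\<theta> ` {0..T}. norm x \<le> B" unfolding bounded_iff by blast
        then show thesis by (intro that[of B]) auto
      qed
      have pa: "g (fst z) powr a \<le> 1" if "z \<in> Z" for z using Zg[OF that] a by (intro powr_le1) auto
      have x1Z: "(x1, t1) \<in> Z" using x1 y norm_triangle_ineq4[of "x1 - x0" "y - x0"] by (simp add: Z_def)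
      obtain \<rho> z where \<rho>: "0 < \<rho>" "\<rho> \<le> \<gamma>0" and zZ: "z \<in> Z"
        and mx: "\<And>w. w \<in> Z \<Longrightarrow> M0 w + \<rho> * ln (g (fst w)) \<le> M0 z + \<rho> * ln (g (fst z))"
        and am: "\<And>w. w \<in> Z \<Longrightarrow> M0 w \<le> M0 z + \<gamma>0"
      proof (rule barrier_max[of Z M0 "R + B\<theta> + A" "\<lambda>z. g (fst z)" \<gamma>0])
        have csn: "continuous_on S (\<lambda>z. snorm \<epsilon> (fst z - y))" for S :: "('a \<times> real) set"
          unfolding snorm_def by (intro continuous_intros)
        have cg: "continuous_on S (\<lambda>z. g (fst z))" for S :: "('a \<times> real) set"
          by (intro continuous_on_compose2[OF gc] continuous_intros) auto
        show "continuous_on Z (\<lambda>z. g (fst z))" by (rule cg)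
        have "usc_on Z (\<lambda>z. u z + (- \<theta> (snd z) - L * snorm \<epsilon> (fst z - y) + A * g (fst z) powr a))"
          using Zg closure_subset
          by (intro usc_on_add usc_on_subset[OF usc] continuous_imp_usc_on continuous_intros csn cg continuous_on_compose2[OF c\<theta>[of UNIV]])
            (fastforce simp: Qbar_def Z_def)+
        then show "usc_on Z M0" unfolding M0_def[abs_def] by (simp add: algebra_simps)
        show "M0 w \<le> R + B\<theta> + A" if w: "w \<in> Z" for w
        proof -
          have "u w \<le> R" using R(2)[of "fst w" "snd w"] w closure_subset[of \<Omega>] by (auto simp: Z_def)
          moreover have "- \<theta> (snd w) \<le> B\<theta>" using B\<theta>[of "snd w"] w by (auto simp: Z_def)
          moreover have "0 \<le> L * snorm \<epsilon> (fst w - y)" by (intro mult_nonneg_nonneg less_imp_le snorm_pos \<epsilon>(1) L0)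
          moreover have "A * g (fst w) powr a \<le> A" using pa[OF w] A by simp
          ultimately show ?thesis unfolding M0_def by linarith
        qed
        show "compact {z \<in> Z. k \<le> g (fst z)}" if k: "0 < k" for k
        proof -
          have "{z \<in> Z. k \<le> g (fst z)} = ((closure \<Omega> \<inter> cball y (r / 2)) \<inter> {x. k \<le> g x}) \<times> {0..T}"
          proof (intro set_eqI)
            fix w :: "'a \<times> real"
            have "fst w \<in> \<Omega>" if "norm (fst w - y) \<le> r / 2" "k \<le> g (fst w)"
              using gp(1)[OF inb[OF that(1)]] that(2) k by simp
            moreover have "fst w \<in> closure \<Omega>" if "fst w \<in> \<Omega>" using that closure_subset by auto
            ultimately show "w \<in> {z \<in> Z. k \<le> g (fst z)} \<longleftrightarrow> w \<in> ((closure \<Omega> \<inter> cball y (r / 2)) \<inter> {x. k \<le> g x}) \<times> {0..T}"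
              by (cases w) (auto simp: Z_def dist_norm norm_minus_commute[of y])
          qed
          moreover have "closed {x. k \<le> g x}" using gc by (intro closed_Collect_le continuous_intros) auto
          ultimately show ?thesis
            by (metis compact_Icc compact_Int_closed compact_Times compact_closure_dom closed_cball)
        qed
      qed (use Zg x1Z \<gamma>0 in auto)
      obtain x t where zxt: "z = (x, t)" by (cases z)
      have x: "x \<in> \<Omega>" "norm (x - y) \<le> r / 2" and t: "0 \<le> t" "t \<le> T" using zZ by (auto simp: Z_def zxt)
      have xc: "x \<in> closure \<Omega>" using x closure_subset by auto
      have xb: "x \<in> ball x0 r" by (rule inb[OF x(2)])
      define s where "s = g x"
      have s: "0 < s" "s \<le> 1" using Zg[OF zZ] by (auto simp: s_def zxt)
      have up: "M0 z \<le> u (x, t) - \<theta> t - L * norm (x - y) + A"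
      proof -
        have "A * g x powr a \<le> A * 1" using pa[OF zZ] A by (intro mult_left_mono) (auto simp: zxt)
        moreover have "L * norm (x - y) \<le> L * snorm \<epsilon> (x - y)" using L0 by (intro mult_left_mono snorm_ge) auto
        ultimately show ?thesis by (simp add: M0_def zxt)
      qed
      have low1: "Q + 2 * \<mu> < M0 z"
      proof -
        have "L * snorm \<epsilon> (x1 - y) \<le> L * norm (x1 - y) + \<mu>"
          using mult_left_mono[OF snorm_le[of \<epsilon> "x1 - y"], of L] L0 \<epsilon> by (simp add: algebra_simps)
        moreover have "0 \<le> A * g x1 powr a" using A by simp
        ultimately have "Q + 3 * \<mu> \<le> M0 (x1, t1)" using \<mu>(3) by (simp add: M0_def)
        then show ?thesis using am[OF x1Z] \<gamma>0 \<mu> by linarith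
      qed
      have far: "\<epsilon>1 \<le> norm (x - y)"
      proof (rule ccontr)
        assume "\<not> \<epsilon>1 \<le> norm (x - y)"
        then have "u (x, t) - \<theta> t < Q + \<mu>" using \<epsilon>1(2)[OF xc, of t] t by simp
        moreover have "0 \<le> L * norm (x - y)" using L0 by simp
        ultimately show False using up low1 A \<mu> by linarith
      qed
      \<comment> \<open>The competitor \<open>(y, s0)\<close> bounds both the distance from
        \<open>x\<close> to \<open>y\<close> and the value of \<open>\<theta>\<close> at the
        maximum.\<close>
      have low2: "u (y, s0) - \<theta> s0 - 1 / 2 \<le> M0 z"
      proof -
        have "(y, s0) \<in> Z" using y s0 r by (simp add: Z_def)
        moreover have "L * snorm \<epsilon> (y - y) \<le> \<mu>"
        proof -
          have "L * snorm \<epsilon> (y - y) \<le> L * \<epsilon>" using L0 snorm_le[of \<epsilon> "y - y"] \<epsilon> by (intro mult_left_mono) auto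
          then show ?thesis using \<epsilon>(3) by linarith
        qed
        moreover have "0 \<le> A * g y powr a" using A by simp
        ultimately show ?thesis using am[of "(y, s0)"] \<gamma>0 \<mu> by (simp add: M0_def)
      qed
      have uR: "u (x, t) \<le> R" "- R \<le> u (y, s0)" using R(2)[OF xc t] R(2)[OF yc s0(1,2)] by auto
      have xy: "norm (x - y) < r / 4"
      proof -
        have "L * norm (x - y) < L * (r / 4)" using up low2 uR s0(3)[OF t] Lr A \<mu> by linarith
        then show ?thesis using L0 by simp
      qed
      have "\<theta> t < \<theta> s0 + 2 * R + 2"
      proof -
        have "0 \<le> L * norm (x - y)" using L0 by simp
        then show ?thesis using up low2 uR A \<mu> by linarith
      qed
      then have t': "0 < t" "t < T" using t s0(4,5) by (auto simp: less_le)
      define Y where "Y = A * (a * s powr (a - 1)) + \<rho> / s"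
      have Y0: "0 \<le> Y" using A a s \<rho> by (simp add: Y_def)
      let ?q = "(L / snorm \<epsilon> (x - y)) *\<^sub>R (x - y)"
      let ?p = "?q - Y *\<^sub>R Dg x"
      have key: "\<theta>' t + H x (u (x, t)) ?p - f (x, t) \<le> K1 * L powr \<sigma> + K2 * (A * s powr (a - \<sigma>) + \<gamma>0 * s powr (- \<sigma>))"
        unfolding K1_def K2_def
      proof (rule lipschitz_touch[OF sub lb patch R \<theta>(1,2) y(2) x(1) xy t' \<epsilon>(1) L0 Linv A(1) a \<rho> s_def Y_def])
        fix x' t' assume "x' \<in> \<Omega>" "norm (x' - y) \<le> r / 2" "0 \<le> t'" "t' \<le> T"
        then show "u (x', t') - \<theta> t' - L * snorm \<epsilon> (x' - y) + (A * g x' powr a + \<rho> * ln (g x'))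
          \<le> u (x, t) - \<theta> t - L * snorm \<epsilon> (x - y) + (A * g x powr a + \<rho> * ln (g x))"
          using mx[of "(x', t')"] by (simp add: Z_def M0_def zxt)
      next
        fix x' assume "x' \<in> \<Omega>" "norm (x' - y) \<le> r / 2"
        then show "u (x', t) - \<theta> t - L * snorm \<epsilon> (x' - y) + A * g x' powr a
          \<le> u (x, t) - \<theta> t - L * snorm \<epsilon> (x - y) + A * g x powr a + \<gamma>0"
          using am[of "(x', t)"] t by (simp add: Z_def M0_def zxt)
      qed
      have main: "c * norm ?p powr m \<le> C3 + K1 * L powr \<sigma> + K2 * (A * s powr (a - \<sigma>) + \<gamma>0 * s powr (- \<sigma>))"
      proof -
        have "\<bar>u (x, t)\<bar> \<le> R" by (rule R(2)[OF xc t])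
        from CR[OF xc this] have "c * norm ?p powr m - CR \<le> H x (u (x, t)) ?p" .
        then show ?thesis using key F(2)[OF xc t] \<theta>(3)[OF t] unfolding C3_def by linarith
      qed
      have p0: "L / 2 \<le> norm ?q" "norm ?q \<le> L"
      proof -
        have sp: "0 < snorm \<epsilon> (x - y)" by (rule snorm_pos[OF \<epsilon>(1)])
        have n: "norm ?q = L * (norm (x - y) / snorm \<epsilon> (x - y))" using L0 sp by simp
        have "snorm \<epsilon> (x - y) \<le> 2 * norm (x - y)" using snorm_le[of \<epsilon> "x - y"] \<epsilon> far by linarith
        then have "1 / 2 \<le> norm (x - y) / snorm \<epsilon> (x - y)" using sp by (simp add: field_simps)
        from mult_left_mono[OF this, of L] show "L / 2 \<le> norm ?q" unfolding n using L0 by simp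
        have "norm (x - y) / snorm \<epsilon> (x - y) \<le> 1" using sp snorm_ge[of "x - y" \<epsilon>] by simp
        from mult_left_mono[OF this, of L] show "norm ?q \<le> L" unfolding n using L0 by simp
      qed
      \<comment> \<open>Either \<open>x\<close> is much closer to the boundary than
        \<open>y\<close>, and penalty and barrier gradients cannot cancel, or the barrier is
        negligible.\<close>
      show False
      proof (cases "s \<le> \<tau> / 2")
        case True
        have "1 \<le> norm (Dg x) \<and> Dg x \<bullet> (x - y) \<le> norm (x - y) / 8"
          using gp(4)[OF xb yb x(1) y(1)] True by (simp add: s_def \<tau>_def)
        then have n1: "1 \<le> norm (Dg x)" and n2: "Dg x \<bullet> ?q \<le> norm ?q / 8"
          using L0 snorm_pos[OF \<epsilon>(1), of "x - y"] mult_left_mono[of "Dg x \<bullet> (x - y)" "norm (x - y) / 8" "L / snorm \<epsilon> (x - y)"]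
          by (auto simp: divide_simps)
        note gl = gradient_lower_bound[OF n1 n2 Y0]
        have "(L / 4) powr m \<le> norm ?p powr m" "(Y / 2) powr m \<le> norm ?p powr m"
        proof -
          have "L / 4 \<le> norm ?p" "Y / 2 \<le> norm ?p" using gl p0(1) by linarith+
          then show "(L / 4) powr m \<le> norm ?p powr m" "(Y / 2) powr m \<le> norm ?p powr m"
            using L0 Y0 m sigma_pos by (intro powr_mono2; simp)+
        qed
        then have "c / 2 * (L / 4) powr m + c / 2 * (Y / 2) powr m \<le> c / 2 * norm ?p powr m + c / 2 * norm ?p powr m"
          using c by (intro add_mono mult_left_mono) auto
        moreover have "K2 * (A * s powr (a - \<sigma>) + \<gamma>0 * s powr (- \<sigma>)) \<le> 2 * (c / 8) * (Y / 2) powr m + C4"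
          by (rule barrier_numbers[OF sigma_pos sigma_less m a_def s A(1,4) _ _ K2 K2\<gamma>0 C4(2)])
            (use \<rho> s c in \<open>auto simp: Y_def\<close>)
        moreover have "0 \<le> c * (Y / 2) powr m" using c by simp
        ultimately show False using main L(1) L4 by linarith
      next
        case False
        have Kb: "(K2 + 1) * (A + \<gamma>0) \<le> (\<tau> / 2) powr \<sigma>"
        proof -
          have "(K2 + 1) * (A + \<gamma>0) \<le> (K2 + 1) * b" using A \<gamma>0 K2 by (intro mult_left_mono) auto
          also have "\<dots> \<le> (\<tau> / 2) powr \<sigma>" using b(2) K2 by (simp add: field_simps)
          finally show ?thesis .
        qed
        have "s powr (a - \<sigma>) \<le> s powr (- \<sigma>)" using s a by (intro powr_mono') auto
        then have "A * s powr (a - \<sigma>) + \<gamma>0 * s powr (- \<sigma>) \<le> (A + \<gamma>0) * s powr (- \<sigma>)"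
          using A by (simp add: distrib_right mult_left_mono)
        also have "\<dots> \<le> (A + \<gamma>0) * (\<tau> / 2) powr (- \<sigma>)"
          using False \<tau> A \<gamma>0 sigma_pos by (intro mult_left_mono powr_mono2') auto
        finally have "K2 * (A * s powr (a - \<sigma>) + \<gamma>0 * s powr (- \<sigma>)) \<le> K2 * ((A + \<gamma>0) * (\<tau> / 2) powr (- \<sigma>))"
          using K2 by (rule mult_left_mono)
        also have "\<dots> \<le> ((K2 + 1) * (A + \<gamma>0)) * (\<tau> / 2) powr (- \<sigma>)"
          using A \<gamma>0 by (simp add: algebra_simps)
        also have "\<dots> \<le> (\<tau> / 2) powr \<sigma> * (\<tau> / 2) powr (- \<sigma>)" using Kb by (intro mult_right_mono) auto
        also have "\<dots> = 1" using \<tau> by (simp add: powr_add[symmetric])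
        finally have K21: "K2 * (A * s powr (a - \<sigma>) + \<gamma>0 * s powr (- \<sigma>)) \<le> 1" .
        have "s powr (a - 1) = s powr a / s" using s by (simp add: powr_diff)
        moreover have "s powr a \<le> 1" using s a by (intro powr_le1) auto
        ultimately have "A * (a * s powr (a - 1)) \<le> A * (1 * (1 / s))"
          using A a s by (intro mult_left_mono mult_mono) (auto intro: divide_right_mono)
        then have "Y \<le> (A + \<rho>) / s" by (simp add: Y_def add_divide_distrib)
        also have "\<dots> \<le> b / (\<tau> / 2)" using A \<gamma>0 \<rho> False \<tau> by (intro frac_le) auto
        also have "\<dots> \<le> (L * \<tau> / (8 * G)) / (\<tau> / 2)" using b \<tau> by (intro divide_right_mono) auto
        also have "\<dots> = L / (4 * G)" using \<tau> by simp
        finally have YL: "Y \<le> L / (4 * G)" .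
        have "norm (Y *\<^sub>R Dg x) = Y * norm (Dg x)" using Y0 by simp
        also have "\<dots> \<le> (L / (4 * G)) * G" using YL gp(3)[OF xb] Y0 L0 r by (intro mult_mono) auto
        also have "\<dots> = L / 4" using r by simp
        finally have "L / 4 \<le> norm ?p" using p0(1) norm_triangle_ineq2[of ?q "Y *\<^sub>R Dg x"] by linarith
        then have "(L / 4) powr m \<le> norm ?p powr m" using L0 m sigma_pos by (intro powr_mono2) auto
        then have "c * (L / 4) powr m \<le> c * norm ?p powr m" using c by simp
        moreover have "0 \<le> c * (L / 4) powr m" using c by simp
        ultimately show False using main K21 L(1) L4 C4(1) by linarith
      qed
    qed
  qed
qed

end

section \<open>Upper limits near the diagonal, and differences of nonlocal terms\<close>

text \<open>The set where \<open>w\<close> is at least \<open>\<mu>\<close> is compact and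
  \<open>h\<close> is positive on it, hence bounded away from 0.\<close>

lemma usc_less_near_zero_set:
  fixes w h :: "'b::metric_space \<Rightarrow> real"
  assumes X: "compact X" and w: "usc_on X w" and h: "continuous_on X h" "\<And>z. z \<in> X \<Longrightarrow> 0 \<le> h z"
    and zero: "\<And>z. z \<in> X \<Longrightarrow> h z = 0 \<Longrightarrow> w z < \<mu>"
  obtains r where "0 < r" "\<And>z. z \<in> X \<Longrightarrow> h z \<le> r \<Longrightarrow> w z < \<mu>"
proof -
  define A where "A = X - {z \<in> X. w z < \<mu>}"
  have "closedin (top_of_set X) A"
    unfolding A_def using usc_on_openin[OF w, of \<mu>] by (simp add: openin_closedin_eq)
  then have A: "compact A" by (rule closedin_compact[OF X])
  show thesis
  proof (cases "A = {}")
    case True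
    then show thesis by (intro that[of 1]) (auto simp: A_def)
  next
    case False
    have "continuous_on A h" using h(1) by (rule continuous_on_subset) (auto simp: A_def)
    from continuous_attains_inf[OF A False this] obtain z where z: "z \<in> A" "\<And>w. w \<in> A \<Longrightarrow> h z \<le> h w" by blast
    have "0 < h z" using z(1) zero[of z] h(2)[of z] by (fastforce simp: A_def less_le)
    show thesis
    proof (rule that[of "h z / 2"])
      fix w' assume w': "w' \<in> X" "h w' \<le> h z / 2"
      show "w w' < \<mu>"
      proof (rule ccontr)
        assume "\<not> w w' < \<mu>"
        then have "w' \<in> A" using w' by (simp add: A_def)
        then show False using z(2)[of w'] w' \<open>0 < h z\<close> by linarith
      qed
    qed (use \<open>0 < h z\<close> in simp)
  qed
qed

text \<open>\<open>M\<close> is the upper limit of \<open>V\<close> as \<open>h\<close> tends to \<open>0\<close>. It replaces the maximum of the upper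
  semicontinuous envelope, so that the envelope is not needed.\<close>

lemma limsup_cluster:
  fixes V h :: "'b::metric_space \<Rightarrow> real"
  assumes B: "\<And>z. z \<in> X \<Longrightarrow> V z \<le> B" and m0: "\<And>\<rho>. 0 < \<rho> \<Longrightarrow> \<exists>z\<in>X. h z \<le> \<rho> \<and> m0 \<le> V z"
    and K: "compact K" "X \<subseteq> K"
  obtains M z where "m0 \<le> M" "\<And>\<mu>. 0 < \<mu> \<Longrightarrow> \<exists>\<rho>>0. \<forall>z\<in>X. h z \<le> \<rho> \<longrightarrow> V z \<le> M + \<mu>" "z \<in> K"
    "\<And>\<rho>. 0 < \<rho> \<Longrightarrow> \<exists>w\<in>X. h w \<le> \<rho> \<and> M - \<rho> \<le> V w \<and> dist w z \<le> \<rho>"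
proof -
  define U where "U = {b. \<exists>\<rho>>0. \<forall>z\<in>X. h z \<le> \<rho> \<longrightarrow> V z \<le> b}"
  define M where "M = Inf U"
  have "B \<in> U" unfolding U_def using B by (intro CollectI exI[of _ "1::real"]) auto
  then have ne: "U \<noteq> {}" by auto
  have lb: "m0 \<le> b" if "b \<in> U" for b using that m0 by (fastforce simp: U_def)
  have bdd: "bdd_below U" by (rule bdd_belowI[of U m0]) (rule lb)
  have 1: "m0 \<le> M" unfolding M_def using ne lb by (rule cInf_greatest)
  have 2: "\<exists>\<rho>>0. \<forall>z\<in>X. h z \<le> \<rho> \<longrightarrow> V z \<le> M + \<mu>" if "0 < \<mu>" for \<mu>
  proof -
    have "Inf U < M + \<mu>" using that by (simp add: M_def)
    then obtain b where "b \<in> U" "b < M + \<mu>" using cInf_less_iff[OF ne bdd] by auto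
    then show ?thesis unfolding U_def by fastforce
  qed
  have 3: "\<exists>z\<in>X. h z \<le> \<rho> \<and> M - \<rho> \<le> V z" if "0 < \<rho>" for \<rho>
  proof (rule ccontr)
    assume "\<not> ?thesis"
    then have "M - \<rho> \<in> U" using that by (auto simp: U_def intro!: exI[of _ \<rho>])
    then have "M \<le> M - \<rho>" unfolding M_def using bdd by (rule cInf_lower)
    then show False using that by simp
  qed
  have "\<forall>n::nat. \<exists>z\<in>X. h z \<le> 1 / (real n + 1) \<and> M - 1 / (real n + 1) \<le> V z"
    by (intro allI 3) simp
  then obtain Z where Z: "\<And>n. Z n \<in> X" "\<And>n. h (Z n) \<le> 1 / (real n + 1)" "\<And>n. M - 1 / (real n + 1) \<le> V (Z n)"
    by metis
  have "\<forall>n. Z n \<in> K" using Z(1) K(2) by auto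
  then obtain z q where z: "z \<in> K" "strict_mono q" "(Z \<circ> q) \<longlonglongrightarrow> z"
    using K(1) unfolding compact_def by metis
  have "\<exists>w\<in>X. h w \<le> \<rho> \<and> M - \<rho> \<le> V w \<and> dist w z \<le> \<rho>" if "0 < \<rho>" for \<rho>
  proof -
    have "\<forall>\<^sub>F n in sequentially. dist ((Z \<circ> q) n) z < \<rho>" using z(3) that by (rule tendstoD)
    moreover have "\<forall>\<^sub>F n::nat in sequentially. 1 / (real n + 1) < \<rho>"
    proof -
      have "(\<lambda>n. 1 / (real n + 1)) \<longlonglongrightarrow> 0" using LIMSEQ_inverse_real_of_nat by (simp add: inverse_eq_divide add.commute)
      then show ?thesis using that by (rule order_tendstoD)
    qed
    ultimately have "\<forall>\<^sub>F n in sequentially. dist ((Z \<circ> q) n) z < \<rho> \<and> 1 / (real n + 1) < \<rho>" by eventually_elim simp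
    then obtain n where n: "dist (Z (q n)) z < \<rho>" "1 / (real n + 1) < \<rho>"
      using eventually_happens[of _ sequentially] by force
    have "1 / (real (q n) + 1) \<le> 1 / (real n + 1)"
      using seq_suble[OF z(2), of n] by (intro divide_left_mono) auto
    then have "h (Z (q n)) \<le> \<rho>" "M - \<rho> \<le> V (Z (q n))" using Z(2,3)[of "q n"] n(2) by linarith+
    then show ?thesis using Z(1) n(1) by (intro bexI[of _ "Z (q n)"]) auto
  qed
  then show thesis using 1 2 z(1) by (rule that[rotated -1])
qed

context levy_setting begin

lemma increment_bound:
  assumes "x \<in> closure \<Omega>" "\<And>y. y \<in> closure \<Omega> \<Longrightarrow> \<bar>w y\<bar> \<le> R"
  shows "\<bar>increment \<Omega> w x z\<bar> \<le> 2 * R"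
proof (cases "x + z \<in> closure \<Omega>")
  case True
  then show ?thesis using assms(2)[OF assms(1)] assms(2)[OF True] by (simp add: increment_def)
next
  case False
  have "0 \<le> R" using assms abs_ge_zero order_trans by blast
  then show ?thesis using False by (simp add: increment_def)
qed

text \<open>The first landing condition in \<open>le\<close> holds almost everywhere for the measure
  at the interior point \<open>x\<close>, by \<open>AE_interior\<close>. The second is known for the
  measure at \<open>y\<close> only; this is the situation for which
  \<open>integral_diff_close_measures\<close> has the set \<open>B\<close>.\<close>

lemma nonlocal_op_diff_le:
  assumes x: "x \<in> \<Omega>" and y: "y \<in> closure \<Omega>" and \<delta>: "0 < \<delta>"
    and w1: "usc_on (closure \<Omega>) w1" "\<And>y. y \<in> closure \<Omega> \<Longrightarrow> \<bar>w1 y\<bar> \<le> R"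
    and w2: "usc_on (closure \<Omega>) (\<lambda>y. - w2 y)" "\<And>y. y \<in> closure \<Omega> \<Longrightarrow> \<bar>w2 y\<bar> \<le> R"
    and tv: "\<And>S. S \<in> sets borel \<Longrightarrow> S \<subseteq> - ball 0 \<delta> \<Longrightarrow> \<bar>measure (\<nu> x) S - measure (\<nu> y) S\<bar> \<le> \<mu>"
    and le: "\<And>z. x + z \<in> \<Omega> \<Longrightarrow> y + z \<in> closure \<Omega> \<Longrightarrow> w1 (x + z) - w1 x \<le> w2 (y + z) - w2 y + \<kappa>"
    and \<kappa>: "0 \<le> \<kappa>"
  shows "nonlocal_op \<Omega> \<nu> (- ball 0 \<delta>) w1 x - nonlocal_op \<Omega> \<nu> (- ball 0 \<delta>) w2 y \<le> \<kappa> * (C1 * \<delta> powr (- \<sigma>)) + 3 * (2 * R) * \<mu>"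
proof -
  let ?D = "- ball (0::'a) \<delta>"
  define M where "M = restrict_space (\<nu> x) ?D"
  define N where "N = restrict_space (\<nu> y) ?D"
  have xc: "x \<in> closure \<Omega>" using x closure_subset by auto
  have D: "?D \<inter> space (\<nu> x) \<in> sets (\<nu> x)" "?D \<inter> space (\<nu> y) \<in> sets (\<nu> y)"
    using sets_nu xc y by auto
  have sM: "sets N = sets M" unfolding M_def N_def by (simp add: sets_restrict_space sets_nu xc y)
  have fin: "finite_measure M" "finite_measure N" unfolding M_def N_def
    using finite_restrict xc y \<delta> by auto
  have mM: "borel_measurable borel \<subseteq> (borel_measurable M :: ('a \<Rightarrow> real) set)"
  proof
    fix k :: "'a \<Rightarrow> real" assume "k \<in> borel_measurable borel"
    then have "k \<in> borel_measurable (\<nu> x)" by (simp add: measurable_cong_sets[OF sets_nu[OF xc] refl])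
    then show "k \<in> borel_measurable M" unfolding M_def by (rule measurable_restrict_space1)
  qed
  have i1: "increment \<Omega> w1 x \<in> borel_measurable borel" by (rule increment_measurable[OF w1(1)])
  have "increment \<Omega> w2 y = (\<lambda>z. - increment \<Omega> (\<lambda>y. - w2 y) y z)" by (auto simp: increment_def)
  then have i2: "increment \<Omega> w2 y \<in> borel_measurable borel" using increment_measurable[OF w2(1), of y] by simp
  have "closed {z. y + z \<in> closure \<Omega>}"
    using continuous_closed_vimage[of "closure \<Omega>" "\<lambda>z. y + z"] by (auto simp: vimage_def)
  then have Cb: "{z. y + z \<in> closure \<Omega>} \<in> sets borel" by simp
  define B where "B = {z \<in> ?D. y + z \<in> closure \<Omega>}"
  have "(\<integral>z. increment \<Omega> w1 x z \<partial>M) - (\<integral>z. increment \<Omega> w2 y z \<partial>N) \<le> \<kappa> * measure M (space M) + 3 * (2 * R) * \<mu>"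
  proof (rule integral_diff_close_measures[OF fin sM _ _ _ _ _ _ _ _ \<kappa>, where B=B])
    fix X assume "X \<in> sets M"
    then have X: "X \<in> sets borel" "X \<subseteq> ?D" unfolding M_def using sets_nu[OF xc] D(1) by (auto simp: sets_restrict_space_iff)
    have "measure M X = measure (\<nu> x) X" "measure N X = measure (\<nu> y) X"
      unfolding M_def N_def using X by (auto simp: measure_restrict_space sets_nu xc y)
    then show "\<bar>measure M X - measure N X\<bar> \<le> \<mu>" using tv[OF X] by simp
  next
    show "increment \<Omega> w1 x \<in> borel_measurable M" "increment \<Omega> w2 y \<in> borel_measurable M" using i1 i2 mM by auto
    show "\<bar>increment \<Omega> w1 x z\<bar> \<le> 2 * R" "\<bar>increment \<Omega> w2 y z\<bar> \<le> 2 * R" for z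
      using increment_bound[OF xc w1(2)] increment_bound[OF y w2(2)] by auto
    show "B \<in> sets M" unfolding M_def B_def using Cb sets_nu[OF xc] by (auto simp: sets_restrict_space)
    show "AE z in N. z \<in> B" unfolding N_def
      using AE_closure[OF y] by (subst AE_restrict_space_iff[OF D(2)]) (auto simp: B_def elim: eventually_mono)
    have "AE z in \<nu> x. z \<in> ?D \<longrightarrow> (z \<in> B \<longrightarrow> increment \<Omega> w1 x z \<le> increment \<Omega> w2 y z + \<kappa>)"
      using AE_interior[OF x]
    proof (eventually_elim, intro impI)
      fix z assume z: "z \<noteq> 0 \<longrightarrow> x + z \<in> \<Omega>" "z \<in> ?D" "z \<in> B"
      then have "x + z \<in> \<Omega>" "x + z \<in> closure \<Omega>" using \<delta> closure_subset by auto
      then show "increment \<Omega> w1 x z \<le> increment \<Omega> w2 y z + \<kappa>"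
        using z(3) le[of z] by (simp add: B_def increment_def)
    qed
    then show "AE z in M. z \<in> B \<longrightarrow> increment \<Omega> w1 x z \<le> increment \<Omega> w2 y z + \<kappa>"
      unfolding M_def by (subst AE_restrict_space_iff[OF D(1)])
  qed
  moreover have "measure M (space M) \<le> C1 * \<delta> powr (- \<sigma>)"
    using measure_tail(2)[OF xc \<delta>, of ?D] unfolding M_def by (simp add: measure_restrict_space space_restrict_space sets_nu[OF xc] xc)
  then have "\<kappa> * measure M (space M) \<le> \<kappa> * (C1 * \<delta> powr (- \<sigma>))" using \<kappa> by (rule mult_left_mono)
  moreover have "nonlocal_op \<Omega> \<nu> ?D w1 x = (\<integral>z. increment \<Omega> w1 x z \<partial>M)" "nonlocal_op \<Omega> \<nu> ?D w2 y = (\<integral>z. increment \<Omega> w2 y z \<partial>N)"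
    unfolding nonlocal_op_increment M_def N_def using D by (simp_all add: integral_restrict_space)
  ultimately show ?thesis by linarith
qed

end

section \<open>The data of the comparison and their parabolic boundary\<close>

locale comparison_problem = levy_setting \<Omega> \<nu> \<sigma> C1 C2
  for \<Omega> :: "'a::euclidean_space set" and \<nu> :: "'a \<Rightarrow> 'a measure" and \<sigma> C1 C2 :: real +
  fixes m :: real and H :: "'a \<Rightarrow> real \<Rightarrow> 'a \<Rightarrow> real" and f \<phi> u v :: "'a \<times> real \<Rightarrow> real" and u0 :: "'a \<Rightarrow> real"
  assumes H_cont: "continuous_on (closure \<Omega> \<times> UNIV \<times> UNIV) (\<lambda>(x, r, p). H x r p)"
    and H1: "assm_H1 \<Omega> H" and H2: "assm_H2 m \<Omega> H" and m_gt: "\<sigma> < m"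
    and f_cont: "continuous_on (Qbar \<Omega>) f" and \<phi>_cont: "continuous_on (frontier \<Omega> \<times> {0..}) \<phi>"
    and u0_cont: "continuous_on (closure \<Omega>) u0" and compat: "\<And>x. x \<in> frontier \<Omega> \<Longrightarrow> u0 x = \<phi> (x, 0)"
    and sub: "visc_subsolution \<Omega> \<nu> H f \<phi> u0 u" and super: "visc_supersolution \<Omega> \<nu> H f \<phi> u0 v"
    and lb_u: "locally_bounded_on (Qbar \<Omega>) u" and lb_v: "locally_bounded_on (Qbar \<Omega>) v"
begin

lemma usc_u: "usc_on (Qbar \<Omega>) u"
  using sub by (simp add: visc_subsolution_def)

lemma usc_minus_v: "usc_on (Qbar \<Omega>) (\<lambda>z. - v z)"
  using super by (auto simp: visc_supersolution_def intro: lsc_imp_usc_on_minus)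

lemma H_compact: "compact (closure \<Omega> \<times> {- R..(R::real)} \<times> cball (0::'a) P)"
  by (intro compact_Times compact_closure_dom) auto

lemma H_bounded: "\<exists>C. \<forall>x\<in>closure \<Omega>. \<forall>r p. \<bar>r\<bar> \<le> R \<longrightarrow> norm p \<le> P \<longrightarrow> \<bar>H x r p\<bar> \<le> C"
proof -
  have "continuous_on (closure \<Omega> \<times> {- R..R} \<times> cball 0 P) (\<lambda>(x, r, p). H x r p)"
    by (rule continuous_on_subset[OF H_cont]) auto
  from compact_imp_bounded[OF compact_continuous_image[OF this H_compact]]
  obtain C where "\<forall>z\<in>closure \<Omega> \<times> {- R..R} \<times> cball 0 P. norm ((\<lambda>(x, r, p). H x r p) z) \<le> C"
    by (auto simp: bounded_iff)
  then show ?thesis by (intro exI[of _ C]) (auto simp: abs_le_iff)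
qed

lemma H_uniform:
  assumes "0 < \<kappa>"
  obtains \<xi> where "0 < \<xi>" "\<And>x y r (p::'a) q. x \<in> closure \<Omega> \<Longrightarrow> y \<in> closure \<Omega> \<Longrightarrow> \<bar>r\<bar> \<le> R \<Longrightarrow> norm p \<le> P \<Longrightarrow> norm q \<le> P \<Longrightarrow>
    norm (x - y) < \<xi> \<Longrightarrow> norm (p - q) < \<xi> \<Longrightarrow> \<bar>H x r p - H y r q\<bar> \<le> \<kappa>"
proof -
  have "continuous_on (closure \<Omega> \<times> {- R..R} \<times> cball 0 P) (\<lambda>(x, r, p). H x r p)"
    by (rule continuous_on_subset[OF H_cont]) auto
  from compact_uniformly_continuous[OF this H_compact] assms
  obtain d where d: "0 < d" "\<And>z z'. z \<in> closure \<Omega> \<times> {- R..R} \<times> cball 0 P \<Longrightarrow> z' \<in> closure \<Omega> \<times> {- R..R} \<times> cball 0 P \<Longrightarrow>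
      dist z' z < d \<Longrightarrow> dist ((\<lambda>(x, r, p). H x r p) z') ((\<lambda>(x, r, p). H x r p) z) < \<kappa>"
    unfolding uniformly_continuous_on_def by metis
  show thesis
  proof (rule that[of "d / 2"])
    fix x y r and p q :: 'a assume a: "x \<in> closure \<Omega>" "y \<in> closure \<Omega>" "\<bar>r\<bar> \<le> R" "norm p \<le> P" "norm q \<le> P"
      "norm (x - y) < d / 2" "norm (p - q) < d / 2"
    have "norm (x - y, 0::real, p - q) \<le> norm (x - y) + norm (p - q)"
      using norm_Pair_le[of "x - y" "(0::real, p - q)"] by (simp add: norm_Pair)
    then have "dist (x, r, p) (y, r, q) < d" using a by (simp add: dist_norm)
    moreover have "r \<in> {- R..R}" using a(3) by auto
    ultimately show "\<bar>H x r p - H y r q\<bar> \<le> \<kappa>"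
      using d(2)[of "(y, r, q)" "(x, r, p)"] a by (simp add: dist_real_def)
  qed (use d in simp)
qed

lemma f_uniform:
  assumes "0 < \<kappa>"
  obtains \<xi> where "0 < \<xi>" "\<And>x y t s. x \<in> closure \<Omega> \<Longrightarrow> y \<in> closure \<Omega> \<Longrightarrow> t \<in> {0..T} \<Longrightarrow> s \<in> {0..T} \<Longrightarrow>
    norm (x - y) < \<xi> \<Longrightarrow> \<bar>t - s\<bar> < \<xi> \<Longrightarrow> \<bar>f (x, t) - f (y, s)\<bar> \<le> \<kappa>"
proof -
  have "continuous_on (closure \<Omega> \<times> {0..T}) f"
    by (rule continuous_on_subset[OF f_cont]) (auto simp: Qbar_def)
  from compact_uniformly_continuous[OF this compact_Times[OF compact_closure_dom compact_Icc]] assms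
  obtain d where d: "0 < d" "\<And>z z'. z \<in> closure \<Omega> \<times> {0..T} \<Longrightarrow> z' \<in> closure \<Omega> \<times> {0..T} \<Longrightarrow>
      dist z' z < d \<Longrightarrow> dist (f z') (f z) < \<kappa>"
    unfolding uniformly_continuous_on_def by metis
  show thesis
  proof (rule that[of "d / 2"])
    fix x y t s assume a: "x \<in> closure \<Omega>" "y \<in> closure \<Omega>" "t \<in> {0..T}" "s \<in> {0..T}"
      "norm (x - y) < d / 2" "\<bar>t - s\<bar> < d / 2"
    have "dist (x, t) (y, s) < d" using a norm_Pair_le[of "x - y" "t - s"] by (simp add: dist_norm)
    then show "\<bar>f (x, t) - f (y, s)\<bar> \<le> \<kappa>"
      using d(2)[of "(y, s)" "(x, t)"] a by (simp add: dist_real_def)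
  qed (use d in simp)
qed

lemma u_initial: "x \<in> closure \<Omega> \<Longrightarrow> u (x, 0) \<le> u0 x"
proof (rule initial_le[OF sub lb_u f_cont \<phi>_cont u0_cont compat])
  show "\<exists>C. \<forall>x\<in>closure \<Omega>. \<forall>r p. \<bar>r\<bar> \<le> R \<longrightarrow> norm p \<le> P \<longrightarrow> - C \<le> H x r p" for R P
    using H_bounded[of R P] by (meson abs_le_D2 minus_le_iff)
qed

lemma v_initial:
  assumes "x \<in> closure \<Omega>"
  shows "u0 x \<le> v (x, 0)"
proof -
  have "- v (x, 0) \<le> - u0 x"
  proof (rule initial_le[OF visc_super_minus[OF super], where ?x0.0=x])
    show "locally_bounded_on (Qbar \<Omega>) (\<lambda>z. - v z)" using lb_v by (auto simp: locally_bounded_on_def bounded_iff)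
    show "\<exists>C. \<forall>x\<in>closure \<Omega>. \<forall>r p. \<bar>r\<bar> \<le> R \<longrightarrow> norm p \<le> P \<longrightarrow> - C \<le> - H x (- r) (- p)" for R P
    proof -
      obtain C where "\<forall>x\<in>closure \<Omega>. \<forall>r p. \<bar>r\<bar> \<le> R \<longrightarrow> norm p \<le> P \<longrightarrow> \<bar>H x r p\<bar> \<le> C" using H_bounded by blast
      then show ?thesis by (intro exI[of _ C]) (auto simp: abs_le_iff)
    qed
  qed (use assms compat in \<open>auto intro!: continuous_intros f_cont \<phi>_cont u0_cont\<close>)
  then show ?thesis by simp
qed

lemma u_boundary:
  assumes "x \<in> frontier \<Omega>" "0 \<le> t"
  shows "u (x, t) \<le> \<phi> (x, t)"
proof (cases "t = 0")
  case True
  have "x \<in> closure \<Omega>" using assms by (simp add: frontier_def)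
  then show ?thesis using u_initial[of x] compat[OF assms(1)] True by simp
next
  case False
  then show ?thesis using lateral_le[OF sub lb_u f_cont \<phi>_cont H2 m_gt] assms by (simp add: lateral_def)
qed

text \<open>At coinciding points the difference is at most 0 by \<open>u_initial\<close>,
  \<open>v_initial\<close> and \<open>u_boundary\<close>, and compactness spreads this to nearby
  pairs. The contrapositive is what counts: across a positive gap both times are away from 0, and at
  a boundary point \<open>v < \<phi>\<close>, so that the equation for \<open>v\<close> is in
  force.\<close>

lemma near_parabolic_boundary:
  assumes T: "0 \<le> T" and \<mu>: "0 < \<mu>"
  obtains r where "0 < r"
    "\<And>x t y s. x \<in> closure \<Omega> \<Longrightarrow> y \<in> closure \<Omega> \<Longrightarrow> t \<in> {0..T} \<Longrightarrow> s \<in> {0..T} \<Longrightarrow> norm (x - y) \<le> r \<Longrightarrow> \<bar>t - s\<bar> \<le> r \<Longrightarrow>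
       t \<le> r \<or> s \<le> r \<or> (y \<in> frontier \<Omega> \<and> \<phi> (y, s) \<le> v (y, s)) \<Longrightarrow> u (x, t) - v (y, s) < \<mu>"
proof -
  let ?Q = "closure \<Omega> \<times> {0..T}"
  let ?h = "\<lambda>z. norm (fst (fst z) - fst (snd z)) + \<bar>snd (fst z) - snd (snd z)\<bar> :: real"
  have cQ: "compact ?Q" "compact (frontier \<Omega> \<times> {0..T})"
    using compact_Times compact_closure_dom compact_frontier_dom by blast+
  have fc: "frontier \<Omega> \<subseteq> closure \<Omega>" by (simp add: frontier_def)
  obtain r1 where r1: "0 < r1" "\<And>z. z \<in> ?Q \<times> ?Q \<Longrightarrow> ?h z + min (snd (fst z)) (snd (snd z)) \<le> r1 \<Longrightarrow> u (fst z) + - v (snd z) < \<mu>"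
  proof (rule usc_less_near_zero_set[OF compact_Times[OF cQ(1) cQ(1)]])
    show "usc_on (?Q \<times> ?Q) (\<lambda>z. u (fst z) + - v (snd z))"
      by (intro usc_on_add usc_on_compose[OF usc_u] usc_on_compose[OF usc_minus_v]) (auto simp: Qbar_def intro!: continuous_intros)
    show "continuous_on (?Q \<times> ?Q) (\<lambda>z. ?h z + min (snd (fst z)) (snd (snd z)))" by (intro continuous_intros)
    show "0 \<le> ?h z + min (snd (fst z)) (snd (snd z))" if "z \<in> ?Q \<times> ?Q" for z using that by (auto intro!: add_nonneg_nonneg)
    show "u (fst z) + - v (snd z) < \<mu>" if "z \<in> ?Q \<times> ?Q" "?h z + min (snd (fst z)) (snd (snd z)) = 0" for z
    proof -
      obtain x t y s where z: "z = ((x, t), (y, s))" by (metis surj_pair)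
      have n: "0 \<le> norm (x - y)" "0 \<le> \<bar>t - s\<bar>" "0 \<le> t" "0 \<le> s" using that(1) by (auto simp: z)
      then have "0 \<le> min t s" by simp
      then have "norm (x - y) = 0" "\<bar>t - s\<bar> = 0" "min t s = 0" using n that(2) unfolding z fst_conv snd_conv by linarith+
      then have "x = y" "t = 0" "s = 0" by (auto simp: min_def split: if_splits)
      then show ?thesis using u_initial[of x] v_initial[of x] that(1) \<mu> by (auto simp: z)
    qed
  next
    fix r assume "0 < r" and "\<And>z. z \<in> ?Q \<times> ?Q \<Longrightarrow> ?h z + min (snd (fst z)) (snd (snd z)) \<le> r \<Longrightarrow> u (fst z) + - v (snd z) < \<mu>"
    then show thesis by (rule that)
  qed
  \<comment> \<open>The points with \<open>\<phi> \<le> v\<close> need not form a closed set, so the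
    bound is proved for \<open>u - \<phi>\<close> on the whole frontier, and \<open>v\<close> is put
    in at the end.\<close>
  obtain r2 where r2: "0 < r2" "\<And>z. z \<in> ?Q \<times> (frontier \<Omega> \<times> {0..T}) \<Longrightarrow> ?h z \<le> r2 \<Longrightarrow> u (fst z) + - \<phi> (snd z) < \<mu>"
  proof (rule usc_less_near_zero_set[OF compact_Times[OF cQ]])
    show "usc_on (?Q \<times> (frontier \<Omega> \<times> {0..T})) (\<lambda>z. u (fst z) + - \<phi> (snd z))"
      by (intro usc_on_add usc_on_compose[OF usc_u] continuous_imp_usc_on continuous_on_compose2[OF \<phi>_cont] continuous_intros) (auto simp: Qbar_def intro!: continuous_intros)
    show "continuous_on (?Q \<times> (frontier \<Omega> \<times> {0..T})) ?h" by (intro continuous_intros)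
    show "u (fst z) + - \<phi> (snd z) < \<mu>" if "z \<in> ?Q \<times> (frontier \<Omega> \<times> {0..T})" "?h z = 0" for z
    proof -
      obtain x t y s where z: "z = ((x, t), (y, s))" by (metis surj_pair)
      have n: "0 \<le> norm (x - y)" "0 \<le> \<bar>t - s\<bar>" by auto
      then have "norm (x - y) = 0" "\<bar>t - s\<bar> = 0" using that(2) unfolding z fst_conv snd_conv by linarith+
      then have "x = y" "t = s" by auto
      then show ?thesis using u_boundary[of x t] that(1) \<mu> by (auto simp: z)
    qed
    show "0 \<le> ?h z" for z :: "('a \<times> real) \<times> 'a \<times> real" by simp
  next
    fix r assume "0 < r" and "\<And>z. z \<in> ?Q \<times> (frontier \<Omega> \<times> {0..T}) \<Longrightarrow> ?h z \<le> r \<Longrightarrow> u (fst z) + - \<phi> (snd z) < \<mu>"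
    then show thesis by (rule that)
  qed
  show thesis
  proof (rule that[of "min r1 r2 / 4"])
    fix x t y s assume a: "x \<in> closure \<Omega>" "y \<in> closure \<Omega>" "t \<in> {0..T}" "s \<in> {0..T}"
      "norm (x - y) \<le> min r1 r2 / 4" "\<bar>t - s\<bar> \<le> min r1 r2 / 4"
      "t \<le> min r1 r2 / 4 \<or> s \<le> min r1 r2 / 4 \<or> (y \<in> frontier \<Omega> \<and> \<phi> (y, s) \<le> v (y, s))"
    then have a': "norm (x - y) \<le> r1 / 4" "norm (x - y) \<le> r2 / 4" "\<bar>t - s\<bar> \<le> r1 / 4" "\<bar>t - s\<bar> \<le> r2 / 4" by linarith+
    show "u (x, t) - v (y, s) < \<mu>"
    proof (cases "t \<le> r1 / 4 \<or> s \<le> r1 / 4")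
      case True
      then have "norm (x - y) + \<bar>t - s\<bar> + min t s \<le> r1" using a' r1(1) by linarith
      then show ?thesis using r1(2)[of "((x, t), (y, s))"] a by simp
    next
      case False
      then have "\<not> (t \<le> min r1 r2 / 4)" "\<not> (s \<le> min r1 r2 / 4)" by linarith+
      then have "y \<in> frontier \<Omega>" "\<phi> (y, s) \<le> v (y, s)" using a(7) by auto
      moreover have "norm (x - y) + \<bar>t - s\<bar> \<le> r2" using a' r2(1) by linarith
      ultimately show ?thesis using r2(2)[of "((x, t), (y, s))"] a by simp
    qed
  qed (use r1 r2 in auto)
qed

end

section \<open>Doubling of variables\<close>

lemma snorm_minus: "snorm \<epsilon> (- w) = snorm \<epsilon> w"
  by (simp add: snorm_def norm_Pair)

lemma powr_small:
  fixes q c :: real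
  assumes "0 < q" "0 < c" "0 < d"
  obtains \<delta> where "0 < \<delta>" "\<delta> \<le> d" "\<delta> powr q \<le> c"
proof (rule that[of "min d (c powr (1 / q))"])
  have "min d (c powr (1 / q)) powr q \<le> (c powr (1 / q)) powr q"
    using assms by (intro powr_mono2) auto
  also have "\<dots> = c" using assms by (simp add: powr_powr)
  finally show "min d (c powr (1 / q)) powr q \<le> c" .
qed (use assms in auto)

context comparison_problem begin

text \<open>\<open>bd\<close> excludes the boundary alternative at \<open>y\<close>, (H1) with
  \<open>uv\<close> lets both Hamiltonians be read at the value \<open>v (y, s)\<close>, and
  \<open>cross\<close> with \<open>tv\<close> compares the jumps of size at least
  \<open>\<delta>\<close>; then the two equations are subtracted.\<close>

lemma doubled_inequality:
  assumes x: "x \<in> \<Omega>" and y: "y \<in> closure \<Omega>" and t: "0 < t" and s: "0 < s"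
    and RR: "\<And>x. x \<in> closure \<Omega> \<Longrightarrow> \<bar>u (x, t)\<bar> \<le> R" "\<And>x. x \<in> closure \<Omega> \<Longrightarrow> \<bar>v (x, s)\<bar> \<le> R" and R: "0 < R"
    and uv: "v (y, s) \<le> u (x, t)" and bd: "y \<in> frontier \<Omega> \<Longrightarrow> v (y, s) < \<phi> (y, s)"
    and \<psi>1: "C1_gradient_on (Qbar \<Omega>) \<psi>1 g1" and \<psi>2: "C1_gradient_on (Qbar \<Omega>) \<psi>2 g2"
    and d: "0 < d"
    and max: "\<And>z. z \<in> Qbar \<Omega> \<Longrightarrow> norm (z - (x, t)) < d \<Longrightarrow> u z - \<psi>1 z \<le> u (x, t) - \<psi>1 (x, t)"
    and min: "\<And>z. z \<in> Qbar \<Omega> \<Longrightarrow> norm (z - (y, s)) < d \<Longrightarrow> v (y, s) - \<psi>2 (y, s) \<le> v z - \<psi>2 z"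
    and \<delta>: "0 < \<delta>" "\<delta> < 1" and \<Lambda>: "0 \<le> \<Lambda>"
    and incr1: "\<And>z. norm z < \<delta> \<Longrightarrow> x + z \<in> \<Omega> \<Longrightarrow> u (x + z, t) - u (x, t) \<le> \<Lambda> * norm z"
    and incr2: "\<And>z. norm z < \<delta> \<Longrightarrow> y + z \<in> closure \<Omega> \<Longrightarrow> - (\<Lambda> * norm z) \<le> v (y + z, s) - v (y, s)"
    and cross: "\<And>z. x + z \<in> \<Omega> \<Longrightarrow> y + z \<in> closure \<Omega> \<Longrightarrow> u (x + z, t) - u (x, t) \<le> v (y + z, s) - v (y, s) + \<kappa>0"
    and \<kappa>0: "0 \<le> \<kappa>0"
    and tv: "\<And>S. S \<in> sets borel \<Longrightarrow> S \<subseteq> - ball 0 \<delta> \<Longrightarrow> \<bar>measure (\<nu> x) S - measure (\<nu> y) S\<bar> \<le> \<mu>"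
  shows "snd (g1 (x, t)) - snd (g2 (y, s)) \<le> H y (v (y, s)) (fst (g2 (y, s))) - H x (v (y, s)) (fst (g1 (x, t)))
    + (f (x, t) - f (y, s)) + 2 * \<Lambda> * (C2 * \<delta> powr (1 - \<sigma>)) + \<kappa>0 * (C1 * \<delta> powr (- \<sigma>)) + 6 * R * \<mu>"
proof -
  let ?J = "\<Lambda> * (C2 * \<delta> powr (1 - \<sigma>))"
  have xc: "x \<in> closure \<Omega>" using x closure_subset by auto
  have J: "0 \<le> ?J" using \<Lambda> C2_pos by simp
  have yQ: "(y, s) \<in> Qcyl \<Omega> \<or> (y, s) \<in> lateral \<Omega> \<and> v (y, s) < \<phi> (y, s)"
    using y s bd open_dom by (cases "y \<in> \<Omega>") (auto simp: Qcyl_def lateral_def frontier_def interior_open)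
  have "snd (g1 (x, t)) + H x (u (x, t)) (fst (g1 (x, t))) - f (x, t) \<le> ?J + nonlocal_op \<Omega> \<nu> (- ball 0 \<delta>) (\<lambda>y. u (y, t)) x"
  proof (rule sub_ineq[OF sub lb_u \<psi>1 _ d max _ \<delta>(1), where k="\<lambda>z. \<Lambda> * norm z"])
    show "AE z in \<nu> x. z \<noteq> 0 \<longrightarrow> norm z < \<delta> \<longrightarrow> x + z \<in> closure \<Omega> \<longrightarrow> u (x + z, t) - u (x, t) \<le> \<Lambda> * norm z"
      using AE_interior[OF x] by eventually_elim (use incr1 in auto)
    show "(\<integral>\<^sup>+z\<in>ball 0 \<delta>. ennreal (\<Lambda> * norm z) \<partial>\<nu> x) \<le> ennreal ?J" by (rule nn_integral_linear[OF xc \<delta> \<Lambda>])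
  qed (use x xc t J \<Lambda> in \<open>auto simp: Qbar_def Qcyl_def\<close>)
  moreover have "nonlocal_op \<Omega> \<nu> (- ball 0 \<delta>) (\<lambda>x. v (x, s)) y - ?J \<le> snd (g2 (y, s)) + H y (v (y, s)) (fst (g2 (y, s))) - f (y, s)"
  proof (rule super_ineq[OF super lb_v \<psi>2 _ d min _ \<delta>(1), where k="\<lambda>z. \<Lambda> * norm z"])
    show "AE z in \<nu> y. z \<noteq> 0 \<longrightarrow> norm z < \<delta> \<longrightarrow> y + z \<in> closure \<Omega> \<longrightarrow> - (\<Lambda> * norm z) \<le> v (y + z, s) - v (y, s)"
      using incr2 by (intro AE_I2) auto
    show "(\<integral>\<^sup>+z\<in>ball 0 \<delta>. ennreal (\<Lambda> * norm z) \<partial>\<nu> y) \<le> ennreal ?J" by (rule nn_integral_linear[OF y \<delta> \<Lambda>])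
    show "(y, s) \<in> Qcyl \<Omega> \<or> (y, s) \<in> lateral \<Omega> \<and> v (y, s) < \<phi> (y, s) \<or> s = 0 \<and> v (y, s) < u0 y" using yQ by blast
  qed (use y s J \<Lambda> in \<open>auto simp: Qbar_def\<close>)
  moreover have "nonlocal_op \<Omega> \<nu> (- ball 0 \<delta>) (\<lambda>y. u (y, t)) x - nonlocal_op \<Omega> \<nu> (- ball 0 \<delta>) (\<lambda>x. v (x, s)) y
      \<le> \<kappa>0 * (C1 * \<delta> powr (- \<sigma>)) + 3 * (2 * R) * \<mu>"
    using t s by (intro nonlocal_op_diff_le[OF x y \<delta>(1) _ RR(1) _ RR(2) tv _ \<kappa>0] usc_on_slice[OF usc_u] usc_on_slice[OF usc_minus_v]) (auto intro: cross)
  moreover have "H x (v (y, s)) (fst (g1 (x, t))) \<le> H x (u (x, t)) (fst (g1 (x, t)))"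
  proof -
    obtain l where "0 \<le> l" "\<And>x p u v. x \<in> closure \<Omega> \<Longrightarrow> v \<le> u \<Longrightarrow> \<bar>u\<bar> \<le> R \<Longrightarrow> \<bar>v\<bar> \<le> R \<Longrightarrow> l * (u - v) \<le> H x u p - H x v p"
      using H1 R unfolding assm_H1_def by metis
    from this(2)[OF xc uv RR(1)[OF xc] RR(2)[OF y], of "fst (g1 (x, t))"] \<open>0 \<le> l\<close> uv show ?thesis
      using mult_nonneg_nonneg[of l "u (x, t) - v (y, s)"] by linarith
  qed
  ultimately show ?thesis by linarith
qed

text \<open>One contradiction serves both conclusions: a constant choice of \<open>(x, t)\<close>
  gives the inequality inside, and interior points approaching \<open>(y1, t1)\<close> give it for
  the upper limit at the lateral boundary.\<close>

lemma no_gap: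
  assumes y1: "y1 \<in> closure \<Omega>" and t1: "0 \<le> t1" and c0: "0 < c0"
    and gap: "\<And>\<rho>. 0 < \<rho> \<Longrightarrow> \<exists>x t. x \<in> \<Omega> \<and> 0 \<le> t \<and> norm (x - y1) \<le> \<rho> \<and> \<bar>t - t1\<bar> \<le> \<rho> \<and> c0 \<le> u (x, t) - v (y1, t1)"
  shows False
proof -
  define T where "T = t1 + 1"
  have T: "0 < T" using t1 by (simp add: T_def)
  have cl: "x \<in> closure \<Omega>" if "x \<in> \<Omega>" for x using that closure_subset by auto
  obtain Ru where Ru: "0 < Ru" "\<And>x t. x \<in> closure \<Omega> \<Longrightarrow> 0 \<le> t \<Longrightarrow> t \<le> T \<Longrightarrow> \<bar>u (x, t)\<bar> \<le> Ru"
    using slice_bounded[OF bounded_dom lb_u, of T] by metis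
  obtain Rv where Rv: "0 < Rv" "\<And>x t. x \<in> closure \<Omega> \<Longrightarrow> 0 \<le> t \<Longrightarrow> t \<le> T \<Longrightarrow> \<bar>v (x, t)\<bar> \<le> Rv"
    using slice_bounded[OF bounded_dom lb_v, of T] by metis
  define R where "R = max Ru Rv"
  have R: "0 < R" using Ru by (simp add: R_def)
  have uR: "\<bar>u (x, t)\<bar> \<le> R" if "x \<in> closure \<Omega>" "0 \<le> t" "t \<le> T" for x t
    using Ru(2)[OF that] by (simp add: R_def)
  have vR: "\<bar>v (x, t)\<bar> \<le> R" if "x \<in> closure \<Omega>" "0 \<le> t" "t \<le> T" for x t
    using Rv(2)[OF that] by (simp add: R_def)
  \<comment> \<open>The slope in time that yields the final contradiction; up to time
    \<open>t1\<close> it costs at most a quarter of the gap.\<close>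
  define \<kappa> where "\<kappa> = c0 / (4 * (t1 + 1))"
  have \<kappa>: "0 < \<kappa>" "\<kappa> * t1 \<le> c0 / 4"
  proof -
    show "0 < \<kappa>" using c0 t1 by (simp add: \<kappa>_def)
    have "\<kappa> * t1 \<le> \<kappa> * (t1 + 1)" using \<open>0 < \<kappa>\<close> by simp
    also have "\<dots> = c0 / 4"
    proof -
      have "t1 + 1 \<noteq> 0" using t1 by linarith
      then show ?thesis by (simp add: \<kappa>_def nonzero_divide_mult_cancel_right[of "t1 + 1" "c0"] field_simps)
    qed
    finally show "\<kappa> * t1 \<le> c0 / 4" .
  qed
  \<comment> \<open>So large that the penalty reaches \<open>2 * R + 2\<close> half a unit after
    \<open>t1\<close>, which keeps the times below \<open>T\<close>.\<close>
  define B where "B = 8 * R + 8"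
  have B0: "0 \<le> B" using R by (simp add: B_def)
  define P where "P s = \<kappa> * s + B * (max 0 (s - t1))\<^sup>2" for s
  define P' where "P' s = \<kappa> + B * (2 * max 0 (s - t1))" for s
  have dP: "(P has_real_derivative P' s) (at s)" for s
  proof -
    have "((\<lambda>s. (max 0 (s - t1))\<^sup>2) has_real_derivative 2 * max 0 (s - t1) * 1) (at s)"
      by (rule DERIV_chain2[OF max_sq_deriv]) (auto intro!: derivative_eq_intros)
    from DERIV_add[OF DERIV_cmult[OF DERIV_ident, of \<kappa>] DERIV_cmult[OF this, of B]]
    show ?thesis unfolding P_def[abs_def] P'_def by simp
  qed
  have cP': "continuous_on S P'" and cP: "continuous_on S P" for S
    unfolding P'_def P_def by (intro continuous_intros)+
  have P0: "0 \<le> P s" if "0 \<le> s" for s using that \<kappa> R by (simp add: P_def B_def)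
  have P'\<kappa>: "\<kappa> \<le> P' s" for s using R by (simp add: P'_def B_def)
  have Pbig: "2 * R + 2 \<le> P s" if "t1 + 1 / 2 \<le> s" for s
  proof -
    have "(1 / 2)\<^sup>2 \<le> (max 0 (s - t1))\<^sup>2" using that by (intro power_mono) auto
    from mult_left_mono[OF this] have "B * (1 / 2)\<^sup>2 \<le> B * (max 0 (s - t1))\<^sup>2" using B0 by blast
    moreover have "0 \<le> \<kappa> * s" using \<kappa> that t1 by simp
    moreover have "B * (1 / 2)\<^sup>2 = 2 * R + 2" by (simp add: B_def power2_eq_square)
    ultimately show ?thesis unfolding P_def by linarith
  qed
  have Pt1: "P t1 = \<kappa> * t1" by (simp add: P_def)
  obtain r0 where r0: "0 < r0"
    "\<And>x t y s. x \<in> closure \<Omega> \<Longrightarrow> y \<in> closure \<Omega> \<Longrightarrow> t \<in> {0..T} \<Longrightarrow> s \<in> {0..T} \<Longrightarrow> norm (x - y) \<le> r0 \<Longrightarrow> \<bar>t - s\<bar> \<le> r0 \<Longrightarrow>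
       t \<le> r0 \<or> s \<le> r0 \<or> (y \<in> frontier \<Omega> \<and> \<phi> (y, s) \<le> v (y, s)) \<Longrightarrow> u (x, t) - v (y, s) < c0 / 4"
    using near_parabolic_boundary[of T "c0 / 4"] T c0 by (metis less_imp_le zero_less_divide_iff zero_less_numeral)
  obtain r2 where r2: "0 < r2" "\<And>x y t s. x \<in> closure \<Omega> \<Longrightarrow> y \<in> closure \<Omega> \<Longrightarrow> t \<in> {0..T} \<Longrightarrow> s \<in> {0..T} \<Longrightarrow>
    norm (x - y) < r2 \<Longrightarrow> \<bar>t - s\<bar> < r2 \<Longrightarrow> \<bar>f (x, t) - f (y, s)\<bar> \<le> \<kappa> / 8"
    using f_uniform[of "\<kappa> / 8" T] \<kappa>(1) by (metis zero_less_divide_iff zero_less_numeral)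
  define r1 where "r1 = min (min r0 (r2 / 2)) (1 / 4)"
  have r1: "0 < r1" "r1 \<le> r0" "r1 \<le> r2 / 2" "r1 \<le> 1 / 4" using r0(1) r2(1) unfolding r1_def by linarith+
  \<comment> \<open>With this weight, times that differ by \<open>r1 / 8\<close> or more cost at
    least \<open>2 * R + 3\<close>, while \<open>u - v\<close> is at most
    \<open>2 * R\<close>.\<close>
  define \<eta> where "\<eta> = (r1 / 8)\<^sup>2 / (2 * R + 3)"
  have \<eta>: "0 < \<eta>" using r1 R by (simp add: \<eta>_def)
  have sq\<eta>: "2 * R + 3 \<le> a\<^sup>2 / \<eta>" if "r1 / 8 \<le> \<bar>a\<bar>" for a
  proof -
    have "(r1 / 8)\<^sup>2 \<le> a\<^sup>2" using power_mono[OF that, of 2] r1 by simp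
    then have "(r1 / 8)\<^sup>2 / \<eta> \<le> a\<^sup>2 / \<eta>" using \<eta> by (intro divide_right_mono) auto
    moreover have "(r1 / 8)\<^sup>2 / \<eta> = 2 * R + 3" using r1 R by (simp add: \<eta>_def)
    ultimately show ?thesis by simp
  qed
  define V :: "('a \<times> real) \<times> 'a \<times> real \<Rightarrow> real" where
    "V z = u (fst z) - v (snd z) - (snd (fst z) - snd (snd z))\<^sup>2 / \<eta> - P (snd (snd z))" for z
  \<comment> \<open>The first point ranges over the open domain only, so
    \<open>limsup_cluster\<close> has to supply a value \<open>M\<close> and a cluster point in
    place of a maximum.\<close>
  define X where "X = (\<Omega> \<times> {0..T}) \<times> (closure \<Omega> \<times> {0..T})"
  define K where "K = (closure \<Omega> \<times> {0..T}) \<times> (closure \<Omega> \<times> {0..T})"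
  have K: "compact K" "X \<subseteq> K"
    unfolding K_def X_def using closure_subset[of \<Omega>] by (auto intro!: compact_Times compact_closure_dom)
  have V_le: "V ((x, t), (y, s)) \<le> u (x, t) - v (y, s)" if "0 \<le> s" for x t y s
  proof -
    have "0 \<le> (t - s)\<^sup>2 / \<eta>" using \<eta> by simp
    then show ?thesis using P0[OF that] unfolding V_def fst_conv snd_conv by linarith
  qed
  obtain M zs where M: "c0 / 2 \<le> M" "\<And>\<mu>. 0 < \<mu> \<Longrightarrow> \<exists>\<rho>>0. \<forall>z\<in>X. norm (fst (fst z) - fst (snd z)) \<le> \<rho> \<longrightarrow> V z \<le> M + \<mu>"
    and zs: "zs \<in> K" "\<And>\<rho>. 0 < \<rho> \<Longrightarrow> \<exists>w\<in>X. norm (fst (fst w) - fst (snd w)) \<le> \<rho> \<and> M - \<rho> \<le> V w \<and> dist w zs \<le> \<rho>"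
  proof (rule limsup_cluster[of X V "2 * R" "\<lambda>z. norm (fst (fst z) - fst (snd z))" "c0 / 2" K])
    fix z assume "z \<in> X"
    then obtain x t y s where z: "z = ((x, t), (y, s))" "x \<in> \<Omega>" "y \<in> closure \<Omega>" "0 \<le> t" "t \<le> T" "0 \<le> s" "s \<le> T" by (auto simp: X_def)
    then show "V z \<le> 2 * R" using V_le[of s x t y] uR[OF cl[OF z(2)] z(4,5)] vR[OF z(3,6,7)] by simp
  next
    fix \<rho> :: real assume \<rho>: "0 < \<rho>"
    define \<rho>' where "\<rho>' = min \<rho> (min 1 (\<eta> * c0 / 8))"
    have \<rho>': "0 < \<rho>'" "\<rho>' \<le> \<rho>" "\<rho>' \<le> 1" "\<rho>' \<le> \<eta> * c0 / 8" using \<rho> \<eta> c0 by (auto simp: \<rho>'_def)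
    obtain x t where xt: "x \<in> \<Omega>" "0 \<le> t" "norm (x - y1) \<le> \<rho>'" "\<bar>t - t1\<bar> \<le> \<rho>'" "c0 \<le> u (x, t) - v (y1, t1)"
      using gap[OF \<rho>'(1)] by blast
    have "(t - t1)\<^sup>2 \<le> \<rho>' * 1"
      using mult_mono[of "\<bar>t - t1\<bar>" \<rho>' "\<bar>t - t1\<bar>" 1] xt(4) \<rho>' by (simp add: power2_eq_square)
    then have "(t - t1)\<^sup>2 / \<eta> \<le> (\<eta> * c0 / 8) / \<eta>" using \<rho>' \<eta> by (intro divide_right_mono) auto
    then have "(t - t1)\<^sup>2 / \<eta> \<le> c0 / 8" using \<eta> by simp
    then have "c0 / 2 \<le> V ((x, t), (y1, t1))" using xt(5) \<kappa>(2) c0 by (simp add: V_def Pt1)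
    moreover have "((x, t), (y1, t1)) \<in> X" using xt y1 t1 \<rho>' by (auto simp: X_def T_def)
    ultimately show "\<exists>z\<in>X. norm (fst (fst z) - fst (snd z)) \<le> \<rho> \<and> c0 / 2 \<le> V z"
      using xt(3) \<rho>'(2) by (intro bexI[of _ "((x, t), (y1, t1))"]) auto
  qed (use K in auto)
  \<comment> \<open>Pairs near the diagonal that retain a quarter of the gap stay away from the
    initial time and from \<open>T\<close>, and the boundary alternative for \<open>v\<close> is
    excluded.\<close>
  have good: "\<bar>t - s\<bar> < r1 / 8 \<and> r1 < t \<and> r1 < s \<and> s < t1 + 1 / 2 \<and> (y \<in> frontier \<Omega> \<longrightarrow> v (y, s) < \<phi> (y, s)) \<and> v (y, s) \<le> u (x, t)"
    if z: "((x, t), (y, s)) \<in> X" "norm (x - y) \<le> r1" "c0 / 4 \<le> V ((x, t), (y, s))" for x t y s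
  proof -
    have b: "x \<in> closure \<Omega>" "y \<in> closure \<Omega>" "0 \<le> t" "t \<le> T" "0 \<le> s" "s \<le> T" using z(1) cl by (auto simp: X_def)
    have uv: "u (x, t) - v (y, s) \<le> 2 * R" using uR[OF b(1,3,4)] vR[OF b(2,5,6)] by linarith
    have q0: "0 \<le> (t - s)\<^sup>2 / \<eta>" using \<eta> by simp
    have Vd: "V ((x, t), (y, s)) = u (x, t) - v (y, s) - (t - s)\<^sup>2 / \<eta> - P s" by (simp add: V_def)
    have "(t - s)\<^sup>2 / \<eta> < 2 * R + 3" using Vd z(3) uv P0[OF b(5)] c0 by linarith
    then have ts: "\<bar>t - s\<bar> < r1 / 8" using sq\<eta>[of "t - s"] by linarith
    have "s < t1 + 1 / 2" using Pbig[of s] Vd z(3) uv q0 c0 by linarith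
    moreover have "\<not> (t \<le> r0 \<or> s \<le> r0 \<or> (y \<in> frontier \<Omega> \<and> \<phi> (y, s) \<le> v (y, s)))"
    proof
      assume "t \<le> r0 \<or> s \<le> r0 \<or> (y \<in> frontier \<Omega> \<and> \<phi> (y, s) \<le> v (y, s))"
      then have "u (x, t) - v (y, s) < c0 / 4" using r0(2)[of x y t s] b z(2) ts r1 by auto
      then show False using V_le[OF b(5), of x t y] z(3) by linarith
    qed
    ultimately show ?thesis using ts r1 V_le[OF b(5), of x t y] z(3) c0 by auto
  qed
  obtain xs ts ys ss where zs_eq: "zs = ((xs, ts), (ys, ss))" by (metis surj_pair)
  have comp: "norm (x - xs) \<le> \<rho>" "norm (y - ys) \<le> \<rho>" "\<bar>t - ts\<bar> \<le> \<rho>" "\<bar>s - ss\<bar> \<le> \<rho>"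
    if "dist ((x, t), (y, s)) zs \<le> \<rho>" for x t y s \<rho>
  proof -
    have "dist (x, t) (xs, ts) \<le> \<rho>" "dist (y, s) (ys, ss) \<le> \<rho>"
      using that dist_fst_le[of "((x, t), (y, s))" zs] dist_snd_le[of "((x, t), (y, s))" zs] by (auto simp: zs_eq)
    then show "norm (x - xs) \<le> \<rho>" "norm (y - ys) \<le> \<rho>" "\<bar>t - ts\<bar> \<le> \<rho>" "\<bar>s - ss\<bar> \<le> \<rho>"
      using dist_fst_le[of "(x, t)" "(xs, ts)"] dist_snd_le[of "(x, t)" "(xs, ts)"] dist_fst_le[of "(y, s)" "(ys, ss)"] dist_snd_le[of "(y, s)" "(ys, ss)"]
      by (auto simp: dist_norm)
  qed
  have approx: "\<exists>x t y s. ((x, t), (y, s)) \<in> X \<and> norm (x - y) \<le> \<rho> \<and> M - \<rho> \<le> V ((x, t), (y, s)) \<and>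
      norm (x - xs) \<le> \<rho> \<and> norm (y - ys) \<le> \<rho> \<and> \<bar>t - ts\<bar> \<le> \<rho> \<and> \<bar>s - ss\<bar> \<le> \<rho>" if \<rho>: "0 < \<rho>" for \<rho>
  proof -
    obtain w where w: "w \<in> X" "norm (fst (fst w) - fst (snd w)) \<le> \<rho>" "M - \<rho> \<le> V w" "dist w zs \<le> \<rho>"
      using zs(2)[OF \<rho>] by blast
    obtain x t y s where "w = ((x, t), (y, s))" by (metis surj_pair)
    then show ?thesis using w comp[of x t y s \<rho>] by auto
  qed
  have xys: "xs = ys"
  proof -
    have "norm (xs - ys) \<le> 0 + \<epsilon>" if \<epsilon>: "0 < \<epsilon>" for \<epsilon>
    proof -
      obtain x t y s where "norm (x - y) \<le> \<epsilon> / 3" "norm (x - xs) \<le> \<epsilon> / 3" "norm (y - ys) \<le> \<epsilon> / 3"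
      proof -
        have "0 < \<epsilon> / 3" using \<epsilon> by simp
        from approx[OF this] show thesis using that by blast
      qed
      moreover have "norm (xs - ys) \<le> norm (x - xs) + norm (x - y) + norm (y - ys)"
        using norm_triangle_ineq4[of "x - ys" "x - xs"] norm_triangle_ineq[of "x - y" "y - ys"] by simp
      ultimately show ?thesis by linarith
    qed
    then have "norm (xs - ys) \<le> 0" by (rule field_le_epsilon)
    then show ?thesis by simp
  qed
  define x0 where "x0 = ys"
  have x0: "x0 \<in> closure \<Omega>" and tsT: "0 \<le> ts" "ts \<le> T" "0 \<le> ss" "ss \<le> T"
    using zs(1) by (auto simp: zs_eq K_def x0_def)
  have ss: "7 * r1 / 8 \<le> ss" "ss \<le> t1 + 1 / 2 + r1 / 8" "\<bar>ts - ss\<bar> \<le> 3 * r1 / 8"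
  proof -
    obtain x t y s where w: "((x, t), (y, s)) \<in> X" "norm (x - y) \<le> min (r1 / 8) (c0 / 4)" "M - min (r1 / 8) (c0 / 4) \<le> V ((x, t), (y, s))"
      "\<bar>t - ts\<bar> \<le> min (r1 / 8) (c0 / 4)" "\<bar>s - ss\<bar> \<le> min (r1 / 8) (c0 / 4)"
      using approx[of "min (r1 / 8) (c0 / 4)"] r1 c0 by auto
    have "norm (x - y) \<le> r1" "c0 / 4 \<le> V ((x, t), (y, s))" using w(2,3) M(1) r1 by linarith+
    then have "\<bar>t - s\<bar> < r1 / 8" "r1 < s" "s < t1 + 1 / 2" using good[OF w(1)] by auto
    then show "7 * r1 / 8 \<le> ss" "ss \<le> t1 + 1 / 2 + r1 / 8" "\<bar>ts - ss\<bar> \<le> 3 * r1 / 8" using w(4,5) by linarith+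
  qed
  obtain r G e g Dg where patch: "patch \<Omega> x0 r G e g Dg" using patch_exists[OF x0] by blast
  note pt = patch[unfolded patch_def]
  have r: "0 < r" "r \<le> 1" "1 \<le> G" "norm e \<le> 1" using pt by auto
  define k0 where "k0 = 1 / (2 * G)"
  have k0: "0 < k0" "k0 \<le> 1 / 2" using r by (auto simp: k0_def field_simps)
  have inw: "x \<in> \<Omega>" if "norm (y - x0) < r / 2" "y \<in> closure \<Omega>" "0 < \<epsilon>" "\<epsilon> < r / 4" "norm (x - y - \<epsilon> *\<^sub>R e) \<le> k0 * \<epsilon>" for x y \<epsilon>
  proof -
    have "\<forall>y\<in>ball x0 (r/2) \<inter> closure \<Omega>. \<forall>\<epsilon> x. 0 < \<epsilon> \<longrightarrow> \<epsilon> < r / 4 \<longrightarrow> norm (x - y - \<epsilon> *\<^sub>R e) \<le> \<epsilon> / (2 * G) \<longrightarrow> x \<in> \<Omega>"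
      using pt by blast
    moreover have "y \<in> ball x0 (r / 2) \<inter> closure \<Omega>" using that by (simp add: dist_norm norm_minus_commute)
    ultimately show ?thesis using that by (auto simp: k0_def)
  qed
  \<comment> \<open>Bounds the derivative of every time penalty used below, whatever its centres in
    the interval up to \<open>T\<close>, so that one Lipschitz constant serves them all.\<close>
  define C0 where "C0 = 2 * T / \<eta> + 2 * T"
  obtain L0 where L0: "0 < L0" and lip: "\<And>\<theta> \<theta>' y s0 Q x t. (\<And>t. (\<theta> has_real_derivative \<theta>' t) (at t)) \<Longrightarrow> continuous_on UNIV \<theta>' \<Longrightarrow>
      (\<And>t. 0 \<le> t \<Longrightarrow> t \<le> T \<Longrightarrow> \<bar>\<theta>' t\<bar> \<le> C0) \<Longrightarrow> y \<in> \<Omega> \<Longrightarrow> norm (y - x0) < r / 4 \<Longrightarrow>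
      0 \<le> s0 \<Longrightarrow> s0 \<le> T \<Longrightarrow> (\<And>t. 0 \<le> t \<Longrightarrow> t \<le> T \<Longrightarrow> \<theta> s0 \<le> \<theta> t + 1) \<Longrightarrow>
      \<theta> s0 + 2 * R + 2 \<le> \<theta> 0 \<Longrightarrow> \<theta> s0 + 2 * R + 2 \<le> \<theta> T \<Longrightarrow>
      (\<And>t. 0 \<le> t \<Longrightarrow> t \<le> T \<Longrightarrow> u (y, t) - \<theta> t \<le> Q) \<Longrightarrow>
      x \<in> \<Omega> \<Longrightarrow> norm (x - x0) < r / 4 \<Longrightarrow> 0 \<le> t \<Longrightarrow> t \<le> T \<Longrightarrow> u (x, t) - \<theta> t \<le> Q + L0 * norm (x - y)"
    using lipschitz_estimate[OF sub lb_u f_cont H2 m_gt patch R uR T, of C0] by blast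
  \<comment> \<open>The surplus 1 over the Lipschitz constant keeps \<open>x\<close> near
    \<open>y + \<epsilon> *\<^sub>R e\<close>; the 3 in \<open>\<Lambda>\<close> accounts for the
    quadratic localization.\<close>
  define L where "L = L0 + 1"
  define \<Lambda> where "\<Lambda> = L + 3"
  have L: "1 < L" "0 < \<Lambda>" using L0 by (auto simp: L_def \<Lambda>_def)
  \<comment> \<open>Chosen after \<open>L\<close> and before \<open>\<mu>\<close> and
    \<open>\<epsilon>\<close>: small jumps are settled by the slope \<open>\<Lambda>\<close>, while
    the error of the larger ones is multiplied by the mass \<open>D1\<close> outside this
    ball.\<close>
  obtain \<delta> where \<delta>: "0 < \<delta>" "\<delta> \<le> min (r / 16) (1 / 2)" "\<delta> powr (1 - \<sigma>) \<le> \<kappa> / (16 * \<Lambda> * C2)"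
    by (rule powr_small[of "1 - \<sigma>" "\<kappa> / (16 * \<Lambda> * C2)" "min (r / 16) (1 / 2)"])
      (use sigma_less \<kappa> L C2_pos r in auto)
  have \<delta>': "\<delta> \<le> r / 16" "\<delta> < 1" "2 * \<Lambda> * (C2 * \<delta> powr (1 - \<sigma>)) \<le> \<kappa> / 8"
  proof -
    show "\<delta> \<le> r / 16" "\<delta> < 1" using \<delta>(2) by linarith+
    have "2 * \<Lambda> * C2 * \<delta> powr (1 - \<sigma>) \<le> 2 * \<Lambda> * C2 * (\<kappa> / (16 * \<Lambda> * C2))"
      using \<delta>(3) L C2_pos by (intro mult_left_mono) auto
    also have "\<dots> = \<kappa> / 8" using L C2_pos by simp
    finally show "2 * \<Lambda> * (C2 * \<delta> powr (1 - \<sigma>)) \<le> \<kappa> / 8" by (simp add: mult.assoc)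
  qed
  obtain \<xi>H where \<xi>H: "0 < \<xi>H" "\<And>x y r p q. x \<in> closure \<Omega> \<Longrightarrow> y \<in> closure \<Omega> \<Longrightarrow> \<bar>r\<bar> \<le> R \<Longrightarrow> norm p \<le> \<Lambda> \<Longrightarrow> norm q \<le> \<Lambda> \<Longrightarrow>
    norm (x - y) < \<xi>H \<Longrightarrow> norm (p - q) < \<xi>H \<Longrightarrow> \<bar>H x r p - H y r q\<bar> \<le> \<kappa> / 8"
    by (rule H_uniform[of "\<kappa> / 8" R \<Lambda>]) (use \<kappa> in auto)
  have "0 < \<kappa> / (48 * R)" using \<kappa> R by simp
  from tv_small[OF \<delta>(1) this] obtain rtv where rtv: "0 < rtv" and tv: "\<And>x y S. x \<in> closure \<Omega> \<Longrightarrow> y \<in> closure \<Omega> \<Longrightarrow> norm (x - y) < rtv \<Longrightarrow>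
    S \<in> sets borel \<Longrightarrow> S \<subseteq> - ball 0 \<delta> \<Longrightarrow> \<bar>measure (\<nu> x) S - measure (\<nu> y) S\<bar> \<le> \<kappa> / (48 * R)" by metis
  define \<xi> where "\<xi> = min (min (r / 32) (\<xi>H / 4)) (min (\<kappa> / 64) (r1 / 16))"
  have \<xi>: "0 < \<xi>" "\<xi> \<le> r / 32" "\<xi> \<le> \<xi>H / 4" "\<xi> \<le> \<kappa> / 64" "\<xi> \<le> r1 / 16"
    using r(1) \<xi>H(1) \<kappa>(1) r1(1) unfolding \<xi>_def by linarith+
  define D1 where "D1 = C1 * \<delta> powr (- \<sigma>)"
  have D1: "0 < D1" using C1_pos \<delta> by (simp add: D1_def)
  \<comment> \<open>The first bound localizes the maximum within \<open>\<xi>\<close> of the cluster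
    point, the second makes the jump error \<open>2 * \<mu> * D1\<close> at most
    \<open>\<kappa> / 8\<close>, the third preserves the gap.\<close>
  define \<mu> where "\<mu> = min (min (\<xi>\<^sup>2 / 4) (\<kappa> / (16 * D1))) (c0 / 16)"
  have \<mu>: "0 < \<mu>" "\<mu> \<le> \<xi>\<^sup>2 / 4" "\<mu> \<le> \<kappa> / (16 * D1)" "\<mu> \<le> c0 / 16"
  proof -
    have "0 < \<xi>\<^sup>2 / 4" "0 < \<kappa> / (16 * D1)" using \<xi>(1) \<kappa>(1) D1 by auto
    then show "0 < \<mu>" "\<mu> \<le> \<xi>\<^sup>2 / 4" "\<mu> \<le> \<kappa> / (16 * D1)" "\<mu> \<le> c0 / 16" using c0 unfolding \<mu>_def by linarith+
  qed
  have \<mu>D: "2 * \<mu> * D1 \<le> \<kappa> / 8"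
  proof -
    have "2 * \<mu> * D1 \<le> 2 * (\<kappa> / (16 * D1)) * D1" using \<mu>(3) D1 by (intro mult_right_mono) auto
    also have "\<dots> = \<kappa> / 8" using D1 by simp
    finally show ?thesis .
  qed
  obtain \<rho>1 where \<rho>1: "0 < \<rho>1" and VM': "\<forall>z\<in>X. norm (fst (fst z) - fst (snd z)) \<le> \<rho>1 \<longrightarrow> V z \<le> M + \<mu>"
    using M(2)[OF \<mu>(1)] by blast
  have VM: "V ((x, t), (y, s)) \<le> M + \<mu>" if "((x, t), (y, s)) \<in> X" "norm (x - y) \<le> \<rho>1" for x t y s
    using VM' that by force
  define \<epsilon> where "\<epsilon> = min (min (min (r / 64) (\<rho>1 / 4)) (min (rtv / 4) (\<xi>H / 4))) (min (r1 / 4) (\<mu> / (8 * L)))"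
  have \<epsilon>: "0 < \<epsilon>" "\<epsilon> \<le> r / 64" "\<epsilon> \<le> \<rho>1 / 4" "\<epsilon> \<le> rtv / 4" "\<epsilon> \<le> \<xi>H / 4" "\<epsilon> \<le> r1 / 4" "L * \<epsilon> \<le> \<mu> / 8"
  proof -
    have p: "0 < \<mu> / (8 * L)" using \<mu> L by simp
    show "0 < \<epsilon>" "\<epsilon> \<le> r / 64" "\<epsilon> \<le> \<rho>1 / 4" "\<epsilon> \<le> rtv / 4" "\<epsilon> \<le> \<xi>H / 4" "\<epsilon> \<le> r1 / 4"
      using p r(1) \<rho>1 rtv \<xi>H(1) r1(1) unfolding \<epsilon>_def by linarith+
    have "\<epsilon> \<le> \<mu> / (8 * L)" unfolding \<epsilon>_def by linarith
    then show "L * \<epsilon> \<le> \<mu> / 8" using L by (simp add: field_simps)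
  qed
  \<comment> \<open>The smoothing is small against the radius \<open>k0 * \<epsilon>\<close>, so
    that from distance \<open>L * \<epsilon>'\<close> on, at most half that radius, the Lipschitz
    bound takes over.\<close>
  define \<epsilon>' where "\<epsilon>' = min (k0 * \<epsilon> / (2 * L)) (\<mu> / (8 * L))"
  have \<epsilon>': "0 < \<epsilon>'" "L * \<epsilon>' \<le> k0 * \<epsilon> / 2" "L * \<epsilon>' \<le> \<mu> / 8"
  proof -
    show "0 < \<epsilon>'" using k0 \<epsilon> \<mu> L by (simp add: \<epsilon>'_def)
    have "\<epsilon>' \<le> k0 * \<epsilon> / (2 * L)" "\<epsilon>' \<le> \<mu> / (8 * L)" unfolding \<epsilon>'_def by linarith+
    then show "L * \<epsilon>' \<le> k0 * \<epsilon> / 2" "L * \<epsilon>' \<le> \<mu> / 8" using L by (simp_all add: field_simps)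
  qed
  have sn0: "snorm \<epsilon>' 0 = \<epsilon>'" using \<epsilon>'(1) by (simp add: snorm_def norm_Pair)
  have ne: "norm (\<epsilon> *\<^sub>R e) \<le> \<epsilon>" using \<epsilon>(1) r(4) by (simp add: mult_left_le)
  have k0\<epsilon>: "k0 * \<epsilon> \<le> \<epsilon> / 2" using k0 \<epsilon>(1) mult_right_mono[of k0 "1/2" \<epsilon>] by simp
  \<comment> \<open>Quadratic localization at the cluster point; it does not involve
    \<open>x\<close>, so it enters only one of the two space gradients.\<close>
  define loc :: "real \<Rightarrow> 'a \<Rightarrow> real \<Rightarrow> real" where "loc t y s = (y - x0) \<bullet> (y - x0) + (t - ts)\<^sup>2 + (s - ss)\<^sup>2" for t y s
  define \<Phi> where "\<Phi> z = V z - L * snorm \<epsilon>' (fst (fst z) - fst (snd z) - \<epsilon> *\<^sub>R e) - loc (snd (fst z)) (fst (snd z)) (snd (snd z))" for z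
  have \<Phi>_eq: "\<Phi> ((x, t), (y, s)) = V ((x, t), (y, s)) - L * snorm \<epsilon>' (x - y - \<epsilon> *\<^sub>R e) - loc t y s" for x t y s
    by (simp add: \<Phi>_def)
  have V_eq: "V ((x, t), (y, s)) = u (x, t) - v (y, s) - (t - s)\<^sup>2 / \<eta> - P s" for x t y s
    by (simp add: V_def)
  \<comment> \<open>The inward shift puts \<open>x\<close> in \<open>\<Omega>\<close> throughout
    this compact set, so \<open>\<Phi>\<close> has a maximum there although \<open>X\<close> is not
    compact.\<close>
  define Kc where "Kc = {z \<in> K. norm (fst (snd z) - x0) \<le> r / 8 \<and> norm (fst (fst z) - fst (snd z) - \<epsilon> *\<^sub>R e) \<le> k0 * \<epsilon>}"
  have KcI: "((x, t), (y, s)) \<in> Kc"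
    if "y \<in> closure \<Omega>" "norm (y - x0) \<le> r / 8" "norm (x - y - \<epsilon> *\<^sub>R e) \<le> k0 * \<epsilon>" "0 \<le> t" "t \<le> T" "0 \<le> s" "s \<le> T" for x t y s
  proof -
    have "x \<in> \<Omega>" by (rule inw[OF _ that(1) \<epsilon>(1) _ that(3)]) (use that(2) \<epsilon> r in linarith)+
    then show ?thesis using that cl by (auto simp: Kc_def K_def)
  qed
  obtain zb where zb: "zb \<in> Kc" "\<And>w. w \<in> Kc \<Longrightarrow> \<Phi> w \<le> \<Phi> zb"
  proof -
    have "closed {z :: ('a \<times> real) \<times> 'a \<times> real. norm (fst (snd z) - x0) \<le> r / 8 \<and> norm (fst (fst z) - fst (snd z) - \<epsilon> *\<^sub>R e) \<le> k0 * \<epsilon>}"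
      by (intro closed_Collect_conj closed_Collect_le continuous_intros)
    moreover have "Kc = K \<inter> {z. norm (fst (snd z) - x0) \<le> r / 8 \<and> norm (fst (fst z) - fst (snd z) - \<epsilon> *\<^sub>R e) \<le> k0 * \<epsilon>}"
      by (auto simp: Kc_def)
    ultimately have cKc: "compact Kc" using K(1) by (simp add: compact_Int_closed)
    have "((x0 + \<epsilon> *\<^sub>R e, 0), (x0, 0)) \<in> Kc" using x0 r k0 \<epsilon> T by (intro KcI) auto
    then have neKc: "Kc \<noteq> {}" by auto
    have KcK: "Kc \<subseteq> K" by (auto simp: Kc_def)
    have uscu: "usc_on Kc (\<lambda>z. u (fst z))" "usc_on Kc (\<lambda>z. - v (snd z))"
      using KcK by (auto intro!: usc_on_compose[OF usc_u] usc_on_compose[OF usc_minus_v] continuous_intros simp: K_def Qbar_def)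
    have "usc_on Kc (\<lambda>z. (u (fst z) + - v (snd z)) + (- ((snd (fst z) - snd (snd z))\<^sup>2 / \<eta>) - P (snd (snd z))
       - L * snorm \<epsilon>' (fst (fst z) - fst (snd z) - \<epsilon> *\<^sub>R e) - loc (snd (fst z)) (fst (snd z)) (snd (snd z))))"
      unfolding snorm_def loc_def using \<eta>
      by (intro usc_on_add uscu continuous_imp_usc_on continuous_intros continuous_on_compose2[OF cP[of UNIV]]) auto
    from usc_attains_sup[OF cKc neKc this] show thesis
      by (auto simp: \<Phi>_def V_def algebra_simps intro!: that)
  qed
  \<comment> \<open>The Lipschitz estimate with base point
    \<open>y + \<epsilon> *\<^sub>R e\<close>: there the penalty is only
    \<open>L * \<epsilon>'\<close>, and the maximum over \<open>Kc\<close> provides the bound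
    \<open>Q\<close> at all times.\<close>
  have star: "u (x, t) - v (y, s) - (t - s)\<^sup>2 / \<eta> - P s - loc t y s \<le> \<Phi> zb + L * \<epsilon>' + L0 * norm (x - (y + \<epsilon> *\<^sub>R e))"
    if x: "x \<in> \<Omega>" "norm (x - x0) < r / 4" and y: "y \<in> closure \<Omega>" "norm (y - x0) \<le> r / 8"
      and t: "0 \<le> t" "t \<le> T" and s: "0 \<le> s" "s \<le> T" "\<bar>s - ss\<bar> \<le> r1 / 2" for x t y s
  proof -
    define \<theta> where "\<theta> t' = (t' - s)\<^sup>2 / \<eta> + (t' - ts)\<^sup>2" for t'
    define \<theta>' where "\<theta>' t' = 2 * (t' - s) / \<eta> + 2 * (t' - ts)" for t'
    define Q where "Q = \<Phi> zb + v (y, s) + P s + (y - x0) \<bullet> (y - x0) + (s - ss)\<^sup>2 + L * \<epsilon>'"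
    have sts: "(s - ts)\<^sup>2 \<le> 1"
    proof -
      have "\<bar>s - ts\<bar> \<le> 1" using s(3) ss(3) r1 by linarith
      then show ?thesis by (simp add: abs_square_le_1)
    qed
    have ye: "y + \<epsilon> *\<^sub>R e \<in> \<Omega>" using y \<epsilon> r k0 by (intro inw[of y \<epsilon>]) auto
    have "u (x, t) - \<theta> t \<le> Q + L0 * norm (x - (y + \<epsilon> *\<^sub>R e))"
    proof (rule lip[of \<theta> \<theta>' "y + \<epsilon> *\<^sub>R e" s])
      show "(\<theta> has_real_derivative \<theta>' t) (at t)" for t
        unfolding \<theta>_def \<theta>'_def using \<eta> by (auto intro!: derivative_eq_intros)
      show "continuous_on UNIV \<theta>'" unfolding \<theta>'_def using \<eta> by (intro continuous_intros) auto
      show "\<bar>\<theta>' t'\<bar> \<le> C0" if "0 \<le> t'" "t' \<le> T" for t'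
      proof -
        have "\<bar>t' - s\<bar> \<le> T" "\<bar>t' - ts\<bar> \<le> T" using that s tsT by linarith+
        then have "\<bar>2 * (t' - s) / \<eta>\<bar> \<le> 2 * T / \<eta>" "\<bar>2 * (t' - ts)\<bar> \<le> 2 * T"
          using \<eta> by (auto simp: abs_mult divide_right_mono)
        then show ?thesis unfolding \<theta>'_def C0_def by linarith
      qed
      show "norm (y + \<epsilon> *\<^sub>R e - x0) < r / 4"
        using norm_triangle_ineq[of "y - x0" "\<epsilon> *\<^sub>R e"] ne y(2) \<epsilon>(2) r(1) by (simp add: algebra_simps)
      show "\<theta> s \<le> \<theta> t' + 1" for t' using sts \<eta> by (simp add: \<theta>_def add_increasing)
      have "r1 / 8 \<le> \<bar>0 - s\<bar>" using ss s r1 by linarith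
      from sq\<eta>[OF this] show "\<theta> s + 2 * R + 2 \<le> \<theta> 0" using sts by (simp add: \<theta>_def add_increasing2)
      have "r1 / 8 \<le> \<bar>T - s\<bar>" using ss s r1 unfolding T_def by linarith
      from sq\<eta>[OF this] show "\<theta> s + 2 * R + 2 \<le> \<theta> T" using sts by (simp add: \<theta>_def add_increasing2)
      show "u (y + \<epsilon> *\<^sub>R e, t') - \<theta> t' \<le> Q" if "0 \<le> t'" "t' \<le> T" for t'
      proof -
        have "((y + \<epsilon> *\<^sub>R e, t'), (y, s)) \<in> Kc" using that s y k0 \<epsilon> by (intro KcI) auto
        from zb(2)[OF this] show ?thesis unfolding \<Phi>_eq V_eq by (simp add: sn0 loc_def \<theta>_def Q_def)
      qed
    qed (use x t s ye in auto)
    then show ?thesis unfolding \<theta>_def Q_def loc_def by linarith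
  qed
  \<comment> \<open>The constraint in \<open>Kc\<close> is inactive: beyond distance
    \<open>L * \<epsilon>'\<close> from \<open>y + \<epsilon> *\<^sub>R e\<close> the surplus slope
    \<open>L - L0 = 1\<close> outweighs the smoothing error in \<open>star\<close>.\<close>
  have global: "\<Phi> ((x, t), (y, s)) \<le> \<Phi> zb"
    if x: "x \<in> \<Omega>" "norm (x - x0) < r / 4" and y: "y \<in> closure \<Omega>" "norm (y - x0) \<le> r / 8"
      and t: "0 \<le> t" "t \<le> T" and s: "0 \<le> s" "s \<le> T" "\<bar>s - ss\<bar> \<le> r1 / 2" for x t y s
  proof (cases "norm (x - y - \<epsilon> *\<^sub>R e) \<le> L * \<epsilon>'")
    case True
    then have "norm (x - y - \<epsilon> *\<^sub>R e) \<le> k0 * \<epsilon>" using \<epsilon>'(2) mult_pos_pos[OF k0(1) \<epsilon>(1)] by linarith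
    then show ?thesis using that by (intro zb(2) KcI) auto
  next
    case False
    have w: "x - (y + \<epsilon> *\<^sub>R e) = x - y - \<epsilon> *\<^sub>R e" by simp
    have "L * norm (x - y - \<epsilon> *\<^sub>R e) \<le> L * snorm \<epsilon>' (x - y - \<epsilon> *\<^sub>R e)" using L by (intro mult_left_mono snorm_ge) auto
    then show ?thesis using star[OF that] False unfolding \<Phi>_eq V_eq w by (simp add: L_def algebra_simps)
  qed
  \<comment> \<open>The shift costs little: \<open>star\<close> at a nearly optimal pair close to
    the cluster point passes its value on to the maximum, up to the localization and errors of order
    \<open>L * \<epsilon>\<close>, \<open>L * \<rho>\<close> and
    \<open>L * \<epsilon>'\<close>.\<close>
  have \<Phi>M: "M - \<mu> \<le> \<Phi> zb"
  proof -
    define \<rho> where "\<rho> = min (min (1 / 2) (\<mu> / 16)) (min (min (\<mu> / (8 * L)) (r / 16)) (r1 / 16))"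
    have \<rho>: "0 < \<rho>" "\<rho> \<le> 1" "\<rho> \<le> \<mu> / 16" "\<rho> \<le> r / 16" "\<rho> \<le> r1 / 16" "L * \<rho> \<le> \<mu> / 8"
    proof -
      have p: "0 < \<mu> / (8 * L)" using \<mu> L by simp
      show "0 < \<rho>" "\<rho> \<le> 1" "\<rho> \<le> \<mu> / 16" "\<rho> \<le> r / 16" "\<rho> \<le> r1 / 16"
        using p \<mu>(1) r(1) r1(1) unfolding \<rho>_def by linarith+
      have "\<rho> \<le> \<mu> / (8 * L)" unfolding \<rho>_def by linarith
      then show "L * \<rho> \<le> \<mu> / 8" using L by (simp add: field_simps)
    qed
    obtain x t y s where w: "((x, t), (y, s)) \<in> X" "norm (x - y) \<le> \<rho>" "M - \<rho> \<le> V ((x, t), (y, s))"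
      "norm (x - xs) \<le> \<rho>" "norm (y - ys) \<le> \<rho>" "\<bar>t - ts\<bar> \<le> \<rho>" "\<bar>s - ss\<bar> \<le> \<rho>"
      using approx[OF \<rho>(1)] by blast
    have b: "x \<in> \<Omega>" "y \<in> closure \<Omega>" "0 \<le> t" "t \<le> T" "0 \<le> s" "s \<le> T" using w(1) by (auto simp: X_def)
    have sq: "a\<^sup>2 \<le> \<rho>" if "\<bar>a\<bar> \<le> \<rho>" for a :: real
      using mult_mono[of "\<bar>a\<bar>" \<rho> "\<bar>a\<bar>" 1] that \<rho> by (simp add: power2_eq_square)
    have "loc t y s \<le> 3 * \<rho>"
      using sq[of "norm (y - x0)"] sq[OF w(6)] sq[OF w(7)] w(5) by (simp add: loc_def x0_def power2_norm_eq_inner)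
    moreover have "norm (x - x0) < r / 4" using w(4) \<rho>(4) r(1) xys by (simp add: x0_def)
    moreover have "norm (y - x0) \<le> r / 8" using w(5) \<rho>(4) r(1) by (simp add: x0_def)
    moreover have "\<bar>s - ss\<bar> \<le> r1 / 2" using w(7) \<rho>(5) r1(1) by linarith
    moreover have "L0 * norm (x - (y + \<epsilon> *\<^sub>R e)) \<le> \<mu> / 8 + \<mu> / 8"
    proof -
      have "norm (x - (y + \<epsilon> *\<^sub>R e)) \<le> \<rho> + \<epsilon>" using norm_triangle_ineq4[of "x - y" "\<epsilon> *\<^sub>R e"] w(2) ne by (simp add: algebra_simps)
      then have "L0 * norm (x - (y + \<epsilon> *\<^sub>R e)) \<le> L * (\<rho> + \<epsilon>)" using L0 by (intro mult_mono) (auto simp: L_def)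
      then show ?thesis using \<rho>(6) \<epsilon>(7) by (simp add: distrib_left)
    qed
    ultimately show ?thesis using star[OF b(1) _ b(2) _ b(3,4,5,6)] w(3) \<rho>(3) \<epsilon>'(3) \<mu>(1) unfolding V_eq by fastforce
  qed
  obtain x t y s where zbe: "zb = ((x, t), (y, s))" by (metis surj_pair)
  have zK: "x \<in> closure \<Omega>" "y \<in> closure \<Omega>" "0 \<le> t" "t \<le> T" "0 \<le> s" "s \<le> T" "norm (y - x0) \<le> r / 8" "norm (x - y - \<epsilon> *\<^sub>R e) \<le> k0 * \<epsilon>"
    using zb(1) by (auto simp: zbe Kc_def K_def)
  have x\<Omega>: "x \<in> \<Omega>" by (rule inw[OF _ zK(2) \<epsilon>(1) _ zK(8)]) (use zK(7) \<epsilon> r in linarith)+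
  have zX: "((x, t), (y, s)) \<in> X" using x\<Omega> zK by (simp add: X_def)
  have xy: "norm (x - y) \<le> 2 * \<epsilon>"
  proof -
    have "norm (x - y) \<le> norm (x - y - \<epsilon> *\<^sub>R e) + norm (\<epsilon> *\<^sub>R e)"
      using norm_triangle_ineq[of "x - y - \<epsilon> *\<^sub>R e" "\<epsilon> *\<^sub>R e"] by simp
    then show ?thesis using zK(8) k0\<epsilon> ne \<epsilon>(1) by linarith
  qed
  have loc0: "0 \<le> loc t y s" by (simp add: loc_def)
  have sn_pos: "0 < snorm \<epsilon>' w" for w :: 'a by (rule snorm_pos[OF \<epsilon>'(1)])
  have Lsn: "0 \<le> L * snorm \<epsilon>' (x - y - \<epsilon> *\<^sub>R e)" using L sn_pos[of "x - y - \<epsilon> *\<^sub>R e"] by simp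
  \<comment> \<open>The value of \<open>V\<close> at the maximum lies within \<open>\<mu>\<close> of
    \<open>M\<close> on both sides, which leaves at most \<open>2 * \<mu>\<close> for the
    localization.\<close>
  have V1: "V ((x, t), (y, s)) \<le> M + \<mu>" using VM[OF zX] xy \<epsilon> by linarith
  have V2: "M - \<mu> \<le> V ((x, t), (y, s))" using \<Phi>M Lsn loc0 unfolding zbe \<Phi>_eq by linarith
  have loc2: "loc t y s \<le> 2 * \<mu>" using \<Phi>M Lsn V1 unfolding zbe \<Phi>_eq by linarith
  have small: "norm (y - x0) < \<xi>" "\<bar>t - ts\<bar> < \<xi>" "\<bar>s - ss\<bar> < \<xi>"
  proof -
    have "2 * \<mu> < \<xi>\<^sup>2" using \<mu>(1,2) by linarith
    moreover have "0 \<le> (y - x0) \<bullet> (y - x0)" "0 \<le> (t - ts)\<^sup>2" "0 \<le> (s - ss)\<^sup>2" by auto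
    ultimately have "(norm (y - x0))\<^sup>2 < \<xi>\<^sup>2" "\<bar>t - ts\<bar>\<^sup>2 < \<xi>\<^sup>2" "\<bar>s - ss\<bar>\<^sup>2 < \<xi>\<^sup>2"
      using loc2 unfolding loc_def power2_norm_eq_inner power2_abs by linarith+
    then show "norm (y - x0) < \<xi>" "\<bar>t - ts\<bar> < \<xi>" "\<bar>s - ss\<bar> < \<xi>"
      using \<xi>(1) by (auto intro: power_less_imp_less_base[where n=2] less_imp_le)
  qed
  have "c0 / 4 \<le> V ((x, t), (y, s))" using V2 M(1) \<mu>(4) c0 by linarith
  moreover have "norm (x - y) \<le> r1" using xy \<epsilon>(6) r1 by linarith
  ultimately have gd: "\<bar>t - s\<bar> < r1 / 8" "r1 < t" "r1 < s" "s < t1 + 1 / 2" "y \<in> frontier \<Omega> \<Longrightarrow> v (y, s) < \<phi> (y, s)" "v (y, s) \<le> u (x, t)"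
    using good[OF zX] by auto
  have xx0: "norm (x - x0) < r / 8"
    using norm_triangle_ineq[of "x - y" "y - x0"] xy small(1) \<xi>(2) \<epsilon>(2) r(1) by simp
  obtain d\<Omega> where d\<Omega>: "0 < d\<Omega>" "ball x d\<Omega> \<subseteq> \<Omega>" using open_dom x\<Omega> open_contains_ball by blast
  define d where "d = min (min d\<Omega> (r / 16)) (r1 / 16)"
  have d: "0 < d" "d \<le> d\<Omega>" "d \<le> r / 16" "d \<le> r1 / 16" using d\<Omega>(1) r(1) r1(1) unfolding d_def by linarith+
  \<comment> \<open>The penalty has centre \<open>a1\<close> when read as a function of
    \<open>x\<close> and centre \<open>a2\<close> when read as a function of
    \<open>y\<close>.\<close>
  define a1 where "a1 = y + \<epsilon> *\<^sub>R e"
  define a2 where "a2 = x - \<epsilon> *\<^sub>R e"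
  have C1s: "C1_gradient_on UNIV (\<lambda>z. L * snorm \<epsilon>' (z - a)) (\<lambda>z. L *\<^sub>R ((1 / snorm \<epsilon>' (z - a)) *\<^sub>R (z - a)))" for a :: 'a
    using C1_gradient_on_compose[OF C1_gradient_on_snorm[OF \<epsilon>'(1)], of "\<lambda>r. L * r" "\<lambda>_. L"]
    by (auto intro!: derivative_eq_intros)
  define \<theta>1 where "\<theta>1 t' = (t' - s)\<^sup>2 / \<eta> + (t' - ts)\<^sup>2" for t'
  define \<theta>1' where "\<theta>1' t' = 2 * (t' - s) / \<eta> + 2 * (t' - ts)" for t'
  define \<theta>2 where "\<theta>2 s' = (s' - t)\<^sup>2 / \<eta> + (s' - ss)\<^sup>2 + P s'" for s'
  define \<theta>2' where "\<theta>2' s' = 2 * (s' - t) / \<eta> + 2 * (s' - ss) + P' s'" for s'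
  have \<theta>1: "(\<theta>1 has_real_derivative \<theta>1' t') (at t')" "continuous_on UNIV \<theta>1'" for t'
    unfolding \<theta>1_def \<theta>1'_def using \<eta> by (auto intro!: derivative_eq_intros continuous_intros)
  have \<theta>2: "(\<theta>2 has_real_derivative \<theta>2' t') (at t')" "continuous_on UNIV \<theta>2'" for t'
    unfolding \<theta>2_def \<theta>2'_def using \<eta> by (auto intro!: derivative_eq_intros dP cP' continuous_intros)
  note \<psi>1 = C1_gradient_on_add[OF C1_gradient_on_fst[OF C1s[of a1]] C1_gradient_on_snd[OF \<theta>1], of "Qbar \<Omega>"]
  have C1q: "C1_gradient_on UNIV (\<lambda>z. L * snorm \<epsilon>' (z - a2) + (z - x0) \<bullet> (z - x0)) (\<lambda>z. L *\<^sub>R ((1 / snorm \<epsilon>' (z - a2)) *\<^sub>R (z - a2)) + 2 *\<^sub>R (z - x0))"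
    by (rule C1_gradient_on_add[OF C1s C1_gradient_on_sq_dist])
  note \<psi>2 = C1_gradient_on_minus[OF C1_gradient_on_add[OF C1_gradient_on_fst[OF C1q] C1_gradient_on_snd[OF \<theta>2], of "Qbar \<Omega>"]]
  have sw: "snorm \<epsilon>' (x' - y' - \<epsilon> *\<^sub>R e) = snorm \<epsilon>' (y' - (x' - \<epsilon> *\<^sub>R e))" for x' y' :: 'a
    using snorm_minus[of \<epsilon>' "x' - y' - \<epsilon> *\<^sub>R e"] by (simp add: algebra_simps)
  have sw1: "x' - y - \<epsilon> *\<^sub>R e = x' - a1" for x' by (simp add: a1_def)
  let ?p = "L *\<^sub>R ((1 / snorm \<epsilon>' (x - a1)) *\<^sub>R (x - a1))"
  let ?q = "- (L *\<^sub>R ((1 / snorm \<epsilon>' (y - a2)) *\<^sub>R (y - a2)) + 2 *\<^sub>R (y - x0))"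
  have main: "snd ((?p, 0) + (0, \<theta>1' t)) - snd (- ((L *\<^sub>R ((1 / snorm \<epsilon>' (y - a2)) *\<^sub>R (y - a2)) + 2 *\<^sub>R (y - x0), 0) + (0, \<theta>2' s)))
    \<le> H y (v (y, s)) (fst (- ((L *\<^sub>R ((1 / snorm \<epsilon>' (y - a2)) *\<^sub>R (y - a2)) + 2 *\<^sub>R (y - x0), 0) + (0, \<theta>2' s)))) - H x (v (y, s)) (fst ((?p, 0) + (0, \<theta>1' t)))
    + (f (x, t) - f (y, s)) + 2 * \<Lambda> * (C2 * \<delta> powr (1 - \<sigma>)) + 2 * \<mu> * (C1 * \<delta> powr (- \<sigma>)) + 6 * R * (\<kappa> / (48 * R))"
  proof (rule doubled_inequality[OF x\<Omega> zK(2) _ _ uR vR R gd(6) gd(5) \<psi>1 \<psi>2 d(1) _ _ \<delta>(1) \<delta>'(2), simplified fst_conv snd_conv])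
    fix z assume z: "z \<in> Qbar \<Omega>" "norm (z - (x, t)) < d"
    obtain x' t' where ze: "z = (x', t')" by (cases z)
    have n: "norm (x' - x) < d" "\<bar>t' - t\<bar> < d" using z(2) norm_fst_diff[of z x t] norm_snd_diff[of z t x] by (auto simp: ze)
    have "x' \<in> \<Omega>" using n(1) d(2) d\<Omega>(2) by (auto simp: subset_eq dist_norm norm_minus_commute)
    moreover have "norm (x' - x0) < r / 4" using norm_triangle_ineq[of "x' - x" "x - x0"] n(1) xx0 d(3) r(1) by simp
    moreover have "0 \<le> t'" "t' \<le> T" using n(2) gd r1 d(4) unfolding T_def by linarith+
    moreover have "\<bar>s - ss\<bar> \<le> r1 / 2" using small(3) \<xi>(5) r1(1) by linarith
    ultimately have "\<Phi> ((x', t'), (y, s)) \<le> \<Phi> zb" using zK by (intro global) auto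
    then show "u z - (L * snorm \<epsilon>' (fst z - a1) + \<theta>1 (snd z)) \<le> u (x, t) - (L * snorm \<epsilon>' (x - a1) + \<theta>1 t)"
      unfolding zbe \<Phi>_eq V_eq sw1 loc_def by (simp add: ze \<theta>1_def)
  next
    fix z assume z: "z \<in> Qbar \<Omega>" "norm (z - (y, s)) < d"
    obtain y' s' where ze: "z = (y', s')" by (cases z)
    have n: "norm (y' - y) < d" "\<bar>s' - s\<bar> < d" using z(2) norm_fst_diff[of z y s] norm_snd_diff[of z s y] by (auto simp: ze)
    have "y' \<in> closure \<Omega>" using z(1) by (simp add: ze Qbar_def)
    moreover have "norm (y' - x0) \<le> r / 8" using norm_triangle_ineq[of "y' - y" "y - x0"] n(1) small(1) \<xi>(2) d(3) r(1) by simp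
    moreover have "0 \<le> s'" "s' \<le> T" using n(2) gd r1 d(4) unfolding T_def by linarith+
    moreover have "\<bar>s' - ss\<bar> \<le> r1 / 2" using small(3) \<xi>(5) r1(1) n(2) d(4) by linarith
    ultimately have "\<Phi> ((x, t), (y', s')) \<le> \<Phi> zb" using zK x\<Omega> xx0 r(1) by (intro global) auto
    then show "v (y, s) - - (L * snorm \<epsilon>' (y - a2) + (y - x0) \<bullet> (y - x0) + \<theta>2 s) \<le> v z - - (L * snorm \<epsilon>' (fst z - a2) + (fst z - x0) \<bullet> (fst z - x0) + \<theta>2 (snd z))"
      unfolding zbe \<Phi>_eq V_eq sw loc_def a2_def[symmetric] by (simp add: ze \<theta>2_def power2_commute[of t])
  next
    fix z assume z: "norm z < \<delta>" "x + z \<in> \<Omega>"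
    have "norm (x + z - x0) < r / 4" using norm_triangle_ineq[of "x - x0" z] z(1) xx0 \<delta>'(1) r(1) by (simp add: algebra_simps)
    moreover have "\<bar>s - ss\<bar> \<le> r1 / 2" using small(3) \<xi>(5) r1(1) by linarith
    ultimately have "\<Phi> ((x + z, t), (y, s)) \<le> \<Phi> zb" using z zK by (intro global) auto
    moreover have "L * snorm \<epsilon>' (x + z - a1) \<le> L * snorm \<epsilon>' (x - a1) + L * norm z"
    proof -
      have e: "x + z - a1 = x - a1 + z" by simp
      show ?thesis unfolding e using mult_left_mono[OF snorm_triangle[of \<epsilon>' "x - a1" z], of L] L by (simp add: distrib_left)
    qed
    ultimately have "u (x + z, t) - u (x, t) \<le> L * norm z"
      unfolding zbe \<Phi>_eq V_eq sw1 by linarith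
    also have "\<dots> \<le> \<Lambda> * norm z" by (intro mult_right_mono) (auto simp: \<Lambda>_def)
    finally show "u (x + z, t) - u (x, t) \<le> \<Lambda> * norm z" .
  next
    fix z assume z: "norm z < \<delta>" "y + z \<in> closure \<Omega>"
    have "norm (y + z - x0) \<le> r / 8" using norm_triangle_ineq[of "y - x0" z] z(1) small(1) \<xi>(2) \<delta>'(1) r(1) by (simp add: algebra_simps)
    moreover have "\<bar>s - ss\<bar> \<le> r1 / 2" using small(3) \<xi>(5) r1(1) by linarith
    ultimately have "\<Phi> ((x, t), (y + z, s)) \<le> \<Phi> zb" using z zK x\<Omega> xx0 r(1) by (intro global) auto
    moreover have "L * snorm \<epsilon>' (y + z - a2) \<le> L * snorm \<epsilon>' (y - a2) + L * norm z"
    proof -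
      have e: "y + z - a2 = y - a2 + z" by simp
      show ?thesis unfolding e using mult_left_mono[OF snorm_triangle[of \<epsilon>' "y - a2" z], of L] L by (simp add: distrib_left)
    qed
    moreover have "(y + z - x0) \<bullet> (y + z - x0) - (y - x0) \<bullet> (y - x0) \<le> 3 * norm z"
    proof -
      have e: "y + z - x0 = y - x0 + z" by simp
      have "norm (y - x0) \<le> 1" "norm z \<le> 1" using small(1) \<xi>(2) r z(1) \<delta>'(2) by linarith+
      then show ?thesis unfolding e using sq_penalty_increment[of "y - x0" z] by linarith
    qed
    ultimately have "- (L * norm z + 3 * norm z) \<le> v (y + z, s) - v (y, s)"
      unfolding zbe \<Phi>_eq V_eq sw loc_def a2_def[symmetric] by linarith
    then show "- (\<Lambda> * norm z) \<le> v (y + z, s) - v (y, s)" by (simp add: \<Lambda>_def distrib_right)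
  next
    fix z assume z: "x + z \<in> \<Omega>" "y + z \<in> closure \<Omega>"
    \<comment> \<open>A common jump changes neither \<open>x - y\<close> nor the times, so the bound
      by \<open>M + \<mu>\<close> applies wherever the pair lands, and the increments differ by at
      most \<open>2 * \<mu>\<close>.\<close>
    have "((x + z, t), (y + z, s)) \<in> X" using z zK by (simp add: X_def)
    moreover have "norm (x + z - (y + z)) \<le> \<rho>1" using xy \<epsilon> by simp
    ultimately have "V ((x + z, t), (y + z, s)) \<le> M + \<mu>" by (rule VM)
    then show "u (x + z, t) - u (x, t) \<le> v (y + z, s) - v (y, s) + 2 * \<mu>" using V2 unfolding V_eq by linarith
  next
    show "\<bar>measure (\<nu> x) S - measure (\<nu> y) S\<bar> \<le> \<kappa> / (48 * R)" if "S \<in> sets borel" "S \<subseteq> - ball 0 \<delta>" for S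
      using tv[OF zK(1,2) _ that] xy \<epsilon>(1,4) by linarith
  qed (use zK gd r1 L \<mu>(1) in auto)
  \<comment> \<open>The penalty contributes the same vector to both gradients, as
    \<open>y - a2 = - (x - a1)\<close>; they differ by the localization term alone.\<close>
  have Hd: "\<bar>H y (v (y, s)) ?q - H x (v (y, s)) ?p\<bar> \<le> \<kappa> / 8"
  proof (rule \<xi>H(2)[OF zK(2,1) vR[OF zK(2,5,6)]])
    have yx: "y - a2 = - (x - a1)" by (simp add: a1_def a2_def)
    have np: "norm ?p \<le> L"
    proof -
      have "norm (x - a1) / snorm \<epsilon>' (x - a1) \<le> 1" using sn_pos[of "x - a1"] snorm_ge[of "x - a1" \<epsilon>'] by simp
      from mult_left_mono[OF this, of L] show ?thesis using L sn_pos[of "x - a1"] by simp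
    qed
    have qp: "?q = ?p - 2 *\<^sub>R (y - x0)" unfolding yx snorm_minus by (simp add: scaleR_diff_right)
    have n2: "norm (2 *\<^sub>R (y - x0)) < \<xi>H" "norm (2 *\<^sub>R (y - x0)) \<le> 3" using small(1) \<xi> r by auto
    show "norm ?p \<le> \<Lambda>" using np by (simp add: \<Lambda>_def)
    show "norm ?q \<le> \<Lambda>" unfolding qp using norm_triangle_ineq4[of ?p "2 *\<^sub>R (y - x0)"] np n2 unfolding \<Lambda>_def by linarith
    show "norm (?q - ?p) < \<xi>H" unfolding qp using n2(1) by simp
    show "norm (y - x) < \<xi>H" using xy \<epsilon>(1,5) by (simp add: norm_minus_commute)
  qed
  have fd: "\<bar>f (x, t) - f (y, s)\<bar> \<le> \<kappa> / 8"
    using zK gd(1) xy \<epsilon>(6) r1 r2(1) by (intro r2(2)) auto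
  \<comment> \<open>The derivatives of the penalty on \<open>t - s\<close> cancel. What is left is
    at least \<open>\<kappa> - 4 * \<xi>\<close>, hence at least \<open>15/16\<close> of
    \<open>\<kappa>\<close>, while the five errors add up to \<open>5/8\<close> of it.\<close>
  have "\<theta>1' t + \<theta>2' s = 2 * (t - ts) + 2 * (s - ss) + P' s"
    using \<eta> by (simp add: \<theta>1'_def \<theta>2'_def field_simps)
  moreover have "6 * R * (\<kappa> / (48 * R)) = \<kappa> / 8" using R by simp
  ultimately show False
    using main Hd fd \<delta>'(3) \<mu>D[unfolded D1_def] P'\<kappa>[of s] small(2,3) \<xi>(4) \<kappa>(1) by simp
qed

end

section \<open>From the hypotheses to the conclusion\<close>

lemma levy_setting_exists:
  assumes "open \<Omega>" "bounded \<Omega>" "C1_boundary \<Omega>" "\<sigma> \<in> {0<..<1}"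
    and reg: "\<And>x. x \<in> closure \<Omega> \<Longrightarrow> regular_measure (\<nu> x)"
    and "assm_M0 \<Omega> \<nu>" and M1: "assm_M1 \<sigma> \<Omega> \<nu>" and M2: "assm_M2 \<sigma> \<Omega> \<nu>" and "assm_M3 \<sigma> \<Omega> \<nu>"
  obtains C1 C2 where "levy_setting \<Omega> \<nu> \<sigma> C1 C2"
proof -
  obtain C1 where C1: "0 < C1" "\<And>\<beta> \<delta>. \<beta> \<in> {0..2} \<Longrightarrow> 0 < \<delta> \<Longrightarrow>
      (SUP x\<in>closure \<Omega>. \<integral>\<^sup>+z\<in>- ball 0 \<delta>. ennreal (min 1 (norm z powr \<beta>)) \<partial>\<nu> x) \<le> ennreal (C1 * h_fun \<beta> \<sigma> \<delta>)"
    using M1 unfolding assm_M1_def by auto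
  obtain C2 where C2: "0 < C2" "\<And>\<beta> \<delta>. \<beta> \<in> {\<sigma><..2} \<Longrightarrow> \<delta> \<in> {0<..<1} \<Longrightarrow>
      (SUP x\<in>closure \<Omega>. \<integral>\<^sup>+z\<in>ball 0 \<delta>. ennreal (norm z powr \<beta>) \<partial>\<nu> x) \<le> ennreal (C2 * \<delta> powr (\<beta> - \<sigma>))"
    using M2 unfolding assm_M2_def by auto
  have sets: "sets (\<nu> x) = sets borel" if "x \<in> closure \<Omega>" for x
    using reg[OF that] by (simp add: regular_measure_def)
  have tail: "emeasure (\<nu> x) (- ball 0 \<delta>) \<le> ennreal (C1 * \<delta> powr (- \<sigma>))" if "x \<in> closure \<Omega>" "0 < \<delta>" for x \<delta>
  proof -
    have "emeasure (\<nu> x) (- ball 0 \<delta>) = (\<integral>\<^sup>+z. indicator (- ball 0 \<delta>) z \<partial>\<nu> x)"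
      using sets[OF that(1)] by simp
    also have "\<dots> = (\<integral>\<^sup>+z\<in>- ball 0 \<delta>. ennreal (min 1 (norm z powr 0)) \<partial>\<nu> x)"
      using that(2) by (intro nn_integral_cong) (auto simp: indicator_def)
    also have "\<dots> \<le> (SUP x\<in>closure \<Omega>. \<integral>\<^sup>+z\<in>- ball 0 \<delta>. ennreal (min 1 (norm z powr 0)) \<partial>\<nu> x)"
      by (rule SUP_upper[OF that(1)])
    also have "\<dots> \<le> ennreal (C1 * h_fun 0 \<sigma> \<delta>)" using that(2) by (intro C1) auto
    finally show ?thesis using assms(4) by (simp add: h_fun_def)
  qed
  have near: "(\<integral>\<^sup>+z\<in>ball 0 \<delta>. ennreal (norm z) \<partial>\<nu> x) \<le> ennreal (C2 * \<delta> powr (1 - \<sigma>))"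
    if "x \<in> closure \<Omega>" "0 < \<delta>" "\<delta> < 1" for x \<delta>
  proof -
    have "(\<integral>\<^sup>+z\<in>ball 0 \<delta>. ennreal (norm z) \<partial>\<nu> x) = (\<integral>\<^sup>+z\<in>ball 0 \<delta>. ennreal (norm z powr 1) \<partial>\<nu> x)"
      by simp
    also have "\<dots> \<le> (SUP x\<in>closure \<Omega>. \<integral>\<^sup>+z\<in>ball 0 \<delta>. ennreal (norm z powr 1) \<partial>\<nu> x)"
      by (rule SUP_upper[OF that(1)])
    also have "\<dots> \<le> ennreal (C2 * \<delta> powr (1 - \<sigma>))" using that assms(4) by (intro C2) auto
    finally show ?thesis .
  qed
  have "levy_setting \<Omega> \<nu> \<sigma> C1 C2"
    by (unfold_locales) (use assms C1 C2 sets tail near in \<open>auto simp: assm_M0_def\<close>)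
  then show thesis by (rule that)
qed

context comparison_problem begin

text \<open>An upper limit above \<open>v\<close> would give interior points with a fixed gap
  arbitrarily close to \<open>(y, s)\<close>, which \<open>no_gap\<close> forbids.\<close>

lemma limsup_le:
  assumes "y \<in> closure \<Omega>" "0 \<le> s"
  shows "Limsup (at (y, s) within (\<Omega> \<times> {0..})) (\<lambda>w. ereal (u w)) \<le> ereal (v (y, s))"
  unfolding Limsup_le_iff
proof (intro allI impI)
  fix c assume c: "ereal (v (y, s)) < c"
  show "\<forall>\<^sub>F w in at (y, s) within (\<Omega> \<times> {0..}). ereal (u w) < c"
  proof (cases c)
    case (real c')
    then have "0 < c' - v (y, s)" using c by simp
    then obtain \<rho> where \<rho>: "0 < \<rho>" "\<And>x t. x \<in> \<Omega> \<Longrightarrow> 0 \<le> t \<Longrightarrow> norm (x - y) \<le> \<rho> \<Longrightarrow> \<bar>t - s\<bar> \<le> \<rho> \<Longrightarrow> u (x, t) - v (y, s) < c' - v (y, s)"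
      using no_gap[OF assms, of "c' - v (y, s)"] by (meson not_less)
    have "u w < c'" if "w \<in> \<Omega> \<times> {0..}" "dist w (y, s) < \<rho>" for w
    proof -
      have "norm (fst w - y) \<le> \<rho>" "\<bar>snd w - s\<bar> \<le> \<rho>"
        using that(2) norm_fst_diff[of w y s] norm_snd_diff[of w s y] by (auto simp: dist_norm)
      then show ?thesis using \<rho>(2)[of "fst w" "snd w"] that(1) by auto
    qed
    then show ?thesis using \<rho>(1) real by (auto simp: eventually_at intro!: exI[of _ \<rho>])
  qed (use c in auto)
qed

lemma interior_le:
  assumes "x \<in> \<Omega>" "0 \<le> t"
  shows "u (x, t) \<le> v (x, t)"
proof (rule ccontr)
  assume "\<not> u (x, t) \<le> v (x, t)"
  then show False
    using no_gap[of x t "u (x, t) - v (x, t)"] assms closure_subset[of \<Omega>]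
    by (metis abs_zero cancel_comm_monoid_add_class.diff_cancel diff_gt_0_iff_gt less_imp_le norm_zero not_le order_refl subsetD)
qed

end

theorem proposition4p1:
  fixes \<Omega> :: "'a::euclidean_space set"
    and \<nu> :: "'a \<Rightarrow> 'a measure"
    and \<sigma> m :: real
    and H :: "'a \<Rightarrow> real \<Rightarrow> 'a \<Rightarrow> real"
    and f \<phi> u v :: "'a \<times> real \<Rightarrow> real"
    and u0 :: "'a \<Rightarrow> real"
  assumes "C1_domain \<Omega>" and "bounded \<Omega>"
    and "\<sigma> \<in> {0<..<1}"
    and "\<And>x. x \<in> closure \<Omega> \<Longrightarrow> regular_measure (\<nu> x)"
    and "assm_M0 \<Omega> \<nu>" and "assm_M1 \<sigma> \<Omega> \<nu>" and "assm_M2 \<sigma> \<Omega> \<nu>" and "assm_M3 \<sigma> \<Omega> \<nu>"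
    and "continuous_on (closure \<Omega> \<times> UNIV \<times> UNIV) (\<lambda>(x, r, p). H x r p)"
    and "assm_H1 \<Omega> H" and "assm_H2 m \<Omega> H" and "m > \<sigma>"
    and "continuous_on (Qbar \<Omega>) f"
    and "continuous_on (frontier \<Omega> \<times> {0..}) \<phi>"
    and "continuous_on (closure \<Omega>) u0"
    and "\<And>x. x \<in> frontier \<Omega> \<Longrightarrow> u0 x = \<phi> (x, 0)"
    and "visc_subsolution \<Omega> \<nu> H f \<phi> u0 u"
    and "visc_supersolution \<Omega> \<nu> H f \<phi> u0 v"
    and "locally_bounded_on (Qbar \<Omega>) u" and "locally_bounded_on (Qbar \<Omega>) v"
  shows "(\<forall>z \<in> Qcyl \<Omega> \<union> closure \<Omega> \<times> {0}. u z \<le> v z) \<and>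
    (\<forall>z \<in> Qbar \<Omega>. u_tilde \<Omega> u z \<le> ereal (v z))"
proof -
  obtain C1 C2 where "levy_setting \<Omega> \<nu> \<sigma> C1 C2"
    using levy_setting_exists[of \<Omega> \<sigma> \<nu>] assms(1-8) unfolding C1_domain_def by blast
  then interpret comparison_problem \<Omega> \<nu> \<sigma> C1 C2 m H f \<phi> u v u0
    using assms by (intro comparison_problem.intro comparison_problem_axioms.intro) auto
  have 0: "u (x, 0) \<le> v (x, 0)" if "x \<in> closure \<Omega>" for x
    using u_initial[OF that] v_initial[OF that] by linarith
  show ?thesis
  proof (intro conjI ballI)
    fix z assume "z \<in> Qcyl \<Omega> \<union> closure \<Omega> \<times> {0}"
    then show "u z \<le> v z" using interior_le 0 by (auto simp: Qcyl_def)
  next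
    fix z assume "z \<in> Qbar \<Omega>"
    then obtain x t where z: "z = (x, t)" "x \<in> closure \<Omega>" "0 \<le> t" by (auto simp: Qbar_def)
    show "u_tilde \<Omega> u z \<le> ereal (v z)"
    proof (cases "z \<in> lateral \<Omega>")
      case True
      then show ?thesis using limsup_le[OF z(2,3)] by (simp add: u_tilde_def z)
    next
      case False
      \<comment> \<open>\<open>lateral\<close> leaves out time 0, so the bottom edge falls under the
        initial inequality.\<close>
      then have "x \<in> \<Omega> \<or> t = 0" using z open_dom by (auto simp: lateral_def frontier_def interior_open)
      then have "u z \<le> v z" using interior_le[of x t] 0[OF z(2)] z by auto
      then show ?thesis using False by (simp add: u_tilde_def)
    qed
  qed
qed

end
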